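(* Let $\Omega\subset\mathbb{C}$ be an open set. Then the following are equivalent: (1) $A^{2}(\Omega)\neq\{0\}$. (2) $\dim A^{2}(\Omega)=\infty$. (3) $\operatorname{cap}(\Omega^{c})>0$. (4) There exists a bounded function $\varphi\in\mathcal{C}^{\infty}(\Omega)$ such that $\triangle\varphi(z)>0$ for all $z\in\Omega$.
   Context: $A^{2}(\Omega)$ is the Bergman space of $\Omega$: the closed subspace of $L^{2}(\Omega)$ consisting of the functions holomorphic on $\Omega$, where $L^{2}(\Omega)$ is the space of functions on $\Omega$ that are square-integrable with respect to Lebesgue measure. $\mathcal{C}^{\infty}(\Omega)$ is the family of smooth functions on $\Omega$, $\triangle$ is the Laplacian, and $\Omega^{c}=\mathbb{C}\setminus\Omega$. For a finite Borel measure $\mu$ with compact support in $\mathbb{C}$, the energy is $I_{\mu}=\int_{\mathbb{C}}\int_{\mathbb{C}}\ln|z-w|\,d\mu(w)\,d\mu(z)\in[-\infty,\infty)$. The logarithmic capacity of a set $E\subset\mathbb{C}$ is $\operatorname{cap}(E)=\sup_{\mu}e^{I_{\mu}}$, the supremum being over all Borel probability measures $\mu$ with compact support contained in $E$ (with $e^{-\infty}=0$ and $\operatorname{cap}(\emptyset)=0$).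
   Formalization: The open set Ω is assumed non-empty; for Ω = ∅ the stated equivalence fails, since A²(∅) = {0} while cap(ℂ) > 0 and condition (4) holds vacuously. *)

theory Defs
  imports "HOL-Complex_Analysis.Complex_Analysis" "HOL-Probability.Probability_Measure"
    "HOL-Library.Function_Algebras"
begin

section \<open>The Bergman space\<close>

definition square_integrable_on :: "(complex \<Rightarrow> complex) \<Rightarrow> complex set \<Rightarrow> bool"
    (infixr "square'_integrable'_on" 46) where
  "f square_integrable_on S \<longleftrightarrow>
     set_borel_measurable lborel S f \<and> set_integrable lborel S (\<lambda>z. (norm (f z))\<^sup>2)"

text \<open>A function on \<open>\<Omega>\<close> is represented by its extension by zero, so that two elements are equal
  in HOL iff they agree on \<open>\<Omega>\<close>. Passing to classes modulo null sets is unnecessary: holomorphic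
  functions on an open set that agree almost everywhere agree everywhere.\<close>

definition bergman_space :: "complex set \<Rightarrow> (complex \<Rightarrow> complex) set" where
  "bergman_space \<Omega> =
     {f. f holomorphic_on \<Omega> \<and> f square_integrable_on \<Omega> \<and> (\<forall>z. z \<notin> \<Omega> \<longrightarrow> f z = 0)}"

definition cfun_scale :: "complex \<Rightarrow> (complex \<Rightarrow> complex) \<Rightarrow> complex \<Rightarrow> complex" where
  "cfun_scale c f = (\<lambda>z. c * f z)"

interpretation cfun: vector_space cfun_scale
  by unfold_locales (auto simp: cfun_scale_def fun_eq_iff algebra_simps)

text \<open>The library's \<open>dim\<close> is a natural number, which is a junk value in the infinite-dimensional
  case, so \<open>dim V = \<infinity>\<close> is stated as the absence of a finite spanning set.\<close>

definition infinite_dimensional :: "(complex \<Rightarrow> complex) set \<Rightarrow> bool" where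
  "infinite_dimensional V \<longleftrightarrow> \<not> (\<exists>B. finite B \<and> B \<subseteq> V \<and> V \<subseteq> cfun.span B)"

lemma subspace_bergman_space:
  assumes "open \<Omega>"
  shows "cfun.subspace (bergman_space \<Omega>)"
proof (rule cfun.subspaceI)
  show "0 \<in> bergman_space \<Omega>"
    by (auto simp: bergman_space_def square_integrable_on_def set_borel_measurable_def
        set_integrable_def zero_fun_def)
next
  fix f g assume fg: "f \<in> bergman_space \<Omega>" "g \<in> bergman_space \<Omega>"
  have meas: "set_borel_measurable lborel \<Omega> f" "set_borel_measurable lborel \<Omega> g"
    and int: "set_integrable lborel \<Omega> (\<lambda>z. (norm (f z))\<^sup>2)"
      "set_integrable lborel \<Omega> (\<lambda>z. (norm (g z))\<^sup>2)"
    using fg by (auto simp: bergman_space_def square_integrable_on_def)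
  have meas': "set_borel_measurable lborel \<Omega> (f + g)"
    using borel_measurable_add[OF meas[unfolded set_borel_measurable_def]]
    by (simp add: set_borel_measurable_def scaleR_add_right)
  have "integrable lborel (\<lambda>z. (norm (indicator \<Omega> z *\<^sub>R (f + g) z))\<^sup>2)"
  proof (rule Bochner_Integration.integrable_bound)
    show "integrable lborel (\<lambda>z. 2 * (indicator \<Omega> z *\<^sub>R (norm (f z))\<^sup>2)
            + 2 * (indicator \<Omega> z *\<^sub>R (norm (g z))\<^sup>2))"
      using int by (intro Bochner_Integration.integrable_add integrable_mult_right)
        (auto simp: set_integrable_def)
    show "(\<lambda>z. (norm (indicator \<Omega> z *\<^sub>R (f + g) z))\<^sup>2) \<in> borel_measurable lborel"
      using meas'[unfolded set_borel_measurable_def] by measurable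
    have "(norm (a + b))\<^sup>2 \<le> 2 * (norm a)\<^sup>2 + 2 * (norm b)\<^sup>2" for a b :: complex
    proof -
      have "(norm (a + b))\<^sup>2 \<le> (norm a + norm b)\<^sup>2"
        by (simp add: norm_triangle_ineq power_mono)
      also have "\<dots> \<le> 2 * (norm a)\<^sup>2 + 2 * (norm b)\<^sup>2"
        using sum_squares_bound[of "norm a" "norm b"] by (simp add: power2_sum)
      finally show ?thesis .
    qed
    then show "AE z in lborel. norm ((norm (indicator \<Omega> z *\<^sub>R (f + g) z))\<^sup>2)
        \<le> norm (2 * (indicator \<Omega> z *\<^sub>R (norm (f z))\<^sup>2)
            + 2 * (indicator \<Omega> z *\<^sub>R (norm (g z))\<^sup>2))"
      by (auto simp: indicator_def)
  qed
  moreover have "(norm (indicator \<Omega> z *\<^sub>R (f + g) z))\<^sup>2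
      = indicator \<Omega> z *\<^sub>R (norm ((f + g) z))\<^sup>2" for z
    by (auto simp: indicator_def)
  ultimately have "set_integrable lborel \<Omega> (\<lambda>z. (norm ((f + g) z))\<^sup>2)"
    by (simp add: set_integrable_def)
  with meas' fg show "f + g \<in> bergman_space \<Omega>"
    by (auto simp: bergman_space_def square_integrable_on_def plus_fun_def
        intro: holomorphic_on_add)
next
  fix c f assume f: "f \<in> bergman_space \<Omega>"
  have "set_borel_measurable lborel \<Omega> (cfun_scale c f)"
  proof -
    have "(\<lambda>z. c * (indicator \<Omega> z *\<^sub>R f z)) \<in> borel_measurable lborel"
      using f unfolding bergman_space_def square_integrable_on_def set_borel_measurable_def
      by (intro borel_measurable_times) auto
    then show ?thesis
      by (simp add: set_borel_measurable_def cfun_scale_def)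
  qed
  moreover have "set_integrable lborel \<Omega> (\<lambda>z. (norm (cfun_scale c f z))\<^sup>2)"
    using f by (auto simp: bergman_space_def square_integrable_on_def cfun_scale_def
        norm_mult power_mult_distrib)
  ultimately show "cfun_scale c f \<in> bergman_space \<Omega>"
    using f by (auto simp: bergman_space_def square_integrable_on_def cfun_scale_def
        intro: holomorphic_on_mult)
qed


section \<open>Logarithmic capacity\<close>

definition measure_support :: "'a::topological_space measure \<Rightarrow> 'a set" where
  "measure_support \<mu> = {x. \<forall>U. open U \<and> x \<in> U \<longrightarrow> emeasure \<mu> U > 0}"

text \<open>Integral of an extended real function as the difference of the integrals of its positive and
  negative parts (\<open>e2ennreal\<close> sends negative numbers to 0). It is only meaningful
  if one of the two is finite.\<close>

definition ereal_integral :: "'a measure \<Rightarrow> ('a \<Rightarrow> ereal) \<Rightarrow> ereal" where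
  "ereal_integral M f =
     enn2ereal (\<integral>\<^sup>+x. e2ennreal (f x) \<partial>M) - enn2ereal (\<integral>\<^sup>+x. e2ennreal (- f x) \<partial>M)"

text \<open>The logarithm with the value \<open>-\<infinity>\<close> at 0, whereas the library has \<^term>\<open>ln (0::real) = 0\<close>.\<close>

definition log_dist :: "complex \<Rightarrow> complex \<Rightarrow> ereal" where
  "log_dist z w = (if z = w then -\<infinity> else ereal (ln (norm (z - w))))"

definition energy :: "complex measure \<Rightarrow> ereal" where
  "energy \<mu> = ereal_integral \<mu> (\<lambda>z. ereal_integral \<mu> (\<lambda>w. log_dist z w))"

definition exp_ereal :: "ereal \<Rightarrow> ennreal" where
  "exp_ereal x =
     (case x of ereal r \<Rightarrow> ennreal (exp r) | PInfty \<Rightarrow> \<infinity> | MInfty \<Rightarrow> 0)"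

text \<open>In \<^typ>\<open>ennreal\<close> the supremum of the empty set is 0, so the capacity of \<open>{}\<close> is 0.\<close>

definition log_capacity :: "complex set \<Rightarrow> ennreal" where
  "log_capacity E =
     (SUP \<mu> \<in> {\<mu>. sets \<mu> = sets borel \<and> prob_space \<mu> \<and>
                    compact (measure_support \<mu>) \<and> measure_support \<mu> \<subseteq> E}.
        exp_ereal (energy \<mu>))"


section \<open>Smooth functions and the Laplacian\<close>

primrec Ck_on :: "nat \<Rightarrow> ('a::real_normed_vector \<Rightarrow> 'b::real_normed_vector) \<Rightarrow> 'a set \<Rightarrow> bool" where
  "Ck_on 0 f S \<longleftrightarrow> continuous_on S f"
| "Ck_on (Suc k) f S \<longleftrightarrow> (\<forall>x\<in>S. f differentiable (at x)) \<and>
     (\<forall>v. Ck_on k (\<lambda>x. frechet_derivative f (at x) v) S)"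

definition smooth_on :: "('a::real_normed_vector \<Rightarrow> 'b::real_normed_vector) \<Rightarrow> 'a set \<Rightarrow> bool"
    (infixr "smooth'_on" 46) where
  "f smooth_on S \<longleftrightarrow> (\<forall>k. Ck_on k f S)"

text \<open>For \<^typ>\<open>complex\<close> the basis is \<open>{1, \<i>}\<close>, so this is
  \<open>\<partial>\<^sup>2/\<partial>x\<^sup>2 + \<partial>\<^sup>2/\<partial>y\<^sup>2\<close>.\<close>

definition laplacian :: "('a::euclidean_space \<Rightarrow> real) \<Rightarrow> 'a \<Rightarrow> real" where
  "laplacian f x =
     (\<Sum>b\<in>Basis. frechet_derivative (\<lambda>y. frechet_derivative f (at y) b) (at x) b)"

end

theory Submission
  imports Defs
begin

text \<open>
  Write \<open>E\<close> for the complement of \<open>\<Omega>\<close>. Both the Bergman space and the bounded subharmonic functions see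
  \<open>E\<close> only through its capacity, for two opposite reasons.

  If \<open>E\<close> has positive capacity, it carries a probability measure \<open>\<mu>\<close> of finite energy. Since the integral
  of \<open>1 / (\<bar>z - w\<bar> \<bar>z - w'\<bar>)\<close> over a disc grows only like \<open>log (1 / \<bar>w - w'\<bar>)\<close>
  (\<open>nn_integral_cauchy_kernel_product\<close>), the Cauchy transform of \<open>g\<mu>\<close> is locally square integrable for
  every bounded \<open>g\<close>, and it is square integrable at infinity as soon as \<open>\<integral> g d\<mu> = 0\<close>. These transforms
  span an infinite-dimensional space: a linear relation between their Taylor coefficients at a point of
  \<open>\<Omega>\<close> would make a nonconstant polynomial in \<open>1 / (w - z0)\<close> constant \<open>\<mu>\<close>-almost everywhere, while
  \<open>\<mu>\<close> has no atoms (\<open>positive_capacity_bergman_infinite_dimensional\<close>). Moreover, some restriction of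
  \<open>\<mu>\<close> has a logarithmic potential \<open>p\<close> that is bounded below on bounded sets, and \<open>ln (1 + \<bar>z\<bar>\<^sup>2) - 2 p\<close>
  is then bounded with Laplacian \<open>4 / (1 + \<bar>z\<bar>\<^sup>2)\<^sup>2\<close>
  (\<open>positive_capacity_bounded_subharmonic\<close>).

  If \<open>E\<close> has capacity zero, there are cutoff functions \<open>\<eta>\<close> with compact support in \<open>\<Omega>\<close>, equal to 1 on
  a fixed disc, with arbitrarily small Dirichlet energy (\<open>exists_cutoff_small_energy\<close>). Integration by
  parts against \<open>\<eta>\<close> finishes both cases. The Cauchy formula bounds \<open>\<bar>f z0\<bar>\<close> by the product of the
  square norms of \<open>f\<close> and of the gradient of \<open>\<eta>\<close>, so that \<open>f = 0\<close>
  (\<open>zero_capacity_bergman_eq_0\<close>); the Caccioppoli inequality bounds \<open>\<integral> \<eta>\<^sup>2 e\<^sup>\<phi> \<Delta>\<phi>\<close> by the energy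
  of \<open>\<eta>\<close> (\<open>caccioppoli\<close>).

  The cutoffs come from an electrical network, which stands in for weak compactness of measures and for
  equilibrium measures. Subdivide a large square dyadically and put a unit resistor on every edge of the
  resulting quadtree, keeping the cells that meet \<open>E\<close>. The conductance of the tree cut off at depth
  \<open>N\<close> decreases in \<open>N\<close>. If the limit is positive, the limiting unit current is a family of masses of
  cells, hence a measure on \<open>E\<close>, and the finite dissipated power bounds its logarithmic energy
  (\<open>log_capacity_pos_of_conductance\<close>). If the limit is zero, the unit current of the truncated tree,
  placed on finitely many points of \<open>E\<close>, has a regularised logarithmic potential of size comparable to
  the resistance \<open>V\<close> near \<open>E\<close>, while its Dirichlet energy is at most of order \<open>V\<close>; dividing by \<open>V\<close>
  makes the energy of order \<open>1 / V\<close> (\<open>equilibrium_potential\<close>).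
\<close>

section \<open>Radial integrals and a regularised Cauchy kernel\<close>

lemma emeasure_lborel_ball_complex:
  fixes w :: complex assumes "r \<ge> 0" shows "emeasure lborel (ball w r) = ennreal (pi * r\<^sup>2)"
  using emeasure_ball[of r w] assms by (simp add: unit_ball_vol_2)

text \<open>Polar coordinates for radial functions: both measures give \<open>{..<r}\<close> the area of a
  disc of radius \<open>r\<close>.\<close>

lemma distr_lborel_norm_complex:
  "distr (lborel :: complex measure) borel norm
     = density lborel (\<lambda>r. ennreal (2 * pi * r) * indicator {0<..} r)" (is "?M = ?N")
proof -
  let ?f = "\<lambda>r::real. ennreal (2 * pi * r) * indicator {0<..} r"
  have L: "emeasure ?M {..<r} = ennreal (pi * (max 0 r)\<^sup>2)" for r :: real
  proof -
    have "emeasure ?M {..<r} = emeasure lborel (ball (0::complex) r)"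
      by (subst emeasure_distr) (auto intro!: arg_cong[where f="emeasure lborel"])
    also have "\<dots> = ennreal (pi * (max 0 r)\<^sup>2)"
      using emeasure_lborel_ball_complex[of r 0] by (cases "r \<ge> 0") (auto simp: max_def ball_empty)
    finally show ?thesis .
  qed
  have R: "emeasure ?N {..<r} = ennreal (pi * (max 0 r)\<^sup>2)" for r :: real
  proof (cases "r > 0")
    case True
    have "emeasure ?N {..<r} = (\<integral>\<^sup>+x. ?f x * indicator {..<r} x \<partial>lborel)"
      by (subst emeasure_density) auto
    also have "\<dots> = (\<integral>\<^sup>+x. ennreal (2 * pi * x) * indicator {0..r} x \<partial>lborel)"
      using AE_lborel_singleton[of r] by (intro nn_integral_cong_AE) (auto simp: indicator_def elim!: eventually_mono)
    also have "\<dots> = ennreal (pi * r\<^sup>2 - pi * 0\<^sup>2)"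
      using True by (intro nn_integral_FTC_Icc) (auto intro!: derivative_eq_intros)
    finally show ?thesis using True by (simp add: max_def)
  next
    case False
    have "emeasure ?N {..<r} = (\<integral>\<^sup>+x. ?f x * indicator {..<r} x \<partial>lborel)"
      by (subst emeasure_density) auto
    also have "\<dots> = (\<integral>\<^sup>+(x::real). 0 \<partial>lborel)"
      using False by (intro nn_integral_cong) (auto simp: indicator_def)
    finally show ?thesis using False by (simp add: max_def)
  qed
  show ?thesis
  proof (rule measure_eqI_generator_eq[where E = "range lessThan" and A = "\<lambda>n. {..<real n}" and \<Omega> = UNIV])
    show "Int_stable (range lessThan :: real set set)"
    proof (rule Int_stableI)
      fix a b :: "real set" assume "a \<in> range lessThan" "b \<in> range lessThan"
      then obtain x y where "a = {..<x}" "b = {..<y}" by auto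
      then have "a \<inter> b = {..<min x y}" by auto
      then show "a \<inter> b \<in> range lessThan" by blast
    qed
    show "(\<Union>n. {..<real n}) = (UNIV::real set)"
      by (auto simp: reals_Archimedean2)
    show "sets ?M = sigma_sets UNIV (range lessThan)" "sets ?N = sigma_sets UNIV (range lessThan)"
      by (simp_all add: borel_Iio)
    fix n show "emeasure ?M {..<real n} \<noteq> \<infinity>" unfolding L by simp
    fix X :: "real set" assume "X \<in> range lessThan"
    then obtain x where "X = {..<x}" by auto
    with L R show "emeasure ?M X = emeasure ?N X" by simp
  qed auto
qed

lemma nn_integral_radial:
  assumes [measurable]: "h \<in> borel_measurable borel"
  shows "(\<integral>\<^sup>+z. h (norm (z::complex)) \<partial>lborel)
       = (\<integral>\<^sup>+r. ennreal (2 * pi * r) * indicator {0<..} r * h r \<partial>lborel)"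
proof -
  have "(\<integral>\<^sup>+z. h (norm (z::complex)) \<partial>lborel) = (\<integral>\<^sup>+r. h r \<partial>distr (lborel :: complex measure) borel norm)"
    by (subst nn_integral_distr) auto
  also have "\<dots> = (\<integral>\<^sup>+r. ennreal (2 * pi * r) * indicator {0<..} r * h r \<partial>lborel)"
    unfolding distr_lborel_norm_complex by (subst nn_integral_density) auto
  finally show ?thesis .
qed

text \<open>The kernel is \<open>1 / (\<rho> r)\<close> inside radius \<open>\<rho>\<close>, which
  contributes the constant, and \<open>1 / r\<^sup>2\<close> outside, which contributes the
  logarithm.\<close>

lemma nn_integral_log_kernel:
  fixes \<rho> R :: real assumes "0 < \<rho>" "\<rho> \<le> R"
  shows "(\<integral>\<^sup>+z. ennreal (indicator {..<R} (norm z) / (norm z * max (norm z) \<rho>)) \<partial>(lborel :: complex measure))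
       \<le> ennreal (2 * pi * (1 + ln (R / \<rho>)))"
proof -
  let ?h = "\<lambda>r::real. ennreal (indicator {..<R} r / (r * max r \<rho>))"
  have "(\<integral>\<^sup>+z. ?h (norm (z::complex)) \<partial>lborel)
       = (\<integral>\<^sup>+r. ennreal (2 * pi * r) * indicator {0<..} r * ?h r \<partial>lborel)"
    by (rule nn_integral_radial) measurable
  also have "\<dots> \<le> (\<integral>\<^sup>+r. ennreal (2 * pi / \<rho>) * indicator {0..\<rho>} r + ennreal (2 * pi / r) * indicator {\<rho>..R} r \<partial>lborel)"
  proof (rule nn_integral_mono)
    fix r :: real
    show "ennreal (2 * pi * r) * indicator {0<..} r * ?h r
        \<le> ennreal (2 * pi / \<rho>) * indicator {0..\<rho>} r + ennreal (2 * pi / r) * indicator {\<rho>..R} r"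
    proof (cases "0 < r \<and> r < R")
      case True
      then have *: "ennreal (2 * pi * r) * indicator {0<..} r * ?h r = ennreal (2 * pi / max r \<rho>)"
        by (simp add: ennreal_mult'[symmetric])
      show ?thesis
      proof (cases "r \<le> \<rho>")
        case True with \<open>0 < r \<and> r < R\<close> show ?thesis unfolding * by (simp add: max_def)
      next
        case False with \<open>0 < r \<and> r < R\<close> show ?thesis unfolding * by (simp add: max_def)
      qed
    next
      case False then show ?thesis by (auto simp: indicator_def)
    qed
  qed
  also have "\<dots> = (\<integral>\<^sup>+r. ennreal (2 * pi / \<rho>) * indicator {0..\<rho>} r \<partial>lborel)
      + (\<integral>\<^sup>+r. ennreal (2 * pi / r) * indicator {\<rho>..R} r \<partial>lborel)"
    by (rule nn_integral_add) auto
  also have "(\<integral>\<^sup>+r. ennreal (2 * pi / \<rho>) * indicator {0..\<rho>} r \<partial>lborel) = ennreal (2 * pi)"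
    using assms by (subst nn_integral_cmult) (auto simp: ennreal_mult[symmetric])
  also have "(\<integral>\<^sup>+r. ennreal (2 * pi / r) * indicator {\<rho>..R} r \<partial>lborel) = ennreal (2 * pi * ln R - 2 * pi * ln \<rho>)"
    using assms by (intro nn_integral_FTC_Icc[where F="\<lambda>r. 2 * pi * ln r"]) (auto intro!: derivative_eq_intros)
  also have "ennreal (2 * pi) + ennreal (2 * pi * ln R - 2 * pi * ln \<rho>) = ennreal (2 * pi * (1 + ln (R / \<rho>)))"
    using assms by (subst ennreal_plus[symmetric]) (auto simp: ln_div algebra_simps)
  finally show ?thesis .
qed


lemma nn_integral_lborel_shift:
  fixes c :: complex
  assumes [measurable]: "h \<in> borel_measurable borel"
  shows "(\<integral>\<^sup>+z. h (z - c) \<partial>lborel) = (\<integral>\<^sup>+z. h z \<partial>lborel)"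
proof -
  have "(\<integral>\<^sup>+z. h z \<partial>lborel) = (\<integral>\<^sup>+z. h z \<partial>distr lborel borel ((+) (- c)))"
    by (simp only: lborel_distr_plus)
  also have "\<dots> = (\<integral>\<^sup>+z. h (z - c) \<partial>lborel)"
    by (subst nn_integral_distr) auto
  finally show ?thesis ..
qed

text \<open>For \<open>\<delta> = 0\<close> this is the modulus of the Cauchy kernel, with value 0 at the
  origin; in general it is the modulus of the gradient of \<open>ln (\<bar>u\<bar>\<^sup>2 +
  \<delta>\<^sup>2) / 2\<close>.\<close>

definition cauchy_kernel :: "real \<Rightarrow> complex \<Rightarrow> real" where
  "cauchy_kernel \<delta> u = norm u / ((norm u)\<^sup>2 + \<delta>\<^sup>2)"

lemma cauchy_kernel_nonneg: "0 \<le> cauchy_kernel \<delta> u"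
  by (simp add: cauchy_kernel_def)

lemma cauchy_kernel_measurable [measurable]: "cauchy_kernel \<delta> \<in> borel_measurable borel"
  unfolding cauchy_kernel_def by measurable

lemma cauchy_kernel_le_inverse:
  assumes "0 < m" "m \<le> max (norm u) (2 * \<delta>)" "u \<noteq> 0"
  shows "cauchy_kernel \<delta> u \<le> 1 / m"
proof -
  have "norm u * m \<le> (norm u)\<^sup>2 + \<delta>\<^sup>2"
  proof (cases "m \<le> norm u")
    case True
    then have "norm u * m \<le> norm u * norm u" by (intro mult_left_mono) auto
    then show ?thesis by (simp add: power2_eq_square add_increasing2)
  next
    case False
    then have "norm u * m \<le> norm u * (2 * \<delta>)" using assms by (intro mult_left_mono) auto
    also have "\<dots> \<le> (norm u)\<^sup>2 + \<delta>\<^sup>2" using sum_squares_bound[of "norm u" \<delta>] by simp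
    finally show ?thesis .
  qed
  moreover have "(norm u)\<^sup>2 + \<delta>\<^sup>2 > 0" using assms by (simp add: add_pos_nonneg)
  ultimately show ?thesis using assms by (simp add: cauchy_kernel_def divide_simps)
qed

text \<open>The farther of two points is at distance at least half of their separation, so only one of the
  two kernels is singular at a time. The parameter \<open>\<delta>\<close> plays the role of a
  minimal separation.\<close>

lemma cauchy_kernel_product_le:
  assumes "0 < \<rho>" "\<rho> \<le> max (norm (u - v)) \<delta>" "norm u \<le> norm v"
  shows "cauchy_kernel \<delta> u * cauchy_kernel \<delta> v \<le> 1 / (norm u * max (norm u) (\<rho> / 2))"
proof (cases "u = 0")
  case True then show ?thesis by (simp add: cauchy_kernel_def)
next
  case False
  then have v: "v \<noteq> 0" using assms by auto
  have "norm (u - v) \<le> norm u + norm v" by (rule norm_triangle_ineq4)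
  then have "max (norm u) (\<rho> / 2) \<le> max (norm v) (2 * \<delta>)"
    using assms by (auto simp: max_def split: if_splits)
  then have "cauchy_kernel \<delta> v \<le> 1 / max (norm u) (\<rho> / 2)"
    using assms v by (intro cauchy_kernel_le_inverse) (auto simp: max_def)
  moreover have "cauchy_kernel \<delta> u \<le> 1 / norm u"
    using False by (intro cauchy_kernel_le_inverse) auto
  ultimately have "cauchy_kernel \<delta> u * cauchy_kernel \<delta> v \<le> (1 / norm u) * (1 / max (norm u) (\<rho> / 2))"
    by (intro mult_mono) (auto simp: cauchy_kernel_nonneg)
  then show ?thesis by simp
qed

text \<open>This is where the logarithm in the definition of the energy meets square integrability: the
  inner product of two Cauchy kernels on a disc is a logarithmic kernel.\<close>

lemma nn_integral_cauchy_kernel_product: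
  assumes w: "norm w < M" "norm w' < M" and rho: "0 < \<rho>" "\<rho> \<le> max (norm (w - w')) \<delta>" "\<rho> \<le> 4 * M"
  shows "(\<integral>\<^sup>+z. ennreal (indicator (ball 0 M) z * (cauchy_kernel \<delta> (z - w) * cauchy_kernel \<delta> (z - w'))) \<partial>lborel)
      \<le> ennreal (4 * pi * (1 + ln (4 * M / \<rho>)))"
proof -
  define h where "h = (\<lambda>u::complex. ennreal (indicator {..<2 * M} (norm u) / (norm u * max (norm u) (\<rho> / 2))))"
  have [measurable]: "h \<in> borel_measurable borel" unfolding h_def by measurable
  have le: "ennreal (indicator (ball 0 M) z * (cauchy_kernel \<delta> (z - a) * cauchy_kernel \<delta> (z - b))) \<le> h (z - a)"
    if "norm a < M" "\<rho> \<le> max (norm (a - b)) \<delta>" "norm (z - a) \<le> norm (z - b)" for z a b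
  proof (cases "norm z < M")
    case True
    have "norm (z - a) < 2 * M" using norm_triangle_ineq4[of z a] True that by linarith
    moreover have "cauchy_kernel \<delta> (z - a) * cauchy_kernel \<delta> (z - b)
        \<le> 1 / (norm (z - a) * max (norm (z - a)) (\<rho> / 2))"
      using that rho by (intro cauchy_kernel_product_le) (auto simp: norm_minus_commute)
    ultimately show ?thesis using True by (auto simp: h_def intro!: ennreal_leI)
  qed (simp add: h_def)
  have "(\<integral>\<^sup>+z. ennreal (indicator (ball 0 M) z * (cauchy_kernel \<delta> (z - w) * cauchy_kernel \<delta> (z - w'))) \<partial>lborel)
      \<le> (\<integral>\<^sup>+z. h (z - w) + h (z - w') \<partial>lborel)"
  proof (rule nn_integral_mono)
    fix z :: complex
    show "ennreal (indicator (ball 0 M) z * (cauchy_kernel \<delta> (z - w) * cauchy_kernel \<delta> (z - w')))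
        \<le> h (z - w) + h (z - w')"
    proof (cases "norm (z - w) \<le> norm (z - w')")
      case True
      from le[OF w(1) rho(2) True] show ?thesis by (simp add: add_increasing2)
    next
      case False
      then have "norm (z - w') \<le> norm (z - w)" by simp
      from le[OF w(2) _ this] rho show ?thesis
        by (simp add: add_increasing mult.commute norm_minus_commute)
    qed
  qed
  also have "\<dots> = (\<integral>\<^sup>+z. h (z - w) \<partial>lborel) + (\<integral>\<^sup>+z. h (z - w') \<partial>lborel)"
    by (rule nn_integral_add) auto
  also have "\<dots> = (\<integral>\<^sup>+z. h z \<partial>lborel) + (\<integral>\<^sup>+z. h z \<partial>lborel)"
    by (simp add: nn_integral_lborel_shift)
  also have "\<dots> \<le> ennreal (2 * pi * (1 + ln (2 * M / (\<rho> / 2)))) + ennreal (2 * pi * (1 + ln (2 * M / (\<rho> / 2))))"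
    unfolding h_def using rho by (intro add_mono nn_integral_log_kernel) auto
  also have "\<dots> = ennreal (4 * pi * (1 + ln (4 * M / \<rho>)))"
    using rho by (subst ennreal_plus[symmetric]) (auto intro!: mult_nonneg_nonneg add_nonneg_nonneg ln_ge_zero)
  finally show ?thesis .
qed

section \<open>Integration by parts against a cutoff\<close>

lemma integrable_continuous_bounded_support:
  fixes G :: "complex \<Rightarrow> 'b::{banach, second_countable_topology}"
  assumes "continuous_on UNIV G" "bounded S" "\<And>z. z \<notin> S \<Longrightarrow> G z = 0"
  shows "integrable lborel G"
proof -
  obtain R where R: "\<And>z. z \<in> S \<Longrightarrow> norm z \<le> R" using assms(2) by (auto simp: bounded_iff)
  have "compact (G ` cball 0 R)"
    by (intro compact_continuous_image continuous_on_subset[OF assms(1)]) auto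
  then obtain C where C: "\<forall>x\<in>G ` cball 0 R. norm x \<le> C" using compact_imp_bounded bounded_iff by metis
  show ?thesis
  proof (rule integrableI_bounded_set[where A="cball 0 R" and B=C])
    show "G \<in> borel_measurable lborel" using borel_measurable_continuous_onI[OF assms(1)] by simp
    show "emeasure lborel (cball (0::complex) R) < \<infinity>" by (rule emeasure_lborel_cball_finite)
    show "AE x in lborel. x \<in> cball 0 R \<longrightarrow> norm (G x) \<le> C" using C by auto
    show "AE x in lborel. x \<notin> cball 0 R \<longrightarrow> G x = 0" using R assms(3) by auto
  qed simp
qed

text \<open>By translation invariance of Lebesgue measure the difference quotients of \<open>G\<close> have
  integral 0, and by the mean value theorem they are dominated.\<close>

lemma integral_directional_derivative_eq_0:
  fixes G :: "complex \<Rightarrow> 'b::{banach, second_countable_topology}"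
  assumes der: "\<And>z. (G has_derivative G' z) (at z)"
    and cont: "continuous_on UNIV (\<lambda>z. G' z v)"
    and supp: "bounded {z. G z \<noteq> 0}"
  shows "integrable lborel (\<lambda>z. G' z v)" "integral\<^sup>L lborel (\<lambda>z. G' z v) = 0"
proof -
  obtain R where R: "R > 0" "\<And>z. G z \<noteq> 0 \<Longrightarrow> norm z \<le> R"
    using supp by (auto simp: bounded_pos)
  have contG: "continuous_on UNIV G"
    using der by (meson continuous_at_imp_continuous_on has_derivative_continuous)
  have [measurable]: "G \<in> borel_measurable borel"
    using contG by (rule borel_measurable_continuous_onI)
  have [measurable]: "(\<lambda>z. G' z v) \<in> borel_measurable borel"
    using cont by (rule borel_measurable_continuous_onI)
  define R' where "R' = R + norm v"
  have zero: "G' z v = 0" if "norm z > R" for z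
  proof -
    have "((\<lambda>_. 0) has_derivative G' z) (at z)"
      by (rule has_derivative_transform_within_open[OF der, of "- cball 0 R"])
        (use that R in \<open>auto simp: not_le[symmetric]\<close>)
    then have "G' z = (\<lambda>_. 0)"
      by (intro has_derivative_unique) auto
    then show ?thesis by simp
  qed
  obtain B where B: "B > 0" "\<And>z. z \<in> cball 0 (R' + norm v) \<Longrightarrow> norm (G' z v) \<le> B"
  proof -
    have "compact ((\<lambda>z. G' z v) ` cball 0 (R' + norm v))"
      by (intro compact_continuous_image continuous_on_subset[OF cont]) auto
    then have "bounded ((\<lambda>z. G' z v) ` cball 0 (R' + norm v))" by (rule compact_imp_bounded)
    then show ?thesis using that by (auto simp: bounded_pos)
  qed
  have B': "norm (G' z v) \<le> B" for z
  proof (cases "norm z \<le> R")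
    case True
    then have "norm z \<le> R' + norm v" using norm_ge_zero[of v] unfolding R'_def by linarith
    then show ?thesis using B(2)[of z] by simp
  qed (use zero[of z] B(1) in auto)
  have bnd: "norm (G (z + t *\<^sub>R v) - G z) \<le> B * t" if t: "t > 0" for z t
  proof -
    have "norm (G (z + t *\<^sub>R v) - G (z + 0 *\<^sub>R v)) \<le> B * norm (t - 0)"
    proof (rule differentiable_bound[where S = "{0..t}" and f' = "\<lambda>x s. s *\<^sub>R G' (z + x *\<^sub>R v) v"])
      fix x assume "x \<in> {0..t}"
      have "((\<lambda>s. G (z + s *\<^sub>R v)) has_derivative (\<lambda>s. G' (z + x *\<^sub>R v) (s *\<^sub>R v))) (at x within {0..t})"
        by (rule has_derivative_compose[OF _ der]) (auto intro!: derivative_eq_intros)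
      then show "((\<lambda>s. G (z + s *\<^sub>R v)) has_derivative (\<lambda>s. s *\<^sub>R G' (z + x *\<^sub>R v) v)) (at x within {0..t})"
        by (simp add: linear_cmul[OF has_derivative_linear[OF der]])
      show "onorm (\<lambda>s. s *\<^sub>R G' (z + x *\<^sub>R v) v) \<le> B"
        using B' B(1) by (intro onorm_bound) (auto simp: mult.commute[of B] intro!: mult_left_mono)
    qed (use t in auto)
    then show ?thesis using t by simp
  qed
  define s where "s n z = real (Suc n) *\<^sub>R (G (z + inverse (real (Suc n)) *\<^sub>R v) - G z)" for n z
  have intG: "integrable lborel G"
    by (rule integrable_continuous_bounded_support[OF contG supp]) simp
  have shift: "integrable lborel (\<lambda>z. G (z + c))" "integral\<^sup>L lborel (\<lambda>z. G (z + c)) = integral\<^sup>L lborel G" for c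
  proof -
    have *: "distr lborel borel ((+) c) = (lborel :: complex measure)" by (rule lborel_distr_plus)
    have "integrable (distr lborel borel ((+) c)) G" using intG by (simp only: *)
    then show "integrable lborel (\<lambda>z. G (z + c))"
      by (subst (asm) integrable_distr_eq) (auto simp: add.commute)
    have "integral\<^sup>L lborel G = integral\<^sup>L (distr lborel borel ((+) c)) G" by (simp only: *)
    also have "\<dots> = integral\<^sup>L lborel (\<lambda>z. G (z + c))"
      by (subst integral_distr) (auto simp: add.commute)
    finally show "integral\<^sup>L lborel (\<lambda>z. G (z + c)) = integral\<^sup>L lborel G" ..
  qed
  have s0: "integral\<^sup>L lborel (s n) = 0" for n
    unfolding s_def[abs_def] using shift intG by simp
  have dom: "integrable lborel (\<lambda>z::complex. indicator (cball 0 R') z * B)"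
    by (intro integrable_mult_left integrable_real_indicator emeasure_lborel_cball_finite) auto
  have lim: "(\<lambda>n. s n z) \<longlonglongrightarrow> G' z v" for z
  proof -
    have "((\<lambda>h. (1 / h) *\<^sub>R (G (z + h *\<^sub>R v) - G z)) \<longlongrightarrow> G' z v) (at 0)"
    proof -
      have "((\<lambda>h. G (z + h *\<^sub>R v)) has_derivative (\<lambda>h. G' (z + 0 *\<^sub>R v) (h *\<^sub>R v))) (at 0)"
        by (rule has_derivative_compose[OF _ der]) (auto intro!: derivative_eq_intros)
      then have "((\<lambda>h. norm (G (z + h *\<^sub>R v) - G z - h *\<^sub>R G' z v) / norm h) \<longlongrightarrow> 0) (at 0)"
        by (simp add: has_derivative_at linear_cmul[OF has_derivative_linear[OF der]])
      moreover have "norm (G (z + h *\<^sub>R v) - G z - h *\<^sub>R G' z v) / norm h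
          = norm ((1 / h) *\<^sub>R (G (z + h *\<^sub>R v) - G z) - G' z v)" if "h \<noteq> 0" for h
      proof -
        have "(1 / h) *\<^sub>R (G (z + h *\<^sub>R v) - G z) - G' z v
            = (1 / h) *\<^sub>R (G (z + h *\<^sub>R v) - G z - h *\<^sub>R G' z v)"
          using that by (simp add: scaleR_diff_right)
        then show ?thesis by simp
      qed
      ultimately have "((\<lambda>h. norm ((1 / h) *\<^sub>R (G (z + h *\<^sub>R v) - G z) - G' z v)) \<longlongrightarrow> 0) (at 0)"
        by (simp cong: LIM_cong)
      then show ?thesis by (simp add: tendsto_norm_zero_iff LIM_zero_iff)
    qed
    then have "(\<lambda>n. (1 / inverse (real (Suc n))) *\<^sub>R (G (z + inverse (real (Suc n)) *\<^sub>R v) - G z)) \<longlonglongrightarrow> G' z v"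
      by (rule filterlim_compose) (auto intro!: filterlim_atI LIMSEQ_inverse_real_of_nat simp del: of_nat_Suc)
    then show ?thesis by (simp only: s_def inverse_eq_divide div_by_1 divide_divide_eq_right mult_1)
  qed
  have le: "norm (s n z) \<le> indicator (cball 0 R') z * B" for n z
  proof (cases "norm z \<le> R'")
    case True
    have "norm (s n z) = real (Suc n) * norm (G (z + inverse (real (Suc n)) *\<^sub>R v) - G z)"
      by (simp add: s_def)
    also have "\<dots> \<le> real (Suc n) * (B * inverse (real (Suc n)))"
      by (intro mult_left_mono bnd) auto
    also have "\<dots> = B" by (simp del: of_nat_Suc)
    finally show ?thesis using True by simp
  next
    case False
    have "norm (inverse (real (Suc n)) *\<^sub>R v) \<le> norm v"
      unfolding norm_scaleR by (intro mult_left_le_one_le) (auto simp: inverse_le_1_iff)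
    then have "norm (z + inverse (real (Suc n)) *\<^sub>R v) > R" "norm z > R"
      using False norm_diff_ineq[of z "inverse (real (Suc n)) *\<^sub>R v"] norm_ge_zero[of v]
      unfolding R'_def by linarith+
    then have "G (z + inverse (real (Suc n)) *\<^sub>R v) = 0" "G z = 0" using R(2) not_le by blast+
    then show ?thesis using False by (simp add: s_def del: of_nat_Suc)
  qed
  have smeas: "s n \<in> borel_measurable lborel" for n unfolding s_def[abs_def] by measurable
  show "integrable lborel (\<lambda>z. G' z v)"
    by (rule integrable_dominated_convergence[where s=s, OF _ smeas dom]) (use lim le in auto)
  have "(\<lambda>n. integral\<^sup>L lborel (s n)) \<longlonglongrightarrow> integral\<^sup>L lborel (\<lambda>z. G' z v)"
    by (rule integral_dominated_convergence[OF _ smeas dom]) (use lim le in auto)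
  then show "integral\<^sup>L lborel (\<lambda>z. G' z v) = 0"
    using s0 by (simp add: LIMSEQ_const_iff)
qed



text \<open>The gradient \<open>g\<close> is a complex number, so that it can be multiplied with holomorphic
  functions.\<close>

definition cutoff_on :: "complex set \<Rightarrow> (complex \<Rightarrow> real) \<Rightarrow> (complex \<Rightarrow> complex) \<Rightarrow> bool" where
  "cutoff_on \<Omega> \<eta> g \<longleftrightarrow> (\<forall>z. GDERIV \<eta> z :> g z) \<and> continuous_on UNIV g
     \<and> bounded {z. \<eta> z \<noteq> 0} \<and> closure {z. \<eta> z \<noteq> 0} \<subseteq> \<Omega>"

lemma cutoff_onD:
  assumes "cutoff_on \<Omega> \<eta> g"
  shows "(\<eta> has_derivative (\<lambda>v. v \<bullet> g z)) (at z)" "continuous_on UNIV g"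
    "continuous_on UNIV \<eta>"
    "z \<notin> closure {z. \<eta> z \<noteq> 0} \<Longrightarrow> \<eta> z = 0"
    "z \<notin> closure {z. \<eta> z \<noteq> 0} \<Longrightarrow> g z = 0"
    "closure {z. \<eta> z \<noteq> 0} \<subseteq> \<Omega>" "bounded {z. \<eta> z \<noteq> 0}"
proof -
  have 1: "\<forall>z. (\<eta> has_derivative (\<lambda>v. v \<bullet> g z)) (at z)" and 2: "continuous_on UNIV g"
    and 3: "bounded {z. \<eta> z \<noteq> 0}" and 4: "closure {z. \<eta> z \<noteq> 0} \<subseteq> \<Omega>"
    using assms unfolding cutoff_on_def gderiv_def by blast+
  from 1 show d: "(\<eta> has_derivative (\<lambda>v. v \<bullet> g z)) (at z)" by blast
  show "continuous_on UNIV \<eta>"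
    by (rule continuous_at_imp_continuous_on, rule ballI) (rule has_derivative_continuous[OF 1[rule_format]])
  have z: "\<eta> z = 0" if "z \<notin> closure {z. \<eta> z \<noteq> 0}" for z
  proof (rule ccontr)
    assume "\<eta> z \<noteq> 0"
    then have "z \<in> {z. \<eta> z \<noteq> 0}" by simp
    then have "z \<in> closure {z. \<eta> z \<noteq> 0}" by (rule subsetD[OF closure_subset])
    with that show False by contradiction
  qed
  then show "z \<notin> closure {z. \<eta> z \<noteq> 0} \<Longrightarrow> \<eta> z = 0" .
  show "g z = 0" if *: "z \<notin> closure {z. \<eta> z \<noteq> 0}"
  proof -
    have "((\<lambda>_. 0) has_derivative (\<lambda>v. v \<bullet> g z)) (at z)"
    proof (rule has_derivative_transform_within_open[OF d])
      show "open (- closure {z. \<eta> z \<noteq> 0})" by (simp add: open_Compl)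
      show "z \<in> - closure {z. \<eta> z \<noteq> 0}" using * by simp
      show "\<eta> x = 0" if "x \<in> - closure {z. \<eta> z \<noteq> 0}" for x
        by (rule z) (use that in simp)
    qed
    then have "(\<lambda>v. v \<bullet> g z) = (\<lambda>v. 0)" by (rule has_derivative_unique) (rule has_derivative_const)
    from fun_cong[OF this, of "g z"] show "g z = 0" by simp
  qed
qed (use assms in \<open>unfold cutoff_on_def, blast+\<close>)

text \<open>The product \<open>\<eta> h\<close>, extended by 0, is continuously differentiable on the whole
  plane although \<open>h\<close> is only controlled on \<open>\<Omega>\<close>.\<close>

lemma integral_cutoff_by_parts:
  fixes h :: "complex \<Rightarrow> 'b::{banach, second_countable_topology}"
  assumes cut: "cutoff_on \<Omega> \<eta> g" and "open \<Omega>"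
    and der: "\<And>z. z \<in> \<Omega> \<Longrightarrow> (h has_derivative h' z) (at z)"
    and cont: "continuous_on \<Omega> (\<lambda>z. h' z v)"
  shows "integrable lborel (\<lambda>z. (v \<bullet> g z) *\<^sub>R h z + \<eta> z *\<^sub>R h' z v)"
    and "(LBINT z. (v \<bullet> g z) *\<^sub>R h z + \<eta> z *\<^sub>R h' z v) = 0"
proof -
  note c = cutoff_onD[OF cut]
  let ?S = "closure {z. \<eta> z \<noteq> 0}"
  define G where "G z = \<eta> z *\<^sub>R h z" for z
  define G' where "G' z w = (w \<bullet> g z) *\<^sub>R h z + \<eta> z *\<^sub>R h' z w" for z w
  have un: "UNIV = \<Omega> \<union> (- ?S)" using c(6) by auto
  have contH: "continuous_on \<Omega> h"
    using der by (meson continuous_at_imp_continuous_on has_derivative_continuous)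
  define G'' where "G'' z = (if z \<in> \<Omega> then G' z else (\<lambda>_. 0))" for z
  have dG: "(G has_derivative G'' z) (at z)" for z
  proof (cases "z \<in> \<Omega>")
    case True
    have "G'' z = (\<lambda>v. \<eta> z *\<^sub>R h' z v + (v \<bullet> g z) *\<^sub>R h z)"
      using True by (simp add: G''_def G'_def fun_eq_iff)
    moreover have "(G has_derivative (\<lambda>v. \<eta> z *\<^sub>R h' z v + (v \<bullet> g z) *\<^sub>R h z)) (at z)"
      unfolding G_def by (rule has_derivative_scaleR[OF c(1) der[OF True]])
    ultimately show ?thesis by simp
  next
    case False
    have "(G has_derivative (\<lambda>_. 0)) (at z)"
    proof (rule has_derivative_transform_within_open[where f = "\<lambda>_. 0" and s = "- ?S"])
      show "z \<in> - ?S" using False c(6) by blast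
      show "0 = G x" if "x \<in> - ?S" for x using that c(4)[of x] by (simp add: G_def)
    qed auto
    with False show ?thesis by (simp add: G''_def)
  qed
  have eq: "(\<lambda>z. G'' z v) = (\<lambda>z. (v \<bullet> g z) *\<^sub>R h z + \<eta> z *\<^sub>R h' z v)"
  proof
    fix z show "G'' z v = (v \<bullet> g z) *\<^sub>R h z + \<eta> z *\<^sub>R h' z v"
    proof (cases "z \<in> \<Omega>")
      case False
      then have "z \<notin> ?S" using c(6) by blast
      then show ?thesis using False c(4)[of z] c(5)[of z] by (simp add: G''_def)
    qed (simp add: G''_def G'_def)
  qed
  have "continuous_on (\<Omega> \<union> (- ?S)) (\<lambda>z. G'' z v)"
  proof (rule continuous_on_open_Un)
    show "continuous_on \<Omega> (\<lambda>z. G'' z v)" unfolding eq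
      using contH cont c(2,3) by (intro continuous_intros) (auto intro: continuous_on_subset)
    have "continuous_on (- ?S) (\<lambda>z. 0::'b)" by simp
    then show "continuous_on (- ?S) (\<lambda>z. G'' z v)"
    proof (rule continuous_on_eq)
      show "0 = G'' z v" if "z \<in> - ?S" for z
        using that c(4)[of z] c(5)[of z] fun_cong[OF eq, of z] by simp
    qed
  qed (use \<open>open \<Omega>\<close> in auto)
  then have cG: "continuous_on UNIV (\<lambda>z. G'' z v)" by (simp only: un)
  have bG: "bounded {z. G z \<noteq> 0}" by (rule bounded_subset[OF c(7)]) (auto simp: G_def)
  from integral_directional_derivative_eq_0[OF dG cG bG]
  show "integrable lborel (\<lambda>z. (v \<bullet> g z) *\<^sub>R h z + \<eta> z *\<^sub>R h' z v)"
    and "(LBINT z. (v \<bullet> g z) *\<^sub>R h z + \<eta> z *\<^sub>R h' z v) = 0"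
    by (simp_all only: eq)
qed

section \<open>Flows on the dyadic tree\<close>

type_synonym cell = "int \<times> int"

definition parent :: "cell \<Rightarrow> cell" where
  "parent Q = (fst Q div 2, snd Q div 2)"

definition children :: "cell \<Rightarrow> cell set" where
  "children Q = {Q'. parent Q' = Q}"

lemma children_eq:
  "children (a, b) = {(2 * a, 2 * b), (2 * a, 2 * b + 1), (2 * a + 1, 2 * b), (2 * a + 1, 2 * b + 1)}"
proof -
  have "x div 2 = a \<longleftrightarrow> x = 2 * a \<or> x = 2 * a + 1" for x a :: int by presburger
  then show ?thesis by (auto simp: children_def parent_def)
qed

lemma finite_children [simp]: "finite (children Q)"
  by (cases Q) (simp add: children_eq)

lemma mem_children [simp]: "Q' \<in> children Q \<longleftrightarrow> parent Q' = Q"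
  by (simp add: children_def)

primrec level :: "nat \<Rightarrow> cell set" where
  "level 0 = {(0, 0)}"
| "level (Suc n) = (\<Union>Q\<in>level n. children Q)"

lemma finite_level [simp]: "finite (level n)"
  by (induction n) auto

lemma level_Suc_iff [simp]: "Q \<in> level (Suc n) \<longleftrightarrow> parent Q \<in> level n"
  by auto

declare level.simps(2) [simp del]

lemma sum_level_Suc: "(\<Sum>Q\<in>level (Suc n). f Q) = (\<Sum>Q\<in>level n. \<Sum>Q'\<in>children Q. f Q')"
  unfolding level.simps by (rule sum.UNION_disjoint) auto

text \<open>The value \<open>S n Q\<close> is the conductance of the subtree below the cell \<open>Q\<close>
  of level \<open>n\<close> together with the unit resistor above it: conductances
  \<open>s\<close> in parallel below and a unit resistor in series give \<open>s / (1 +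
  s)\<close>. The recursion is required down to level \<open>N\<close>.\<close>

definition conductances :: "nat \<Rightarrow> (nat \<Rightarrow> cell \<Rightarrow> real) \<Rightarrow> bool" where
  "conductances N S \<longleftrightarrow> (\<forall>n Q. 0 \<le> S n Q) \<and>
     (\<forall>n<N. \<forall>Q. S n Q = (\<Sum>Q'\<in>children Q. S (Suc n) Q') / (1 + (\<Sum>Q'\<in>children Q. S (Suc n) Q')))"

text \<open>The unit current entering at the root, split at each cell in proportion to the conductances of
  its children.\<close>

primrec flow :: "(nat \<Rightarrow> cell \<Rightarrow> real) \<Rightarrow> nat \<Rightarrow> cell \<Rightarrow> real" where
  "flow S 0 Q = (if Q = (0, 0) then 1 else 0)"
| "flow S (Suc n) Q
     = flow S n (parent Q) * S (Suc n) Q / (\<Sum>Q'\<in>children (parent Q). S (Suc n) Q')"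

lemma conductances_nonneg: "conductances N S \<Longrightarrow> 0 \<le> S n Q"
  unfolding conductances_def by blast

lemma conductances_eq:
  "conductances N S \<Longrightarrow> n < N \<Longrightarrow>
    S n Q = (\<Sum>Q'\<in>children Q. S (Suc n) Q') / (1 + (\<Sum>Q'\<in>children Q. S (Suc n) Q'))"
  unfolding conductances_def by blast

lemma flow_nonneg: "conductances N S \<Longrightarrow> 0 \<le> flow S n Q"
proof (induction n arbitrary: Q)
  case (Suc n)
  then show ?case
    by (simp only: flow.simps) (intro divide_nonneg_nonneg mult_nonneg_nonneg sum_nonneg, auto intro: conductances_nonneg)
qed simp

lemma flow_nonzero_imp:
  assumes "S 0 (0, 0) \<noteq> 0" "flow S n Q \<noteq> 0" shows "S n Q \<noteq> 0"
  using assms by (cases n) (auto split: if_splits)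

lemma flow_children:
  assumes "parent Q' = Q"
  shows "flow S (Suc n) Q' = flow S n Q * S (Suc n) Q' / (\<Sum>Q''\<in>children Q. S (Suc n) Q'')"
  using assms by simp

lemma sum_flow_children:
  assumes "conductances N S" "S 0 (0, 0) > 0" "n < N"
  shows "(\<Sum>Q'\<in>children Q. flow S (Suc n) Q') = flow S n Q"
proof -
  let ?s = "\<Sum>Q'\<in>children Q. S (Suc n) Q'"
  have "(\<Sum>Q'\<in>children Q. flow S (Suc n) Q') = (\<Sum>Q'\<in>children Q. flow S n Q * S (Suc n) Q' / ?s)"
    by (intro sum.cong refl flow_children) auto
  also have "\<dots> = flow S n Q * ?s / ?s"
    by (simp add: sum_distrib_left sum_divide_distrib)
  also have "\<dots> = flow S n Q"
  proof (cases "?s = 0")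
    case True
    then have "S n Q = 0" using conductances_eq[OF assms(1,3), of Q] by simp
    then have "flow S n Q = 0" using assms flow_nonzero_imp[of S n Q] by auto
    then show ?thesis by simp
  qed simp
  finally show ?thesis .
qed

text \<open>Ohm's law for a unit resistor in series with a subtree of conductance \<open>s\<close>: the
  voltage over both is the sum of the two voltages.\<close>

lemma flow_over_conductance: "0 \<le> s \<Longrightarrow> s \<noteq> 0 \<Longrightarrow> x / (s / (1 + s)) = x + x / (s::real)"
  by (simp add: field_simps)

text \<open>Conservation of power for the unit current: the power used in the first \<open>m\<close> levels
  and the power used below them add up to the total resistance.\<close>

lemma sum_level_flow_energy:
  assumes c: "conductances N S" and pos: "S 0 (0, 0) > 0" and "m \<le> N"
  shows "(\<Sum>n<m. \<Sum>Q\<in>level n. (flow S n Q)\<^sup>2) + (\<Sum>Q\<in>level m. (flow S m Q)\<^sup>2 / S m Q) = 1 / S 0 (0, 0)"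
  using \<open>m \<le> N\<close>
proof (induction m)
  case (Suc m)
  define s where "s Q = (\<Sum>Q'\<in>children Q. S (Suc m) Q')" for Q
  have "(flow S m Q)\<^sup>2 / S m Q = (flow S m Q)\<^sup>2 + (\<Sum>Q'\<in>children Q. (flow S (Suc m) Q')\<^sup>2 / S (Suc m) Q')" for Q
  proof (cases "s Q = 0")
    case True
    then have "S m Q = 0" using conductances_eq[OF c, of m Q] Suc.prems by (simp add: s_def)
    then have "flow S m Q = 0" using pos flow_nonzero_imp[of S m Q] by auto
    then show ?thesis by (simp add: flow_children)
  next
    case False
    have "s Q \<ge> 0" unfolding s_def by (intro sum_nonneg conductances_nonneg[OF c])
    have "(\<Sum>Q'\<in>children Q. (flow S (Suc m) Q')\<^sup>2 / S (Suc m) Q')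
        = (\<Sum>Q'\<in>children Q. (flow S m Q / s Q)\<^sup>2 * S (Suc m) Q')"
    proof (intro sum.cong refl)
      fix Q' assume "Q' \<in> children Q"
      then have "flow S (Suc m) Q' = flow S m Q / s Q * S (Suc m) Q'"
        using flow_children[of Q' Q S m] by (simp add: s_def)
      then show "(flow S (Suc m) Q')\<^sup>2 / S (Suc m) Q' = (flow S m Q / s Q)\<^sup>2 * S (Suc m) Q'"
        by (simp add: power2_eq_square)
    qed
    also have "\<dots> = (flow S m Q / s Q)\<^sup>2 * s Q" by (simp add: s_def sum_distrib_left)
    also have "\<dots> = (flow S m Q)\<^sup>2 / s Q" using False by (simp add: power2_eq_square)
    finally have *: "(\<Sum>Q'\<in>children Q. (flow S (Suc m) Q')\<^sup>2 / S (Suc m) Q') = (flow S m Q)\<^sup>2 / s Q" .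
    have "S m Q = s Q / (1 + s Q)" using conductances_eq[OF c, of m Q] Suc.prems by (simp add: s_def)
    then show ?thesis using False \<open>s Q \<ge> 0\<close> unfolding * using flow_over_conductance[of "s Q"] by simp
  qed
  then have "(\<Sum>Q\<in>level m. (flow S m Q)\<^sup>2 / S m Q)
      = (\<Sum>Q\<in>level m. (flow S m Q)\<^sup>2) + (\<Sum>Q\<in>level (Suc m). (flow S (Suc m) Q)\<^sup>2 / S (Suc m) Q)"
    by (simp add: sum_level_Suc sum.distrib del: flow.simps)
  with Suc show ?case by (simp del: flow.simps)
qed simp

text \<open>Along every path to a leaf the voltages add up to the voltage at the root. So the potential of
  the unit current is the same at all leaves.\<close>

lemma sum_path_flow:
  assumes c: "conductances N S" and pos: "S 0 (0, 0) > 0" and "m \<le> N"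
    and Q: "Q 0 = (0, 0)" "\<And>n. parent (Q (Suc n)) = Q n" and Spos: "\<And>n. n \<le> N \<Longrightarrow> S n (Q n) > 0"
  shows "(\<Sum>n<m. flow S n (Q n)) + flow S m (Q m) / S m (Q m) = 1 / S 0 (0, 0)"
  using \<open>m \<le> N\<close>
proof (induction m)
  case 0 then show ?case by (simp add: Q)
next
  case (Suc m)
  define s where "s = (\<Sum>Q'\<in>children (Q m). S (Suc m) Q')"
  have S: "S m (Q m) = s / (1 + s)" using conductances_eq[OF c, of m "Q m"] Suc.prems by (simp add: s_def)
  have "s \<ge> 0" unfolding s_def by (intro sum_nonneg conductances_nonneg[OF c])
  moreover have "s \<noteq> 0" using S Spos[of m] Suc.prems by auto
  ultimately have "flow S m (Q m) / S m (Q m) = flow S m (Q m) + flow S m (Q m) / s"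
    using flow_over_conductance[of s] S by simp
  also have "flow S m (Q m) / s = flow S (Suc m) (Q (Suc m)) / S (Suc m) (Q (Suc m))"
    using flow_children[OF Q(2), of S m] Spos[of "Suc m"] Suc.prems by (simp add: s_def)
  finally show ?case using Suc by simp
qed

text \<open>Conservation of the current, tested against an arbitrary function of the cell at the upper
  level.\<close>

lemma sum_flow_ancestor:
  fixes \<phi> :: "cell \<Rightarrow> real"
  assumes c: "conductances N S" and pos: "S 0 (0, 0) > 0" and "n + j \<le> N"
  shows "(\<Sum>Q\<in>level (n + j). flow S (n + j) Q * \<phi> ((parent ^^ j) Q)) = (\<Sum>P\<in>level n. flow S n P * \<phi> P)"
  using \<open>n + j \<le> N\<close>
proof (induction j)
  case (Suc j)
  have "(\<Sum>Q\<in>level (n + Suc j). flow S (n + Suc j) Q * \<phi> ((parent ^^ Suc j) Q))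
      = (\<Sum>Q\<in>level (n + j). \<Sum>Q'\<in>children Q. flow S (Suc (n + j)) Q' * \<phi> ((parent ^^ Suc j) Q'))"
    by (simp add: sum_level_Suc del: flow.simps funpow.simps)
  also have "\<dots> = (\<Sum>Q\<in>level (n + j). (\<Sum>Q'\<in>children Q. flow S (Suc (n + j)) Q') * \<phi> ((parent ^^ j) Q))"
    by (intro sum.cong refl) (simp add: funpow_Suc_right sum_distrib_right del: flow.simps funpow.simps)
  also have "\<dots> = (\<Sum>Q\<in>level (n + j). flow S (n + j) Q * \<phi> ((parent ^^ j) Q))"
    using Suc.prems by (simp add: sum_flow_children[OF c pos] del: flow.simps)
  finally show ?case using Suc by simp
qed simp

definition near :: "cell \<Rightarrow> cell \<Rightarrow> bool" where
  "near P Q \<longleftrightarrow> \<bar>fst P - fst Q\<bar> \<le> 1 \<and> \<bar>snd P - snd Q\<bar> \<le> 1"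

lemma near_commute: "near P Q \<longleftrightarrow> near Q P"
  by (auto simp: near_def)

lemma finite_near: "finite {Q. near P Q}" and card_near: "card {Q. near P Q} \<le> 9"
proof -
  have *: "{Q. near P Q} = {fst P - 1..fst P + 1} \<times> {snd P - 1..snd P + 1}"
    by (auto simp: near_def)
  show "finite {Q. near P Q}" "card {Q. near P Q} \<le> 9" unfolding * by (auto simp: card_cartesian_product)
qed

text \<open>A cell has nine neighbours including itself. Passing to neighbours therefore costs a factor 9
  only, which repairs the mismatch between the tree metric and the distance in the plane.\<close>

lemma sum_near_le:
  fixes x :: "cell \<Rightarrow> real"
  assumes "finite A"
  shows "(\<Sum>P\<in>A. \<Sum>Q\<in>A. of_bool (near P Q) * (x P * x Q)) \<le> 9 * (\<Sum>P\<in>A. (x P)\<^sup>2)"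
proof -
  have count: "(\<Sum>Q\<in>A. of_bool (near P Q)) \<le> (9::real)" for P
  proof -
    have "(\<Sum>Q\<in>A. of_bool (near P Q)) = real (card (A \<inter> {Q. near P Q}))"
      using assms by (simp add: of_bool_def sum.If_cases)
    also have "\<dots> \<le> real (card {Q. near P Q})"
      by (intro of_nat_mono card_mono finite_near) auto
    finally show ?thesis using card_near[of P] by linarith
  qed
  have "(\<Sum>P\<in>A. \<Sum>Q\<in>A. of_bool (near P Q) * (x P * x Q))
      \<le> (\<Sum>P\<in>A. \<Sum>Q\<in>A. of_bool (near P Q) * ((x P)\<^sup>2 / 2) + of_bool (near P Q) * ((x Q)\<^sup>2 / 2))"
  proof (intro sum_mono)
    fix P Q
    have "x P * x Q \<le> (x P)\<^sup>2 / 2 + (x Q)\<^sup>2 / 2"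
      using sum_squares_bound[of "x P" "x Q"] by simp
    then show "of_bool (near P Q) * (x P * x Q)
        \<le> of_bool (near P Q) * ((x P)\<^sup>2 / 2) + of_bool (near P Q) * ((x Q)\<^sup>2 / 2)"
      by (simp add: of_bool_def)
  qed
  also have "\<dots> = (\<Sum>P\<in>A. \<Sum>Q\<in>A. of_bool (near P Q) * ((x P)\<^sup>2 / 2))
      + (\<Sum>Q\<in>A. \<Sum>P\<in>A. of_bool (near P Q) * ((x Q)\<^sup>2 / 2))"
    by (subst sum.swap[of _ A A]) (simp add: sum.distrib)
  also have "\<dots> = 2 * (\<Sum>P\<in>A. (\<Sum>Q\<in>A. of_bool (near P Q)) * ((x P)\<^sup>2 / 2))"
    by (subst near_commute) (simp add: sum_distrib_right sum_divide_distrib)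
  also have "\<dots> \<le> 2 * (\<Sum>P\<in>A. 9 * ((x P)\<^sup>2 / 2))"
    by (intro mult_left_mono sum_mono mult_right_mono count) auto
  also have "\<dots> = 9 * (\<Sum>P\<in>A. (x P)\<^sup>2)" by (simp add: sum_distrib_left sum_divide_distrib)
  finally show ?thesis .
qed

text \<open>The tree is cut off \<open>k\<close> levels below, where the cells that satisfy \<open>H\<close>
  are connected to the ground, with value 1 for the unit resistor above such a cell.\<close>

primrec trunc_conductance :: "(nat \<Rightarrow> cell \<Rightarrow> bool) \<Rightarrow> nat \<Rightarrow> nat \<Rightarrow> cell \<Rightarrow> real" where
  "trunc_conductance H 0 n Q = of_bool (H n Q)"
| "trunc_conductance H (Suc k) n Q = (\<Sum>Q'\<in>children Q. trunc_conductance H k (Suc n) Q') / (1 + (\<Sum>Q'\<in>children Q. trunc_conductance H k (Suc n) Q'))"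

lemma trunc_conductance_nonneg: "0 \<le> trunc_conductance H k n Q"
  by (induction k arbitrary: n Q) (auto intro!: divide_nonneg_nonneg sum_nonneg add_nonneg_nonneg)

lemma trunc_conductance_le_1: "trunc_conductance H k n Q \<le> 1"
proof (cases k)
  case (Suc j)
  have "0 \<le> (\<Sum>Q'\<in>children Q. trunc_conductance H j (Suc n) Q')" by (intro sum_nonneg trunc_conductance_nonneg)
  then show ?thesis using Suc by simp
qed simp

lemma frac_mono: "0 \<le> x \<Longrightarrow> x \<le> y \<Longrightarrow> x / (1 + x) \<le> y / (1 + (y::real))"
  by (simp add: field_simps)

lemma trunc_conductance_zero:
  assumes "\<And>n Q. H (Suc n) Q \<Longrightarrow> H n (parent Q)" "\<not> H n Q" shows "trunc_conductance H k n Q = 0"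
  using assms(2)
proof (induction k arbitrary: n Q)
  case (Suc k)
  then have "trunc_conductance H k (Suc n) Q' = 0" if "parent Q' = Q" for Q'
    using that assms(1) by blast
  then show ?case by simp
qed simp

text \<open>Cutting the tree off at a greater depth adds resistors, and a longer path has a smaller
  conductance.\<close>

lemma trunc_conductance_antimono:
  assumes "\<And>n Q. H (Suc n) Q \<Longrightarrow> H n (parent Q)"
  shows "trunc_conductance H (Suc k) n Q \<le> trunc_conductance H k n Q"
proof (induction k arbitrary: n Q)
  case 0
  show ?case
  proof (cases "H n Q")
    case True
    then show ?thesis using trunc_conductance_le_1[of H "Suc 0" n Q] by (simp del: trunc_conductance.simps(2))
  next
    case False
    then show ?thesis using trunc_conductance_zero[of H n Q "Suc 0", OF assms False] by (simp del: trunc_conductance.simps(2))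
  qed
next
  case (Suc k)
  show ?case unfolding trunc_conductance.simps(2)[of H "Suc k"] trunc_conductance.simps(2)[of H k n Q]
    by (intro frac_mono sum_nonneg trunc_conductance_nonneg sum_mono Suc.IH)
qed

lemma trunc_conductance_pos:
  assumes "\<And>n. H n (Q n)" "\<And>n. parent (Q (Suc n)) = Q n" shows "0 < trunc_conductance H k n (Q n)"
proof (induction k arbitrary: n)
  case 0 then show ?case using assms by simp
next
  case (Suc k)
  have "0 < (\<Sum>Q'\<in>children (Q n). trunc_conductance H k (Suc n) Q')"
    by (rule sum_pos2[where i = "Q (Suc n)"]) (auto simp: assms trunc_conductance_nonneg Suc)
  then show ?case by simp
qed

lemma conductances_trunc_conductance: "conductances N (\<lambda>n. trunc_conductance H (N - n) n)"
  unfolding conductances_def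
proof (intro conjI allI impI trunc_conductance_nonneg)
  fix n Q assume "n < N"
  then have "N - n = Suc (N - Suc n)" by simp
  then show "trunc_conductance H (N - n) n Q = (\<Sum>Q'\<in>children Q. trunc_conductance H (N - Suc n) (Suc n) Q')
      / (1 + (\<Sum>Q'\<in>children Q. trunc_conductance H (N - Suc n) (Suc n) Q'))"
    by (simp only: trunc_conductance.simps)
qed

text \<open>Conductances of the truncated trees converge by monotonicity, and the limit satisfies the
  recursion of the infinite tree. This replaces a compactness argument.\<close>

lemma trunc_conductance_limit:
  assumes "\<And>n Q. H (Suc n) Q \<Longrightarrow> H n (parent Q)"
  obtains S where "\<And>n Q. (\<lambda>k. trunc_conductance H k n Q) \<longlonglongrightarrow> S n Q" "\<And>N. conductances N S"
    "\<And>n Q. S n Q \<le> trunc_conductance H 0 n Q"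
proof -
  have "\<exists>l. (\<lambda>k. trunc_conductance H k n Q) \<longlonglongrightarrow> l \<and> l \<le> trunc_conductance H 0 n Q \<and> 0 \<le> l" for n Q
  proof -
    have dec: "decseq (\<lambda>k. trunc_conductance H k n Q)" by (rule decseq_SucI) (rule trunc_conductance_antimono[of H, OF assms])
    obtain l where l: "(\<lambda>k. trunc_conductance H k n Q) \<longlonglongrightarrow> l"
    proof (rule decseq_convergent[OF dec])
      show "\<forall>k. 0 \<le> trunc_conductance H k n Q" by (simp add: trunc_conductance_nonneg)
    qed
    then show ?thesis
      using decseq_ge[OF dec l, of 0] LIMSEQ_le_const[OF l, of 0] trunc_conductance_nonneg[of H _ n Q] by auto
  qed
  then obtain S where S: "\<And>n Q. (\<lambda>k. trunc_conductance H k n Q) \<longlonglongrightarrow> S n Q" "\<And>n Q. S n Q \<le> trunc_conductance H 0 n Q"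
    "\<And>n Q. 0 \<le> S n Q" by metis
  have "S n Q = (\<Sum>Q'\<in>children Q. S (Suc n) Q') / (1 + (\<Sum>Q'\<in>children Q. S (Suc n) Q'))" for n Q
  proof -
    have "0 \<le> (\<Sum>Q'\<in>children Q. S (Suc n) Q')" by (intro sum_nonneg S)
    then have "(\<lambda>k. trunc_conductance H (Suc k) n Q) \<longlonglongrightarrow> (\<Sum>Q'\<in>children Q. S (Suc n) Q') / (1 + (\<Sum>Q'\<in>children Q. S (Suc n) Q'))"
      unfolding trunc_conductance.simps by (intro tendsto_intros S) auto
    moreover have "(\<lambda>k. trunc_conductance H (Suc k) n Q) \<longlonglongrightarrow> S n Q" by (rule LIMSEQ_Suc[OF S(1)])
    ultimately show ?thesis using LIMSEQ_unique by blast
  qed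
  then have "conductances N S" for N using S(3) unfolding conductances_def by blast
  from that[OF S(1) this S(2)] show ?thesis .
qed

section \<open>Realising a flow by a measure on the unit interval\<close>

definition rank :: "cell \<Rightarrow> int" where
  "rank Q = 2 * (fst Q mod 2) + snd Q mod 2"

primrec slot_start :: "(nat \<Rightarrow> cell \<Rightarrow> real) \<Rightarrow> nat \<Rightarrow> cell \<Rightarrow> real" where
  "slot_start S 0 Q = 0"
| "slot_start S (Suc n) Q = slot_start S n (parent Q)
     + (\<Sum>Q'\<in>children (parent Q). if rank Q' < rank Q then flow S (Suc n) Q' else 0)"

text \<open>The cells of one level are laid out in the unit interval as consecutive intervals whose lengths
  are their masses. The four children of a cell are ordered by \<open>rank\<close>.\<close>

definition slot :: "(nat \<Rightarrow> cell \<Rightarrow> real) \<Rightarrow> nat \<Rightarrow> cell \<Rightarrow> real set" where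
  "slot S n Q = {slot_start S n Q..<slot_start S n Q + flow S n Q}"

lemma slot_start_children:
  fixes a b :: int and S :: "nat \<Rightarrow> cell \<Rightarrow> real" and n :: nat
  defines "f \<equiv> flow S (Suc n)" and "l \<equiv> slot_start S n (a, b)"
  shows "slot_start S (Suc n) (2 * a, 2 * b) = l"
    "slot_start S (Suc n) (2 * a, 2 * b + 1) = l + f (2 * a, 2 * b)"
    "slot_start S (Suc n) (2 * a + 1, 2 * b) = l + f (2 * a, 2 * b) + f (2 * a, 2 * b + 1)"
    "slot_start S (Suc n) (2 * a + 1, 2 * b + 1)
       = l + f (2 * a, 2 * b) + f (2 * a, 2 * b + 1) + f (2 * a + 1, 2 * b)"
proof -
  have r: "rank (2 * a, 2 * b) = 0" "rank (2 * a, 2 * b + 1) = 1"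
    "rank (2 * a + 1, 2 * b) = 2" "rank (2 * a + 1, 2 * b + 1) = 3"
    by (simp_all add: rank_def)
  have p: "parent (2 * a, 2 * b) = (a, b)" "parent (2 * a, 2 * b + 1) = (a, b)"
    "parent (2 * a + 1, 2 * b) = (a, b)" "parent (2 * a + 1, 2 * b + 1) = (a, b)"
    by (simp_all add: parent_def)
  have ne: "2 * a \<noteq> 2 * a + 1" "2 * b \<noteq> 2 * b + 1" "2 * a + 1 \<noteq> 2 * a" "2 * b + 1 \<noteq> 2 * b" by auto
  show "slot_start S (Suc n) (2 * a, 2 * b) = l"
    "slot_start S (Suc n) (2 * a, 2 * b + 1) = l + f (2 * a, 2 * b)"
    "slot_start S (Suc n) (2 * a + 1, 2 * b) = l + f (2 * a, 2 * b) + f (2 * a, 2 * b + 1)"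
    "slot_start S (Suc n) (2 * a + 1, 2 * b + 1)
       = l + f (2 * a, 2 * b) + f (2 * a, 2 * b + 1) + f (2 * a + 1, 2 * b)"
    unfolding slot_start.simps p children_eq f_def[symmetric] l_def[symmetric]
    by (simp_all only: sum.insert finite.intros insert_iff empty_iff prod.inject ne simp_thms sum.empty r if_True if_False)
      simp_all
qed

text \<open>Since the current is conserved, the slots of the children tile the slot of the parent.\<close>

lemma slot_children:
  assumes c: "\<And>N. conductances N S" and pos: "S 0 (0, 0) > 0"
  shows "(\<Union>Q'\<in>children Q. slot S (Suc n) Q') = slot S n Q"
    and "Q' \<in> children Q \<Longrightarrow> Q'' \<in> children Q \<Longrightarrow> Q' \<noteq> Q'' \<Longrightarrow> slot S (Suc n) Q' \<inter> slot S (Suc n) Q'' = {}"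
proof -
  obtain a b where Q: "Q = (a, b)" by force
  have sum: "(\<Sum>Q'\<in>children Q. flow S (Suc n) Q') = flow S n Q"
    by (rule sum_flow_children[OF c pos lessI])
  have nn: "0 \<le> flow S (Suc n) Q'" for Q' by (rule flow_nonneg[OF c])
  define w x y z where "w = flow S (Suc n) (2 * a, 2 * b)" and "x = flow S (Suc n) (2 * a, 2 * b + 1)"
    and "y = flow S (Suc n) (2 * a + 1, 2 * b)" and "z = flow S (Suc n) (2 * a + 1, 2 * b + 1)"
  note fl = w_def[symmetric] x_def[symmetric] y_def[symmetric] z_def[symmetric]
  have n: "0 \<le> w" "0 \<le> x" "0 \<le> y" "0 \<le> z" using nn by (simp_all only: w_def x_def y_def z_def)
  have s: "flow S n (a, b) = w + x + y + z"
    using sum unfolding Q children_eq by (simp add: fl del: flow.simps)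
  show "(\<Union>Q'\<in>children Q. slot S (Suc n) Q') = slot S n Q"
    unfolding Q children_eq slot_def using n
    by (auto simp: slot_start_children fl s simp del: flow.simps slot_start.simps)
  show "Q' \<in> children Q \<Longrightarrow> Q'' \<in> children Q \<Longrightarrow> Q' \<noteq> Q'' \<Longrightarrow> slot S (Suc n) Q' \<inter> slot S (Suc n) Q'' = {}"
    unfolding Q children_eq slot_def using n
    by (elim insertE emptyE; simp add: slot_start_children fl s del: flow.simps slot_start.simps)
qed

lemma slot_disjoint:
  assumes c: "\<And>N. conductances N S" and pos: "S 0 (0, 0) > 0"
  shows "Q \<in> level n \<Longrightarrow> Q' \<in> level n \<Longrightarrow> t \<in> slot S n Q \<Longrightarrow> t \<in> slot S n Q' \<Longrightarrow> Q = Q'"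
proof (induction n arbitrary: Q Q')
  case (Suc n)
  have "t \<in> slot S n (parent Q)" "t \<in> slot S n (parent Q')"
    using slot_children(1)[OF c pos, of n] Suc.prems by fastforce+
  with Suc have "parent Q = parent Q'" by (simp del: flow.simps)
  then show ?case
    using slot_children(2)[OF c pos, of Q "parent Q" Q' n] Suc.prems by fastforce
qed simp

definition address :: "(nat \<Rightarrow> cell \<Rightarrow> real) \<Rightarrow> nat \<Rightarrow> real \<Rightarrow> cell" where
  "address S n t = (THE Q. Q \<in> level n \<and> t \<in> slot S n Q)"

lemma address:
  assumes c: "\<And>N. conductances N S" and pos: "S 0 (0, 0) > 0" and t: "t \<in> {0..<1}"
  shows "address S n t \<in> level n" "t \<in> slot S n (address S n t)"
    "parent (address S (Suc n) t) = address S n t" "flow S n (address S n t) > 0"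
    "Q \<in> level n \<Longrightarrow> address S n t = Q \<longleftrightarrow> t \<in> slot S n Q"
proof -
  have ex: "\<exists>Q\<in>level n. t \<in> slot S n Q" for n
  proof (induction n)
    case 0 then show ?case using t by (simp add: slot_def)
  next
    case (Suc n)
    then obtain Q where Q: "Q \<in> level n" "t \<in> slot S n Q" by auto
    then obtain Q' where "Q' \<in> children Q" "t \<in> slot S (Suc n) Q'"
      using slot_children(1)[OF c pos, of n Q] by blast
    with Q show ?case by (intro bexI[of _ Q']) auto
  qed
  have ex1: "\<exists>!Q. Q \<in> level n \<and> t \<in> slot S n Q" for n
    using ex[of n] slot_disjoint[OF c pos] by blast
  have *: "address S n t \<in> level n \<and> t \<in> slot S n (address S n t)" for n
    unfolding address_def by (rule theI'[OF ex1])
  then show 1: "address S n t \<in> level n" "t \<in> slot S n (address S n t)" by auto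
  show "flow S n (address S n t) > 0" using 1(2) by (auto simp: slot_def)
  show "Q \<in> level n \<Longrightarrow> address S n t = Q \<longleftrightarrow> t \<in> slot S n Q"
    using 1 ex1[of n] by blast
  have "t \<in> slot S n (parent (address S (Suc n) t))"
    using slot_children(1)[OF c pos, of n] *[of "Suc n"] by fastforce
  then show "parent (address S (Suc n) t) = address S n t"
    using 1 *[of "Suc n"] ex1[of n] by (metis level_Suc_iff)
qed

lemma slot_subset:
  assumes c: "\<And>N. conductances N S" and pos: "S 0 (0, 0) > 0"
  shows "Q \<in> level n \<Longrightarrow> slot S n Q \<subseteq> {0..<1}"
proof (induction n arbitrary: Q)
  case 0 then show ?case by (simp add: slot_def)
next
  case (Suc n)
  have "slot S (Suc n) Q \<subseteq> slot S n (parent Q)"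
    using slot_children(1)[OF c pos, of n "parent Q"] by fastforce
  also have "\<dots> \<subseteq> {0..<1}" using Suc by simp
  finally show ?case .
qed

lemma address_eq_iff_slot:
  assumes c: "\<And>N. conductances N S" and pos: "S 0 (0, 0) > 0" and Q: "Q \<in> level n"
  shows "{t \<in> {0..<1}. address S n t = Q} = slot S n Q"
  using slot_subset[OF c pos Q] address(5)[OF c pos _ Q] by blast

lemma emeasure_slot:
  assumes "\<And>N. conductances N S"
  shows "emeasure lborel (slot S n Q) = ennreal (flow S n Q)"
  using flow_nonneg[OF assms, of n Q] by (simp add: slot_def)

section \<open>Dyadic cells of a square in the plane\<close>

text \<open>Cells of level \<open>n\<close> are half-open squares of side \<open>2 L / 2\<^sup>n\<close>,
  and the root cell is \<open>[-L, L)\<close> squared.\<close>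

definition cell_of :: "real \<Rightarrow> nat \<Rightarrow> complex \<Rightarrow> cell" where
  "cell_of L n z = (\<lfloor>2 ^ n * ((Re z + L) / (2 * L))\<rfloor>, \<lfloor>2 ^ n * ((Im z + L) / (2 * L))\<rfloor>)"

lemma floor_double_div2: "\<lfloor>2 * x\<rfloor> div 2 = \<lfloor>x::real\<rfloor>"
proof -
  have "\<lfloor>2 * x\<rfloor> = 2 * \<lfloor>x\<rfloor> \<or> \<lfloor>2 * x\<rfloor> = 2 * \<lfloor>x\<rfloor> + 1"
    by (simp add: floor_eq_iff) linarith
  then show ?thesis by presburger
qed

lemma parent_cell_of: "parent (cell_of L (Suc n) z) = cell_of L n z"
  using floor_double_div2[of "2 ^ n * ((Re z + L) / (2 * L))"] floor_double_div2[of "2 ^ n * ((Im z + L) / (2 * L))"]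
  by (simp add: parent_def cell_of_def mult.assoc)

lemma funpow_parent_cell_of: "(parent ^^ j) (cell_of L (n + j) z) = cell_of L n z"
  by (induction j) (simp_all add: funpow_Suc_right parent_cell_of del: funpow.simps)

lemma floor_close:
  fixes x y :: real
  assumes "L > 0" "\<lfloor>2 ^ n * ((x + L) / (2 * L))\<rfloor> = \<lfloor>2 ^ n * ((y + L) / (2 * L))\<rfloor>"
  shows "\<bar>x - y\<bar> \<le> 2 * L / 2 ^ n"
proof -
  have "\<bar>2 ^ n * ((x + L) / (2 * L)) - 2 ^ n * ((y + L) / (2 * L))\<bar> \<le> 1"
    using assms(2) by linarith
  also have "2 ^ n * ((x + L) / (2 * L)) - 2 ^ n * ((y + L) / (2 * L)) = (x - y) * (2 ^ n / (2 * L))"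
    using assms(1) by (simp add: field_simps)
  finally have "\<bar>x - y\<bar> * (2 ^ n / (2 * L)) \<le> 1" using assms(1) by (simp add: abs_mult)
  then show ?thesis using assms(1) by (simp add: field_simps)
qed

lemma floor_near:
  fixes x y :: real
  assumes "L > 0" "\<bar>x - y\<bar> < 2 * L / 2 ^ n"
  shows "\<bar>\<lfloor>2 ^ n * ((x + L) / (2 * L))\<rfloor> - \<lfloor>2 ^ n * ((y + L) / (2 * L))\<rfloor>\<bar> \<le> 1"
proof -
  have "\<bar>x - y\<bar> * (2 ^ n / (2 * L)) < 1" using assms by (simp add: field_simps)
  moreover have "2 ^ n * ((x + L) / (2 * L)) - 2 ^ n * ((y + L) / (2 * L)) = (x - y) * (2 ^ n / (2 * L))"
    using assms(1) by (simp add: field_simps)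
  ultimately have "\<bar>2 ^ n * ((x + L) / (2 * L)) - 2 ^ n * ((y + L) / (2 * L))\<bar> < 1"
    using assms(1) by (simp add: abs_mult)
  then show ?thesis by linarith
qed

lemma same_cell_dist:
  assumes "L > 0" "cell_of L n z = cell_of L n w"
  shows "norm (z - w) \<le> 2 * (2 * L / 2 ^ n)"
proof -
  have "\<bar>Re z - Re w\<bar> \<le> 2 * L / 2 ^ n" "\<bar>Im z - Im w\<bar> \<le> 2 * L / 2 ^ n"
    using assms by (auto simp: cell_of_def intro!: floor_close)
  then show ?thesis using cmod_le[of "z - w"] by simp
qed

text \<open>Points closer than the side length of a cell lie in neighbouring cells, though possibly in cells
  that are far apart in the tree.\<close>

lemma dist_imp_near:
  assumes "L > 0" "norm (z - w) < 2 * L / 2 ^ n"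
  shows "near (cell_of L n z) (cell_of L n w)"
proof -
  have "\<bar>Re z - Re w\<bar> < 2 * L / 2 ^ n" "\<bar>Im z - Im w\<bar> < 2 * L / 2 ^ n"
    using abs_Re_le_cmod[of "z - w"] abs_Im_le_cmod[of "z - w"] assms(2) by auto
  from this[THEN floor_near[OF assms(1)]] show ?thesis by (simp only: near_def cell_of_def fst_conv snd_conv simp_thms)
qed

lemma cell_of_root: 
  assumes "L > 0"
  shows "cell_of L 0 z = (0, 0) \<longleftrightarrow> - L \<le> Re z \<and> Re z < L \<and> - L \<le> Im z \<and> Im z < L"
  using assms by (auto simp: cell_of_def floor_eq_iff field_simps)

text \<open>Up to a constant, the logarithm of a distance counts the scales that exceed it.\<close>

lemma scales_above:
  assumes "L > 0" "\<rho> > 0"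
  shows "finite {n. \<rho> < 2 * L / 2 ^ n}" (is "finite ?A")
    and "ln (2 * L / \<rho>) \<le> ln 2 * real (card {n. \<rho> < 2 * L / 2 ^ n})"
proof -
  obtain k0 :: nat where "2 * L / \<rho> < 2 ^ k0" using real_arch_pow[of 2 "2 * L / \<rho>"] by auto
  then have ex: "2 * L / \<rho> \<le> 2 ^ k0" by simp
  define k :: nat where "k = (LEAST k. 2 * L / \<rho> \<le> 2 ^ k)"
  have k: "2 * L / \<rho> \<le> 2 ^ k" unfolding k_def by (rule LeastI[of "\<lambda>k. 2 * L / \<rho> \<le> 2 ^ k", OF ex])
  have "n \<in> ?A \<longleftrightarrow> n < k" for n
  proof
    assume "n \<in> ?A"
    then have "2 ^ n < 2 * L / \<rho>" using assms by (simp add: field_simps)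
    also note k
    finally show "n < k" by simp
  next
    assume "n < k"
    then have "\<not> 2 * L / \<rho> \<le> 2 ^ n" unfolding k_def by (rule not_less_Least)
    then show "n \<in> ?A" using assms by (simp add: field_simps)
  qed
  then have A: "?A = {..<k}" by auto
  show "finite ?A" unfolding A by simp
  have "ln (2 * L / \<rho>) \<le> ln (2 ^ k)" using k assms by (subst ln_le_cancel_iff) auto
  then show "ln (2 * L / \<rho>) \<le> ln 2 * real (card ?A)" unfolding A by (simp add: ln_realpow mult.commute)
qed

section \<open>Logarithmic capacity and finite energy\<close>

text \<open>The energy of a compactly supported measure differs from \<open>-\<infinity>\<close> iff the
  negative part of the logarithm, with value \<open>\<infinity>\<close> on the diagonal, has a
  finite double integral.\<close>

definition neg_log :: "complex \<Rightarrow> complex \<Rightarrow> ennreal" where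
  "neg_log z w = e2ennreal (- log_dist z w)"

lemma neg_log_eq: "neg_log z w = (if z = w then \<infinity> else ennreal (- ln (norm (z - w))))"
  by (simp add: neg_log_def log_dist_def e2ennreal_ereal)

lemma measurable_neg_log [measurable (raw)]:
  assumes [measurable]: "f \<in> borel_measurable M" "g \<in> borel_measurable M"
  shows "(\<lambda>x. neg_log (f x) (g x)) \<in> borel_measurable M"
  unfolding neg_log_eq by measurable

lemma measurable_log_dist [measurable (raw)]:
  assumes [measurable]: "f \<in> borel_measurable M" "g \<in> borel_measurable M"
  shows "(\<lambda>x. log_dist (f x) (g x)) \<in> borel_measurable M"
  unfolding log_dist_def by measurable

text \<open>By second countability, countably many null open sets cover the complement of the support.\<close>

lemma AE_measure_support:
  fixes \<mu> :: "'a::second_countable_topology measure"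
  assumes sets: "sets \<mu> = sets borel"
  shows "AE x in \<mu>. x \<in> measure_support \<mu>"
proof -
  obtain B :: "'a set set" where B: "countable B" "\<And>C. C \<in> B \<Longrightarrow> open C" "\<And>S. open S \<Longrightarrow> \<exists>U\<subseteq>B. S = \<Union> U"
    using univ_second_countable by metis
  define N where "N = {C \<in> B. emeasure \<mu> C = 0}"
  have "countable N" unfolding N_def using B(1) by auto
  then have "AE x in \<mu>. \<forall>C\<in>N. x \<notin> C"
  proof (subst AE_ball_countable, simp, intro ballI)
    fix C assume "C \<in> N"
    then have "C \<in> null_sets \<mu>"
      using B(2) sets by (auto simp: N_def null_sets_def)
    then show "AE x in \<mu>. x \<notin> C" by (rule AE_not_in)
  qed
  then show ?thesis
  proof eventually_elim
    case (elim x)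
    show ?case unfolding measure_support_def
    proof (intro CollectI allI impI)
      fix U assume U: "open U \<and> x \<in> U"
      obtain \<U> where "\<U> \<subseteq> B" "U = \<Union> \<U>" using B(3) U by blast
      then obtain C where C: "C \<in> B" "x \<in> C" "C \<subseteq> U" using U by blast
      have "emeasure \<mu> C \<noteq> 0" using elim C by (auto simp: N_def)
      moreover have "emeasure \<mu> C \<le> emeasure \<mu> U"
        using C U sets by (intro emeasure_mono) auto
      ultimately show "emeasure \<mu> U > 0" by (metis le_zero_eq not_gr_zero)
    qed
  qed
qed

lemma measure_support_subset_closed:
  fixes \<mu> :: "'a::topological_space measure"
  assumes "closed K" "AE x in \<mu>. x \<in> K" "sets \<mu> = sets borel"
  shows "measure_support \<mu> \<subseteq> K"
proof (rule ccontr)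
  assume "\<not> ?thesis"
  then obtain x where x: "x \<in> measure_support \<mu>" "x \<notin> K" by auto
  have "emeasure \<mu> (- K) = 0"
    using assms(2) assms(1,3) sets_eq_imp_space_eq[OF assms(3)]
    by (subst (asm) AE_iff_measurable[where N = "- K"]) auto
  moreover have "emeasure \<mu> (- K) > 0"
    using x assms(1) by (auto simp: measure_support_def)
  ultimately show False by simp
qed

lemma closed_measure_support: "closed (measure_support \<mu>)"
proof -
  have "- measure_support \<mu> = \<Union>{U. open U \<and> \<not> emeasure \<mu> U > 0}"
    by (auto simp: measure_support_def)
  then show ?thesis by (auto simp: closed_def)
qed

lemma finite_energy_imp_log_capacity_pos:
  assumes "prob_space \<mu>" and sets: "sets \<mu> = sets borel" and K: "compact K" "K \<subseteq> E" "AE z in \<mu>. z \<in> K"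
    and fin: "(\<integral>\<^sup>+z. \<integral>\<^sup>+w. neg_log z w \<partial>\<mu> \<partial>\<mu>) < \<infinity>"
  shows "log_capacity E > 0"
proof -
  interpret prob_space \<mu> by fact
  define F where "F z = ereal_integral \<mu> (\<lambda>w. log_dist z w)" for z
  have "(\<integral>\<^sup>+z. e2ennreal (- F z) \<partial>\<mu>) \<le> (\<integral>\<^sup>+z. \<integral>\<^sup>+w. neg_log z w \<partial>\<mu> \<partial>\<mu>)"
  proof (rule nn_integral_mono)
    fix z
    have "- (enn2ereal a - enn2ereal b) \<le> enn2ereal b" for a b
      by (cases a; cases b) auto
    then have "- F z \<le> enn2ereal (\<integral>\<^sup>+w. neg_log z w \<partial>\<mu>)"
      unfolding F_def ereal_integral_def neg_log_def .
    then have "e2ennreal (- F z) \<le> e2ennreal (enn2ereal (\<integral>\<^sup>+w. neg_log z w \<partial>\<mu>))"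
      by (rule e2ennreal_mono)
    then show "e2ennreal (- F z) \<le> (\<integral>\<^sup>+w. neg_log z w \<partial>\<mu>)" by simp
  qed
  with fin have "(\<integral>\<^sup>+z. e2ennreal (- F z) \<partial>\<mu>) < \<infinity>" by (rule order.strict_trans1[rotated])
  then have "energy \<mu> \<noteq> - \<infinity>"
    unfolding energy_def F_def[symmetric] ereal_integral_def[of \<mu> F]
    by (cases "\<integral>\<^sup>+z. e2ennreal (- F z) \<partial>\<mu>"; cases "\<integral>\<^sup>+z. e2ennreal (F z) \<partial>\<mu>") auto
  then have pos: "exp_ereal (energy \<mu>) > 0"
    by (cases "energy \<mu>") (auto simp: exp_ereal_def)
  have sub: "measure_support \<mu> \<subseteq> K"
    using K sets by (intro measure_support_subset_closed) (auto simp: compact_imp_closed)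
  then have "compact (measure_support \<mu>)"
    using K(1) closed_measure_support by (metis compact_Int_closed inf.absorb_iff2)
  then have "exp_ereal (energy \<mu>) \<le> log_capacity E"
    unfolding log_capacity_def using sub K(2) sets \<open>prob_space \<mu>\<close> by (intro SUP_upper) auto
  with pos show ?thesis by simp
qed

text \<open>On a compact support the positive part of the logarithm is bounded, so an energy different from
  \<open>-\<infinity>\<close> controls the negative part.\<close>

lemma log_capacity_pos_imp_finite_energy:
  assumes "log_capacity E > 0"
  obtains \<mu> K where "prob_space \<mu>" "sets \<mu> = sets borel" "compact K" "K \<subseteq> E" "AE z in \<mu>. z \<in> K"
    "(\<integral>\<^sup>+z. \<integral>\<^sup>+w. neg_log z w \<partial>\<mu> \<partial>\<mu>) < \<infinity>"
proof -
  obtain \<mu> where sets [measurable_cong]: "sets \<mu> = sets borel" and "prob_space \<mu>"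
    and comp: "compact (measure_support \<mu>)" "measure_support \<mu> \<subseteq> E" and pos: "exp_ereal (energy \<mu>) > 0"
    using assms unfolding log_capacity_def less_SUP_iff by auto
  interpret prob_space \<mu> by fact
  define K where "K = measure_support \<mu>"
  have AEK: "AE z in \<mu>. z \<in> K" unfolding K_def by (rule AE_measure_support[OF sets])
  obtain R where R: "R \<ge> 1" "\<And>z. z \<in> K \<Longrightarrow> norm z \<le> R"
  proof -
    obtain b where "\<forall>z\<in>K. norm z \<le> b" using compact_imp_bounded[OF comp(1)] by (auto simp: K_def bounded_iff)
    then show ?thesis by (intro that[of "max 1 b"]) auto
  qed
  define C where "C = ln (2 * R)"
  have "C \<ge> 0" using R by (simp add: C_def)
  define A where "A z = (\<integral>\<^sup>+w. e2ennreal (log_dist z w) \<partial>\<mu>)" for z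
  define B where "B z = (\<integral>\<^sup>+w. neg_log z w \<partial>\<mu>)" for z
  define F where "F z = ereal_integral \<mu> (\<lambda>w. log_dist z w)" for z
  have F: "F z = enn2ereal (A z) - enn2ereal (B z)" for z
    by (simp add: F_def A_def B_def ereal_integral_def neg_log_def)
  have [measurable]: "A \<in> borel_measurable \<mu>" "B \<in> borel_measurable \<mu>" unfolding A_def B_def by measurable
  have A: "A z \<le> ennreal C" if "z \<in> K" for z
  proof -
    have "A z \<le> (\<integral>\<^sup>+w. ennreal C \<partial>\<mu>)"
      unfolding A_def
    proof (rule nn_integral_mono_AE, use AEK in eventually_elim)
      fix w assume "w \<in> K"
      then have "norm (z - w) \<le> 2 * R" using norm_triangle_ineq4[of z w] R(2)[of z] R(2)[of w] that by linarith
      then show "e2ennreal (log_dist z w) \<le> ennreal C"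
        using R(1) by (auto simp: log_dist_def C_def e2ennreal_ereal e2ennreal_neg intro!: ennreal_leI)
    qed
    then show ?thesis by (simp add: emeasure_space_1)
  qed
  have P: "(\<integral>\<^sup>+z. e2ennreal (F z) \<partial>\<mu>) \<le> ennreal C"
  proof -
    have "(\<integral>\<^sup>+z. e2ennreal (F z) \<partial>\<mu>) \<le> (\<integral>\<^sup>+z. ennreal C \<partial>\<mu>)"
    proof (rule nn_integral_mono_AE, use AEK in eventually_elim)
      fix z assume "z \<in> K"
      have "enn2ereal a - enn2ereal b \<le> enn2ereal a" for a b
        by (cases a; cases b) auto
      then have "e2ennreal (F z) \<le> e2ennreal (enn2ereal (A z))" unfolding F by (intro e2ennreal_mono)
      with A[OF \<open>z \<in> K\<close>] show "e2ennreal (F z) \<le> ennreal C" by simp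
    qed
    then show ?thesis by (simp add: emeasure_space_1)
  qed
  have "energy \<mu> \<noteq> - \<infinity>" using pos by (auto simp: exp_ereal_def)
  then have N: "(\<integral>\<^sup>+z. e2ennreal (- F z) \<partial>\<mu>) < \<infinity>"
    unfolding energy_def F_def[symmetric] ereal_integral_def[of \<mu> F]
    using P by (cases "\<integral>\<^sup>+z. e2ennreal (- F z) \<partial>\<mu>"; cases "\<integral>\<^sup>+z. e2ennreal (F z) \<partial>\<mu>") (auto simp: top_unique)
  have [measurable]: "F \<in> borel_measurable \<mu>" unfolding F by measurable
  have "(\<integral>\<^sup>+z. B z \<partial>\<mu>) \<le> (\<integral>\<^sup>+z. e2ennreal (- F z) + ennreal C \<partial>\<mu>)"
  proof (rule nn_integral_mono_AE, use AEK in eventually_elim)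
    fix z assume "z \<in> K"
    have "b \<le> e2ennreal (- (enn2ereal a - enn2ereal b)) + ennreal C" if "a \<le> ennreal C" for a b
    proof (cases a)
      case (real x)
      then have "x \<le> C" using that \<open>C \<ge> 0\<close> by simp
      show ?thesis
      proof (cases b)
        case (real y)
        show ?thesis using real \<open>a = ennreal x\<close> \<open>0 \<le> x\<close> \<open>x \<le> C\<close> \<open>C \<ge> 0\<close>
          by (cases "y \<le> x") (auto simp: e2ennreal_ereal ennreal_plus[symmetric] ennreal_neg simp del: ennreal_plus intro!: ennreal_leI)
      next
        case top
        then show ?thesis using \<open>a = ennreal x\<close> \<open>0 \<le> x\<close> by (simp add: enn2ereal_ennreal)
      qed
    qed (use that in \<open>simp add: top_unique\<close>)
    from this[OF A[OF \<open>z \<in> K\<close>]] show "B z \<le> e2ennreal (- F z) + ennreal C" unfolding F .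
  qed
  also have "\<dots> = (\<integral>\<^sup>+z. e2ennreal (- F z) \<partial>\<mu>) + ennreal C"
    by (subst nn_integral_add) (auto simp: emeasure_space_1)
  also have "\<dots> < \<infinity>" using N by simp
  finally have "(\<integral>\<^sup>+z. \<integral>\<^sup>+w. neg_log z w \<partial>\<mu> \<partial>\<mu>) < \<infinity>" by (simp add: B_def)
  then show ?thesis
    using that[of \<mu> K] \<open>prob_space \<mu>\<close> sets comp AEK unfolding K_def by blast
qed

text \<open>An atom interacts with itself with infinite energy.\<close>

lemma finite_energy_no_atoms:
  assumes "prob_space \<mu>" and sets [measurable_cong]: "sets \<mu> = sets borel"
    and fin: "(\<integral>\<^sup>+z. \<integral>\<^sup>+w. neg_log z w \<partial>\<mu> \<partial>\<mu>) < \<infinity>"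
  shows "AE z in \<mu>. z \<noteq> a"
proof -
  interpret prob_space \<mu> by fact
  have "\<infinity> * emeasure \<mu> {a} * emeasure \<mu> {a} = (\<integral>\<^sup>+z. (\<integral>\<^sup>+w. \<infinity> * indicator {a} w \<partial>\<mu>) * indicator {a} z \<partial>\<mu>)"
    using sets by (subst nn_integral_cmult_indicator; simp)+
  also have "\<dots> \<le> (\<integral>\<^sup>+z. \<integral>\<^sup>+w. neg_log z w \<partial>\<mu> \<partial>\<mu>)"
  proof (rule nn_integral_mono)
    fix z show "(\<integral>\<^sup>+w. \<infinity> * indicator {a} w \<partial>\<mu>) * indicator {a} z \<le> (\<integral>\<^sup>+w. neg_log z w \<partial>\<mu>)"
      by (cases "z = a") (auto simp: neg_log_eq indicator_def intro!: nn_integral_mono)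
  qed
  also note fin
  finally have "emeasure \<mu> {a} = 0" 
    by (cases "emeasure \<mu> {a} = 0") (auto simp: ennreal_top_mult)
  then have "{a} \<in> null_sets \<mu>" using sets by (auto simp: null_sets_def)
  from AE_not_in[OF this] show ?thesis by simp
qed

section \<open>A charged tree gives positive capacity\<close>

lemma suminf_ennreal_const:
  fixes c :: real assumes "c > 0" shows "(\<Sum>n. ennreal c) = top"
proof (rule ccontr)
  assume "(\<Sum>n. ennreal c) \<noteq> top"
  then obtain r where r: "r \<ge> 0" "(\<Sum>n. ennreal c) = ennreal r" by (cases "\<Sum>n. ennreal c") auto
  obtain k :: nat where k: "r < real k * c" using reals_Archimedean3[OF assms] by auto
  have "(\<Sum>n<k. ennreal c) \<le> (\<Sum>n. ennreal c)" by (rule sum_le_suminf) auto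
  then have "ennreal (real k * c) \<le> ennreal r"
    using r assms by (simp add: ennreal_of_nat_eq_real_of_nat ennreal_mult'[symmetric])
  then show False using k r by (simp add: ennreal_le_iff)
qed

text \<open>In the case of equal points every scale counts, and both sides are infinite.\<close>

lemma neg_log_le_near_count:
  assumes L: "L > 0" and near: "\<And>n. norm (z - w) < 2 * L / 2 ^ n \<Longrightarrow> A n"
  shows "neg_log z w \<le> ennreal \<bar>ln (2 * L)\<bar> + (\<Sum>n. ennreal (ln 2) * of_bool (A n))"
proof (cases "z = w")
  case True
  have "A n" for n by (rule near) (use True L in simp)
  then have "(\<Sum>n. ennreal (ln 2) * of_bool (A n)) = (\<Sum>n. ennreal (ln 2))"
    by (simp only: of_bool_eq mult_1_right)
  also have "\<dots> = top" by (rule suminf_ennreal_const) simp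
  finally show ?thesis by (simp only: add_top_right_ennreal top_greatest)
next
  case False
  define \<rho> where "\<rho> = norm (z - w)"
  have "\<rho> > 0" using False by (simp add: \<rho>_def)
  define N where "N = {n. \<rho> < 2 * L / 2 ^ n}"
  have N: "finite N" "ln (2 * L / \<rho>) \<le> ln 2 * real (card N)"
    unfolding N_def using scales_above[OF L \<open>\<rho> > 0\<close>] by auto
  have "- ln \<rho> \<le> \<bar>ln (2 * L)\<bar> + ln 2 * real (card N)"
    using N(2) L \<open>\<rho> > 0\<close> by (simp add: ln_div)
  then have "ennreal (- ln \<rho>) \<le> ennreal (\<bar>ln (2 * L)\<bar> + ln 2 * real (card N))"
    by (rule ennreal_leI)
  also have "\<dots> = ennreal \<bar>ln (2 * L)\<bar> + ennreal (ln 2 * real (card N))"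
    by (rule ennreal_plus) simp_all
  also have "ennreal (ln 2 * real (card N)) = (\<Sum>n\<in>N. ennreal (ln 2) * of_bool (A n))"
  proof -
    have "A n" if "n \<in> N" for n using that near by (simp add: N_def \<rho>_def)
    then have "(\<Sum>n\<in>N. ennreal (ln 2) * of_bool (A n)) = (\<Sum>n\<in>N. ennreal (ln 2))" by simp
    then show ?thesis by (simp add: ennreal_mult' ennreal_of_nat_eq_real_of_nat mult.commute)
  qed
  also have "\<dots> \<le> (\<Sum>n. ennreal (ln 2) * of_bool (A n))"
    by (rule sum_le_suminf) (use N in auto)
  finally show ?thesis using False by (simp add: neg_log_eq \<rho>_def add_left_mono)
qed

lemma measurable_address:
  assumes c: "\<And>N. conductances N S" and pos: "S 0 (0, 0) > 0"
  shows "address S n \<in> restrict_space lborel {0..<1} \<rightarrow>\<^sub>M count_space UNIV"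
proof (subst measurable_count_space_eq_countable)
  show "countable (UNIV :: cell set)" by simp
  show "address S n \<in> space (restrict_space lborel {0..<1}) \<rightarrow> UNIV \<and>
    (\<forall>Q\<in>UNIV. address S n -` {Q} \<inter> space (restrict_space lborel {0..<1}) \<in> sets (restrict_space lborel {0..<1}))"
  proof safe
    fix Q
    have "address S n -` {Q} \<inter> space (restrict_space lborel {0..<1}) = {t \<in> {0..<1}. address S n t = Q}"
      by (auto simp: space_restrict_space)
    also have "\<dots> \<in> sets (restrict_space lborel {0..<1})"
    proof (cases "Q \<in> level n")
      case True
      from slot_subset[OF c pos True] show ?thesis unfolding address_eq_iff_slot[OF c pos True]
        by (subst sets_restrict_space_iff) (auto simp: slot_def)
    next
      case False
      then have "{t \<in> {0..<1}. address S n t = Q} = {}" using address(1)[OF c pos, of _ n] by auto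
      then show ?thesis by (simp only: sets.empty_sets)
    qed
    finally show "address S n -` {Q} \<inter> space (restrict_space lborel {0..<1}) \<in> sets (restrict_space lborel {0..<1})" .
  qed auto
qed

lemma nn_integral_near_address:
  assumes c: "\<And>N. conductances N S" and pos: "S 0 (0, 0) > 0"
  defines "M \<equiv> restrict_space lborel {0..<1::real}"
  shows "(\<integral>\<^sup>+s. \<integral>\<^sup>+t. of_bool (near (address S n s) (address S n t)) \<partial>M \<partial>M)
      \<le> ennreal (9 * (\<Sum>Q\<in>level n. (flow S n Q)\<^sup>2))"
proof -
  have sl: "slot S n Q \<in> sets M" "emeasure M (slot S n Q) = ennreal (flow S n Q)" if "Q \<in> level n" for Q
  proof -
    note sub = slot_subset[OF c pos that]
    then show "slot S n Q \<in> sets M"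
      unfolding M_def by (subst sets_restrict_space_iff) (auto simp: slot_def)
    show "emeasure M (slot S n Q) = ennreal (flow S n Q)"
      unfolding M_def using sub emeasure_slot[OF c] by (subst emeasure_restrict_space) auto
  qed
  have fl: "0 \<le> flow S n Q" for Q by (rule flow_nonneg[OF c])
  have ind: "indicator (slot S n Q) s = of_bool (address S n s = Q)" if "Q \<in> level n" "s \<in> {0..<1}" for Q s
    using address(5)[OF c pos that(2,1)] by (simp add: indicator_def)
  have inner: "(\<integral>\<^sup>+t. of_bool (near P (address S n t)) \<partial>M) = (\<Sum>Q\<in>level n. of_bool (near P Q) * ennreal (flow S n Q))" for P
  proof -
    have "(\<integral>\<^sup>+t. of_bool (near P (address S n t)) \<partial>M) = (\<integral>\<^sup>+t. (\<Sum>Q\<in>level n. of_bool (near P Q) * indicator (slot S n Q) t) \<partial>M)"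
    proof (rule nn_integral_cong)
      fix t assume "t \<in> space M"
      then have t: "t \<in> {0..<1}" by (simp add: M_def space_restrict_space)
      have "(\<Sum>Q\<in>level n. of_bool (near P Q) * indicator (slot S n Q) t)
          = (\<Sum>Q\<in>level n. if Q = address S n t then of_bool (near P Q) else (0::ennreal))"
        by (intro sum.cong refl) (use t in \<open>auto simp: ind\<close>)
      also have "\<dots> = of_bool (near P (address S n t))"
        using address(1)[OF c pos t, of n] by simp
      finally show "of_bool (near P (address S n t)) = (\<Sum>Q\<in>level n. of_bool (near P Q) * indicator (slot S n Q) t :: ennreal)" ..
    qed
    also have "\<dots> = (\<Sum>Q\<in>level n. of_bool (near P Q) * ennreal (flow S n Q))"
      by (subst nn_integral_sum) (auto simp: sl nn_integral_cmult_indicator intro!: sum.cong borel_measurable_times_ennreal borel_measurable_indicator)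
    finally show ?thesis .
  qed
  define I where "I P = (\<Sum>Q\<in>level n. of_bool (near P Q) * flow S n Q)" for P
  have I: "(\<Sum>Q\<in>level n. of_bool (near P Q) * ennreal (flow S n Q)) = ennreal (I P)" "0 \<le> I P" for P
  proof -
    show "0 \<le> I P" unfolding I_def by (intro sum_nonneg mult_nonneg_nonneg fl) simp
    have "(\<Sum>Q\<in>level n. of_bool (near P Q) * ennreal (flow S n Q)) = (\<Sum>Q\<in>level n. ennreal (of_bool (near P Q) * flow S n Q))"
      by (intro sum.cong refl) (simp add: of_bool_def)
    also have "\<dots> = ennreal (I P)" unfolding I_def by (intro sum_ennreal mult_nonneg_nonneg fl) simp
    finally show "(\<Sum>Q\<in>level n. of_bool (near P Q) * ennreal (flow S n Q)) = ennreal (I P)" .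
  qed
  have "(\<integral>\<^sup>+s. \<integral>\<^sup>+t. of_bool (near (address S n s) (address S n t)) \<partial>M \<partial>M) = (\<integral>\<^sup>+s. ennreal (I (address S n s)) \<partial>M)"
    by (simp add: inner I)
  also have "\<dots> = (\<integral>\<^sup>+s. (\<Sum>P\<in>level n. ennreal (I P) * indicator (slot S n P) s) \<partial>M)"
  proof (rule nn_integral_cong)
    fix s assume "s \<in> space M"
    then have s: "s \<in> {0..<1}" by (simp add: M_def space_restrict_space)
    have "(\<Sum>P\<in>level n. ennreal (I P) * indicator (slot S n P) s)
        = (\<Sum>P\<in>level n. if P = address S n s then ennreal (I P) else 0)"
      by (intro sum.cong refl) (use s in \<open>auto simp: ind\<close>)
    also have "\<dots> = ennreal (I (address S n s))"
      using address(1)[OF c pos s, of n] by simp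
    finally show "ennreal (I (address S n s)) = (\<Sum>P\<in>level n. ennreal (I P) * indicator (slot S n P) s)" ..
  qed
  also have "\<dots> = (\<Sum>P\<in>level n. ennreal (I P) * ennreal (flow S n P))"
    by (subst nn_integral_sum) (auto simp: sl nn_integral_cmult_indicator intro!: sum.cong borel_measurable_times_ennreal borel_measurable_indicator)
  also have "\<dots> = ennreal (\<Sum>P\<in>level n. I P * flow S n P)"
    using I(2) fl by (simp add: sum_ennreal ennreal_mult[symmetric])
  also have "(\<Sum>P\<in>level n. I P * flow S n P)
      = (\<Sum>P\<in>level n. \<Sum>Q\<in>level n. of_bool (near P Q) * (flow S n P * flow S n Q))"
    unfolding I_def sum_distrib_right by (intro sum.cong refl) (simp only: mult_ac)
  also have "ennreal \<dots> \<le> ennreal (9 * (\<Sum>Q\<in>level n. (flow S n Q)\<^sup>2))"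
    by (intro ennreal_leI sum_near_le) simp
  finally show ?thesis .
qed

text \<open>A uniformly random number lies in one slot of each level, hence determines a path of cells,
  which shrink to a point of \<open>E\<close>. The law of this point has finite energy, because
  \<open>-log\<close> of a distance is bounded by the number of levels at which the cells are
  neighbours, and the expected number is a sum of squares of the flow.\<close>

lemma log_capacity_pos_of_conductance:
  assumes "closed E" and L: "L > 0" and c: "\<And>N. conductances N S" and pos: "S 0 (0, 0) > 0"
    and meets: "\<And>n Q. S n Q > 0 \<Longrightarrow> \<exists>z\<in>E. cell_of L n z = Q"
  shows "log_capacity E > 0"
proof -
  define M where "M = restrict_space lborel {0..<1::real}"
  have spM: "space M = {0..<1}" by (simp add: M_def space_restrict_space)
  have "prob_space M"
    unfolding M_def by (rule prob_space_restrict_space) auto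
  then interpret M: prob_space M .
  obtain w where w: "\<And>n Q. S n Q > 0 \<Longrightarrow> w n Q \<in> E \<and> cell_of L n (w n Q) = Q"
    using meets by metis
  \<comment> \<open>Points of \<open>E\<close> in the nested cells of the path of \<open>t\<close>; they form a Cauchy sequence.\<close>
  define W where "W n t = w n (address S n t)" for n t
  have W: "W n t \<in> E" "cell_of L n (W n t) = address S n t" if "t \<in> {0..<1}" for n t
  proof -
    have "S n (address S n t) \<noteq> 0"
      using flow_nonzero_imp[of S n "address S n t"] address(4)[OF c pos that, of n] pos by auto
    then have "S n (address S n t) > 0" using conductances_nonneg[OF c, of n "address S n t"] by simp
    with w show "W n t \<in> E" "cell_of L n (W n t) = address S n t" by (auto simp: W_def)
  qed
  have cW: "cell_of L n (W (n + j) t) = address S n t" if "t \<in> {0..<1}" for n j t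
  proof -
    have "cell_of L n (W (n + j) t) = (parent ^^ j) (address S (n + j) t)"
      using funpow_parent_cell_of[of j L n] W(2)[OF that, of "n + j"] by metis
    also have "\<dots> = address S n t"
      by (induction j) (simp_all add: funpow_Suc_right address(3)[OF c pos that] del: funpow.simps)
    finally show ?thesis .
  qed
  have dW: "norm (W n t - W (n + j) t) \<le> 2 * (2 * L / 2 ^ n)" if "t \<in> {0..<1}" for n j t
    using cW[OF that, of n j] W(2)[OF that, of n] by (intro same_cell_dist[OF L]) simp
  have "\<exists>z. (\<lambda>n. W n t) \<longlonglongrightarrow> z" if t: "t \<in> {0..<1}" for t
  proof -
    have "Cauchy (\<lambda>n. W n t)"
    proof (rule metric_CauchyI)
      fix e :: real assume "e > 0"
      have "(\<lambda>n. 2 * (2 * L) * (1 / 2) ^ n) \<longlonglongrightarrow> 2 * (2 * L) * 0"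
        by (intro tendsto_intros LIMSEQ_realpow_zero) auto
      then have "\<forall>\<^sub>F n in sequentially. 2 * (2 * L) * (1 / 2) ^ n < e / 2"
        using \<open>e > 0\<close> by (intro order_tendstoD) auto
      then obtain n where n: "2 * (2 * L) * (1 / 2) ^ n < e / 2" by (auto simp: eventually_sequentially)
      have b: "dist (W n t) (W m t) < e / 2" if "m \<ge> n" for m
      proof -
        have "norm (W n t - W m t) \<le> 2 * (2 * L / 2 ^ n)" using dW[OF t, of n "m - n"] that by simp
        also have "\<dots> < e / 2" using n by (simp add: power_one_over field_simps)
        finally show ?thesis by (simp add: dist_norm)
      qed
      show "\<exists>n. \<forall>m\<ge>n. \<forall>k\<ge>n. dist (W m t) (W k t) < e"
        using b by (intro exI[of _ n]) (metis dist_triangle_half_r)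
    qed
    then show ?thesis by (simp add: Cauchy_convergent_iff convergent_def)
  qed
  then obtain T where T: "\<And>t. t \<in> {0..<1} \<Longrightarrow> (\<lambda>n. W n t) \<longlonglongrightarrow> T t" by metis
  have TE: "T t \<in> E" if "t \<in> {0..<1}" for t
    using closed_sequentially[OF \<open>closed E\<close> _ T[OF that]] W(1)[OF that] by auto
  have [measurable]: "W n \<in> borel_measurable M" for n
  proof -
    have "(\<lambda>t. w n (address S n t)) \<in> borel_measurable M"
      by (rule measurable_compose[OF measurable_address[OF c pos, folded M_def]]) simp
    then show ?thesis by (simp add: W_def[abs_def])
  qed
  have mT [measurable]: "T \<in> borel_measurable M"
    by (rule borel_measurable_LIMSEQ_metric[where f = W]) (use T spM in auto)
  have bT: "norm (T t) \<le> norm (W 0 0) + 4 * (2 * L)" if t: "t \<in> {0..<1}" for t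
  proof -
    have "norm (T t - W 0 t) \<le> 2 * (2 * L)"
    proof (rule LIMSEQ_le_const2)
      show "(\<lambda>n. norm (W n t - W 0 t)) \<longlonglongrightarrow> norm (T t - W 0 t)" by (intro tendsto_intros T t)
      show "\<exists>N. \<forall>n\<ge>N. norm (W n t - W 0 t) \<le> 2 * (2 * L)"
        using dW[OF t, of 0] by (auto simp: norm_minus_commute)
    qed
    moreover have "norm (W 0 t - W 0 0) \<le> 2 * (2 * L / 2 ^ 0)"
    proof (rule same_cell_dist[OF L])
      have "address S 0 t = (0, 0)" "address S 0 0 = (0, 0)"
        using address(1)[OF c pos, of _ 0] t by auto
      then show "cell_of L 0 (W 0 t) = cell_of L 0 (W 0 0)" using W(2)[of _ 0] t by simp
    qed
    ultimately show ?thesis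
      using norm_triangle_ineq[of "T t - W 0 t" "W 0 t - W 0 0"]
        norm_triangle_ineq[of "T t - W 0 0" "W 0 0"] by simp
  qed
  have near: "near (address S n s) (address S n t)"
    if "s \<in> {0..<1}" "t \<in> {0..<1}" "norm (T s - T t) < 2 * L / 2 ^ n" for s t n
  proof -
    have "(\<lambda>m. norm (W m s - W m t)) \<longlonglongrightarrow> norm (T s - T t)" by (intro tendsto_intros T that)
    then have "\<forall>\<^sub>F m in sequentially. norm (W m s - W m t) < 2 * L / 2 ^ n" using that(3) by (intro order_tendstoD)
    then obtain m0 where m0: "\<And>m. m \<ge> m0 \<Longrightarrow> norm (W m s - W m t) < 2 * L / 2 ^ n"
      by (auto simp: eventually_sequentially)
    from dist_imp_near[OF L m0[of "n + m0"]] show ?thesis using cW[OF that(1)] cW[OF that(2)] by simp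
  qed
  define \<mu> where "\<mu> = distr M borel T"
  have "prob_space \<mu>" unfolding \<mu>_def by (rule M.prob_space_distr) (rule mT)
  then interpret \<mu>: prob_space \<mu> .
  have sets [measurable_cong]: "sets \<mu> = sets borel" by (simp add: \<mu>_def)
  define K where "K = E \<inter> cball 0 (norm (W 0 0) + 4 * (2 * L))"
  have K: "compact K" unfolding K_def using \<open>closed E\<close> by (intro closed_Int_compact) auto
  have AEK: "AE z in \<mu>. z \<in> K"
  proof -
    have "AE t in M. T t \<in> K" using TE bT by (intro AE_I2) (simp add: spM K_def)
    then show ?thesis unfolding \<mu>_def using K
      by (subst AE_distr_iff) (auto simp: compact_imp_closed)
  qed
  have "(\<integral>\<^sup>+z. \<integral>\<^sup>+w. neg_log z w \<partial>\<mu> \<partial>\<mu>) = (\<integral>\<^sup>+s. \<integral>\<^sup>+t. neg_log (T s) (T t) \<partial>M \<partial>M)"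
  proof -
    have push: "integral\<^sup>N \<mu> f = (\<integral>\<^sup>+s. f (T s) \<partial>M)" if "f \<in> borel_measurable borel" for f
      unfolding \<mu>_def using that by (intro nn_integral_distr mT) simp
    have "(\<integral>\<^sup>+z. \<integral>\<^sup>+w. neg_log z w \<partial>\<mu> \<partial>\<mu>) = (\<integral>\<^sup>+s. \<integral>\<^sup>+w. neg_log (T s) w \<partial>\<mu> \<partial>M)"
      by (rule push) measurable
    also have "\<dots> = (\<integral>\<^sup>+s. \<integral>\<^sup>+t. neg_log (T s) (T t) \<partial>M \<partial>M)"
      by (intro nn_integral_cong push) measurable
    finally show ?thesis .
  qed
  also have "\<dots> \<le> (\<integral>\<^sup>+s. \<integral>\<^sup>+t. ennreal \<bar>ln (2 * L)\<bar> + (\<Sum>n. ennreal (ln 2) * of_bool (near (address S n s) (address S n t))) \<partial>M \<partial>M)"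
    by (intro nn_integral_mono neg_log_le_near_count[OF L] near) (auto simp: spM)
  also have "\<dots> = ennreal \<bar>ln (2 * L)\<bar> + (\<Sum>n. ennreal (ln 2) *
      (\<integral>\<^sup>+s. \<integral>\<^sup>+t. of_bool (near (address S n s) (address S n t)) \<partial>M \<partial>M))"
  proof -
    have ad [measurable]: "address S n \<in> M \<rightarrow>\<^sub>M count_space UNIV" for n
      unfolding M_def by (rule measurable_address[OF c pos])
    have 1: "(\<lambda>t. of_bool (near P (address S n t)) :: ennreal) \<in> borel_measurable M" for P n
      by (rule measurable_compose[OF ad]) simp
    have 2: "(\<lambda>s. \<integral>\<^sup>+t. of_bool (near (address S n s) (address S n t)) \<partial>M) \<in> borel_measurable M" for n
      by (rule measurable_compose[OF ad, of "\<lambda>P. \<integral>\<^sup>+t. of_bool (near P (address S n t)) \<partial>M"]) simp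
    have "(\<integral>\<^sup>+t. ennreal \<bar>ln (2 * L)\<bar> + (\<Sum>n. ennreal (ln 2) * of_bool (near (address S n s) (address S n t))) \<partial>M)
        = ennreal \<bar>ln (2 * L)\<bar> + (\<Sum>n. ennreal (ln 2) * (\<integral>\<^sup>+t. of_bool (near (address S n s) (address S n t)) \<partial>M))" for s
      using 1 by (subst nn_integral_add) (auto simp: nn_integral_suminf nn_integral_cmult M.emeasure_space_1)
    then show ?thesis
      using 2 by (simp add: nn_integral_add nn_integral_suminf nn_integral_cmult M.emeasure_space_1)
  qed
  also have "\<dots> \<le> ennreal \<bar>ln (2 * L)\<bar> + (\<Sum>n. ennreal (ln 2) * ennreal (9 * (\<Sum>Q\<in>level n. (flow S n Q)\<^sup>2)))"
    unfolding M_def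
    by (intro add_mono suminf_le mult_left_mono nn_integral_near_address[OF c pos]) auto
  also have "\<dots> \<le> ennreal \<bar>ln (2 * L)\<bar> + ennreal (ln 2 * (9 / S 0 (0, 0)))"
  proof (rule add_left_mono, subst suminf_eq_SUP, rule SUP_least)
    fix m
    have "(\<Sum>n<m. ennreal (ln 2) * ennreal (9 * (\<Sum>Q\<in>level n. (flow S n Q)\<^sup>2)))
        = ennreal (\<Sum>n<m. ln 2 * (9 * (\<Sum>Q\<in>level n. (flow S n Q)\<^sup>2)))"
      by (subst sum_ennreal[symmetric]) (auto simp: ennreal_mult' sum_nonneg intro!: sum.cong)
    also have "\<dots> \<le> ennreal (ln 2 * (9 / S 0 (0, 0)))"
    proof (rule ennreal_leI)
      have "0 \<le> (\<Sum>Q\<in>level m. (flow S m Q)\<^sup>2 / S m Q)"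
        by (intro sum_nonneg divide_nonneg_nonneg conductances_nonneg[OF c]) auto
      then have "(\<Sum>n<m. \<Sum>Q\<in>level n. (flow S n Q)\<^sup>2) \<le> 1 / S 0 (0, 0)"
        using sum_level_flow_energy[OF c pos order_refl, of m] by simp
      then have "ln 2 * (9 * (\<Sum>n<m. \<Sum>Q\<in>level n. (flow S n Q)\<^sup>2)) \<le> ln 2 * (9 * (1 / S 0 (0, 0)))"
        by (intro mult_left_mono) auto
      then show "(\<Sum>n<m. ln 2 * (9 * (\<Sum>Q\<in>level n. (flow S n Q)\<^sup>2))) \<le> ln 2 * (9 / S 0 (0, 0))"
        by (simp add: sum_distrib_left)
    qed
    finally show "(\<Sum>n<m. ennreal (ln 2) * ennreal (9 * (\<Sum>Q\<in>level n. (flow S n Q)\<^sup>2))) \<le> ennreal (ln 2 * (9 / S 0 (0, 0)))" .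
  qed
  also have "ennreal \<bar>ln (2 * L)\<bar> + ennreal (ln 2 * (9 / S 0 (0, 0))) < \<infinity>" by (simp add: ennreal_plus[symmetric] del: ennreal_plus)
  finally have "(\<integral>\<^sup>+z. \<integral>\<^sup>+w. neg_log z w \<partial>\<mu> \<partial>\<mu>) < \<infinity>" .
  moreover have "K \<subseteq> E" by (simp add: K_def)
  ultimately show ?thesis
    using finite_energy_imp_log_capacity_pos[OF \<open>prob_space \<mu>\<close> sets K _ AEK] by blast
qed

section \<open>Cutoff functions at infinity\<close>

lemma has_derivative_quadratic_error:
  fixes f :: "'a::real_normed_vector \<Rightarrow> 'b::real_normed_vector"
  assumes "bounded_linear D" "r > 0"
    and "\<And>y. dist y x < r \<Longrightarrow> norm (f y - f x - D (y - x)) \<le> C * (norm (y - x))\<^sup>2"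
  shows "(f has_derivative D) (at x)"
proof (rule has_derivativeI_sandwich[OF assms(2,1), where H = "\<lambda>y. C * norm (y - x)"])
  show "norm (f y - f x - D (y - x)) / norm (y - x) \<le> C * norm (y - x)" if "dist y x < r" "y \<noteq> x" for y
    using assms(3)[OF that(1)] that(2) by (simp add: divide_le_eq power2_eq_square mult.assoc)
  have "((\<lambda>y. C * norm (y - x)) \<longlongrightarrow> C * norm (x - x)) (at x)" by (intro tendsto_intros)
  then show "((\<lambda>y. C * norm (y - x)) \<longlongrightarrow> 0) (at x)" by simp
qed

lemma DERIV_pos_part_square: "((\<lambda>t::real. (max 0 t)\<^sup>2) has_real_derivative 2 * max 0 t) (at t)"
  unfolding has_field_derivative_def
proof (rule has_derivative_quadratic_error[where r = 1 and C = 1])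
  fix y :: real
  have "\<bar>(max 0 y)\<^sup>2 - (max 0 t)\<^sup>2 - 2 * max 0 t * (y - t)\<bar> \<le> (y - t)\<^sup>2"
  proof (cases "0 \<le> t"; cases "0 \<le> y")
    assume "0 \<le> t" "0 \<le> y"
    then have "(max 0 y)\<^sup>2 - (max 0 t)\<^sup>2 - 2 * max 0 t * (y - t) = (y - t)\<^sup>2"
      by (simp add: power2_eq_square algebra_simps)
    then show ?thesis by simp
  next
    assume *: "0 \<le> t" "\<not> 0 \<le> y"
    then have "t * y \<le> 0" by (simp add: mult_nonneg_nonpos)
    moreover have "(max 0 y)\<^sup>2 - (max 0 t)\<^sup>2 - 2 * max 0 t * (y - t) = t\<^sup>2 - 2 * (t * y)"
      using * by (simp add: power2_eq_square algebra_simps)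
    moreover have "(y - t)\<^sup>2 = y\<^sup>2 + t\<^sup>2 - 2 * (t * y)" by (simp add: power2_eq_square algebra_simps)
    ultimately show ?thesis using zero_le_power2[of t] zero_le_power2[of y] by linarith
  next
    assume *: "\<not> 0 \<le> t" "0 \<le> y"
    then have "t * y \<le> 0" by (simp add: mult_nonpos_nonneg)
    moreover have "(max 0 y)\<^sup>2 - (max 0 t)\<^sup>2 - 2 * max 0 t * (y - t) = y\<^sup>2"
      using * by simp
    moreover have "(y - t)\<^sup>2 = y\<^sup>2 + t\<^sup>2 - 2 * (t * y)" by (simp add: power2_eq_square algebra_simps)
    ultimately show ?thesis using zero_le_power2[of t] zero_le_power2[of y] by linarith
  next
    assume *: "\<not> 0 \<le> t" "\<not> 0 \<le> y"
    then show ?thesis by simp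
  qed
  then show "norm ((max 0 y)\<^sup>2 - (max 0 t)\<^sup>2 - 2 * max 0 t * (y - t)) \<le> 1 * (norm (y - t))\<^sup>2"
    by simp
qed (auto intro: bounded_linear_mult_right)

text \<open>A continuously differentiable transition from 0 to 1 on the unit interval.\<close>

definition step :: "real \<Rightarrow> real" where
  "step t = 1 - (max 0 (1 - (max 0 t)\<^sup>2))\<^sup>2"

definition step' :: "real \<Rightarrow> real" where
  "step' t = 4 * max 0 t * max 0 (1 - (max 0 t)\<^sup>2)"

lemma DERIV_step: "(step has_real_derivative step' t) (at t)"
proof -
  have 1: "((\<lambda>t. 1 - (max 0 t)\<^sup>2) has_real_derivative 0 - 2 * max 0 t) (at t)"
    by (intro derivative_intros DERIV_pos_part_square)
  have "((\<lambda>t. 1 - (max 0 (1 - (max 0 t)\<^sup>2))\<^sup>2) has_real_derivative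
      0 - 2 * max 0 (1 - (max 0 t)\<^sup>2) * (0 - 2 * max 0 t)) (at t)"
    by (intro derivative_intros DERIV_chain2[OF DERIV_pos_part_square 1])
  then show ?thesis by (simp add: step_def[abs_def] step'_def mult_ac)
qed

lemma continuous_step': "continuous_on UNIV step'"
  unfolding step'_def by (intro continuous_intros)

lemma step_eq_0: "t \<le> 0 \<Longrightarrow> step t = 0"
  by (simp add: step_def)

lemma step_eq_1: assumes "1 \<le> t" shows "step t = 1"
proof -
  have m: "max 0 t = t" using assms by simp
  have "max 0 (1 - t\<^sup>2) = 0" using one_le_power[OF assms, of 2] by simp
  then show ?thesis by (simp add: step_def m)
qed

lemma step_bounds: "0 \<le> step t" "step t \<le> 1"
proof -
  have "(max 0 (1 - (max 0 t)\<^sup>2))\<^sup>2 \<le> 1\<^sup>2" by (intro power_mono) auto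
  then show "0 \<le> step t" "step t \<le> 1" by (simp_all add: step_def)
qed

lemma step'_bounds: "0 \<le> step' t" "step' t \<le> 4"
proof -
  show "0 \<le> step' t" by (simp add: step'_def)
  show "step' t \<le> 4"
  proof (cases "max 0 t \<le> 1")
    case True
    then have "max 0 t * max 0 (1 - (max 0 t)\<^sup>2) \<le> 1 * 1" by (intro mult_mono) auto
    then show ?thesis by (simp add: step'_def)
  next
    case False
    then have "1 - (max 0 t)\<^sup>2 \<le> 0" by (simp add: max_def)
    then show ?thesis by (simp add: step'_def)
  qed
qed

lemma GDERIV_ln_norm_square:
  fixes c :: real and z w :: complex
  assumes "c > 0"
  shows "GDERIV (\<lambda>z. ln ((norm (z - w))\<^sup>2 + c)) z :> (2 / ((norm (z - w))\<^sup>2 + c)) *\<^sub>R (z - w)"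
proof -
  have pos: "(norm (z - w))\<^sup>2 + c > 0" using assms by (simp add: add_nonneg_pos)
  have "((\<lambda>z. (z - w) \<bullet> (z - w) + c) has_derivative (\<lambda>v. v \<bullet> (2 *\<^sub>R (z - w)))) (at z)"
    by (auto intro!: derivative_eq_intros simp: inner_commute)
  then have "GDERIV (\<lambda>z. (norm (z - w))\<^sup>2 + c) z :> 2 *\<^sub>R (z - w)"
    by (simp add: gderiv_def power2_norm_eq_inner)
  from GDERIV_DERIV_compose[OF this DERIV_ln_divide[OF pos]] show ?thesis by simp
qed

definition log_cutoff :: "real \<Rightarrow> complex \<Rightarrow> real" where
  "log_cutoff m z = step (2 - ln ((norm z)\<^sup>2 + 1) / (2 * m))"

definition log_cutoff_grad :: "real \<Rightarrow> complex \<Rightarrow> complex" where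
  "log_cutoff_grad m z = (- step' (2 - ln ((norm z)\<^sup>2 + 1) / (2 * m)) / (m * ((norm z)\<^sup>2 + 1))) *\<^sub>R z"

lemma GDERIV_log_cutoff: 
  assumes "m > 0" shows "GDERIV (log_cutoff m) z :> log_cutoff_grad m z"
proof -
  have d: "((\<lambda>t. 2 - t / (2 * m)) has_real_derivative 0 - 1 / (2 * m)) (at t)" for t
    by (intro derivative_intros DERIV_cdivide)
  have "GDERIV (\<lambda>z. ln ((norm (z - 0))\<^sup>2 + 1)) z :> (2 / ((norm (z - 0))\<^sup>2 + 1)) *\<^sub>R (z - 0)"
    by (rule GDERIV_ln_norm_square) simp
  from GDERIV_DERIV_compose[OF this DERIV_chain2[OF DERIV_step d]]
  have G: "GDERIV (log_cutoff m) z :> (step' (2 - ln ((norm z)\<^sup>2 + 1) / (2 * m)) * (0 - 1 / (2 * m)))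
      *\<^sub>R (2 / ((norm z)\<^sup>2 + 1)) *\<^sub>R z"
    by (simp only: log_cutoff_def[abs_def] diff_0_right)
  show ?thesis by (rule GDERIV_subst[OF G]) (simp add: log_cutoff_grad_def)
qed

lemma continuous_log_cutoff_grad: "m > 0 \<Longrightarrow> continuous_on UNIV (log_cutoff_grad m)"
  unfolding log_cutoff_grad_def
  by (intro continuous_intros continuous_on_compose2[OF continuous_step'])
    (auto simp: add_nonneg_eq_0_iff)

lemma log_cutoff_eq_0:
  assumes "m > 0" "exp (2 * m) \<le> norm z" shows "log_cutoff m z = 0" "log_cutoff_grad m z = 0"
proof -
  have "exp (4 * m) = (exp (2 * m))\<^sup>2" by (simp flip: exp_double)
  also have "\<dots> \<le> (norm z)\<^sup>2" using assms by (intro power_mono) auto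
  finally have "exp (4 * m) \<le> (norm z)\<^sup>2 + 1" by simp
  then have "4 * m \<le> ln ((norm z)\<^sup>2 + 1)" by (subst ln_ge_iff) (auto simp: add_nonneg_pos)
  then have "2 - ln ((norm z)\<^sup>2 + 1) / (2 * m) \<le> 0" using assms(1) by (simp add: field_simps)
  then show "log_cutoff m z = 0" "log_cutoff_grad m z = 0"
    by (simp_all add: log_cutoff_def log_cutoff_grad_def step_eq_0 step'_def)
qed

text \<open>The gradient is of size \<open>1 / (m \<bar>z\<bar>)\<close> on an annulus of logarithmic width
  of order \<open>m\<close>, so its energy is of order \<open>1 / m\<close>.\<close>

lemma nn_integral_log_cutoff_grad:
  assumes "m > 0"
  shows "(\<integral>\<^sup>+z. ennreal ((norm (log_cutoff_grad m z))\<^sup>2) \<partial>lborel) \<le> ennreal (16 / m\<^sup>2 * (2 * pi * (1 + 2 * m)))"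
proof -
  let ?R = "exp (2 * m)"
  have le: "(norm (log_cutoff_grad m z))\<^sup>2 \<le> 16 / m\<^sup>2 * (indicator {..<?R} (norm z) / (norm z * max (norm z) 1))" for z
  proof (cases "norm z < ?R \<and> z \<noteq> 0")
    case True
    let ?r = "norm z"
    have r: "?r > 0" using True by simp
    have p: "?r\<^sup>2 + 1 > 0" by (simp add: add_nonneg_pos)
    have "norm (log_cutoff_grad m z) = step' (2 - ln (?r\<^sup>2 + 1) / (2 * m)) / m * (?r / (?r\<^sup>2 + 1))"
      using assms p step'_bounds(1) by (simp add: log_cutoff_grad_def abs_mult)
    also have "\<dots> \<le> 4 / m * (?r / (?r\<^sup>2 + 1))"
      using assms p step'_bounds(2) by (intro mult_right_mono divide_right_mono) auto
    finally have "(norm (log_cutoff_grad m z))\<^sup>2 \<le> (4 / m * (?r / (?r\<^sup>2 + 1)))\<^sup>2"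
      by (intro power_mono) auto
    also have "\<dots> = 16 / m\<^sup>2 * ((?r / (?r\<^sup>2 + 1)) * (?r / (?r\<^sup>2 + 1)))"
      by (simp add: power2_eq_square)
    also have "\<dots> \<le> 16 / m\<^sup>2 * ((1 / ?r) * (1 / max ?r 1))"
    proof (intro mult_left_mono mult_mono)
      show "?r / (?r\<^sup>2 + 1) \<le> 1 / ?r" using r p by (simp add: divide_simps power2_eq_square)
      have "?r * 1 \<le> ?r\<^sup>2 + 1" using sum_squares_bound[of ?r 1] r by (simp only: mult_1_right power_one)
      then have "?r * max ?r 1 \<le> ?r\<^sup>2 + 1" using r by (auto simp: max_def power2_eq_square)
      then show "?r / (?r\<^sup>2 + 1) \<le> 1 / max ?r 1" using r p by (simp add: divide_simps)
    qed (use r p in auto)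
    finally show ?thesis using True by simp
  next
    case False
    then have "log_cutoff_grad m z = 0"
    proof (cases "z = 0")
      case False
      then show ?thesis using \<open>\<not> (norm z < ?R \<and> z \<noteq> 0)\<close> by (intro log_cutoff_eq_0 assms) auto
    qed (simp add: log_cutoff_grad_def)
    then show ?thesis by simp
  qed
  have "(\<integral>\<^sup>+z. ennreal ((norm (log_cutoff_grad m z))\<^sup>2) \<partial>lborel)
      \<le> (\<integral>\<^sup>+z. ennreal (16 / m\<^sup>2) * ennreal (indicator {..<?R} (norm z) / (norm z * max (norm z) 1)) \<partial>(lborel :: complex measure))"
    by (intro nn_integral_mono) (subst ennreal_mult'[symmetric], simp, rule ennreal_leI, rule le)
  also have "\<dots> = ennreal (16 / m\<^sup>2) * (\<integral>\<^sup>+z. ennreal (indicator {..<?R} (norm z) / (norm z * max (norm z) 1)) \<partial>(lborel :: complex measure))"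
    by (rule nn_integral_cmult) measurable
  also have "\<dots> \<le> ennreal (16 / m\<^sup>2) * ennreal (2 * pi * (1 + ln (?R / 1)))"
    using assms by (intro mult_left_mono nn_integral_log_kernel) auto
  also have "\<dots> = ennreal (16 / m\<^sup>2 * (2 * pi * (1 + 2 * m)))"
    by (subst ennreal_mult'[symmetric]) auto
  finally show ?thesis .
qed

section \<open>Potentials of discrete equilibrium measures\<close>

text \<open>The negative logarithm is smoothed at the scale \<open>\<delta>\<close>, so that the potential
  of point masses is smooth.\<close>

definition potential :: "'i set \<Rightarrow> ('i \<Rightarrow> real) \<Rightarrow> ('i \<Rightarrow> complex) \<Rightarrow> real \<Rightarrow> complex \<Rightarrow> real" where
  "potential A a w \<delta> z = (\<Sum>i\<in>A. a i * (- (1 / 2) * ln ((norm (z - w i))\<^sup>2 + \<delta>\<^sup>2)))"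

definition potential_grad :: "'i set \<Rightarrow> ('i \<Rightarrow> real) \<Rightarrow> ('i \<Rightarrow> complex) \<Rightarrow> real \<Rightarrow> complex \<Rightarrow> complex" where
  "potential_grad A a w \<delta> z = (\<Sum>i\<in>A. (- a i / ((norm (z - w i))\<^sup>2 + \<delta>\<^sup>2)) *\<^sub>R (z - w i))"

lemma GDERIV_sum:
  assumes "\<And>i. i \<in> A \<Longrightarrow> GDERIV (f i) z :> g i"
  shows "GDERIV (\<lambda>z. \<Sum>i\<in>A. f i z) z :> (\<Sum>i\<in>A. g i)"
  using has_derivative_sum[of A f "\<lambda>i v. v \<bullet> g i" "at z"] assms by (simp add: gderiv_def inner_sum_right)

lemma GDERIV_potential:
  assumes "\<delta> > 0" shows "GDERIV (potential A a w \<delta>) z :> potential_grad A a w \<delta> z"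
  unfolding potential_def[abs_def] potential_grad_def
proof (rule GDERIV_sum)
  fix i
  have d: "((\<lambda>t. a i * (- (1 / 2) * t)) has_real_derivative a i * (- (1 / 2) * 1)) (at t)" for t
    by (auto intro!: derivative_eq_intros)
  have "\<delta>\<^sup>2 > 0" using assms by simp
  from GDERIV_DERIV_compose[OF GDERIV_ln_norm_square[OF this] d, of "w i" z]
  show "GDERIV (\<lambda>z. a i * (- (1 / 2) * ln ((norm (z - w i))\<^sup>2 + \<delta>\<^sup>2))) z
      :> (- a i / ((norm (z - w i))\<^sup>2 + \<delta>\<^sup>2)) *\<^sub>R (z - w i)"
    by (simp add: algebra_simps)
qed

lemma continuous_potential_grad: "\<delta> > 0 \<Longrightarrow> continuous_on UNIV (potential_grad A a w \<delta>)"
  unfolding potential_grad_def by (intro continuous_intros) (auto simp: add_nonneg_eq_0_iff)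

lemma nn_integral_double_sum:
  fixes c :: "'i \<Rightarrow> 'i \<Rightarrow> ennreal"
  assumes "\<And>i j. F i j \<in> borel_measurable M"
  shows "(\<integral>\<^sup>+z. (\<Sum>i\<in>A. \<Sum>j\<in>A. c i j * F i j z) \<partial>M) = (\<Sum>i\<in>A. \<Sum>j\<in>A. c i j * (\<integral>\<^sup>+z. F i j z \<partial>M))"
  using assms by (simp add: nn_integral_sum nn_integral_cmult)

text \<open>The gradient is a finite combination of regularised Cauchy kernels; expand its square.\<close>

lemma nn_integral_potential_grad:
  assumes A: "finite A" "\<And>i. i \<in> A \<Longrightarrow> 0 \<le> a i" "\<And>i. i \<in> A \<Longrightarrow> norm (w i) < M" and "\<delta> > 0" "\<delta> \<le> 4 * M"
  shows "(\<integral>\<^sup>+z. ennreal (indicator (ball 0 M) z * (norm (potential_grad A a w \<delta> z))\<^sup>2) \<partial>lborel)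
      \<le> ennreal (\<Sum>i\<in>A. \<Sum>j\<in>A. a i * a j * (4 * pi * (1 + ln (4 * M / max (norm (w i - w j)) \<delta>))))"
proof -
  let ?k = "\<lambda>i z. cauchy_kernel \<delta> (z - w i)"
  let ?c = "\<lambda>i j. 4 * pi * (1 + ln (4 * M / max (norm (w i - w j)) \<delta>))"
  have rho: "max (norm (w i - w j)) \<delta> \<le> 4 * M" if "i \<in> A" "j \<in> A" for i j
    using A(3)[OF that(1)] A(3)[OF that(2)] norm_triangle_ineq4[of "w i" "w j"] assms(5) norm_ge_zero[of "w i"]
    by (intro max.boundedI) linarith+
  have c: "0 \<le> ?c i j" if "i \<in> A" "j \<in> A" for i j
  proof -
    have "1 \<le> 4 * M / max (norm (w i - w j)) \<delta>" using rho[OF that] assms(4) by (simp add: less_max_iff_disj)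
    then show ?thesis by (intro mult_nonneg_nonneg add_nonneg_nonneg ln_ge_zero) auto
  qed
  have le: "(norm (potential_grad A a w \<delta> z))\<^sup>2 \<le> (\<Sum>i\<in>A. \<Sum>j\<in>A. a i * a j * (?k i z * ?k j z))" for z
  proof -
    have "norm (potential_grad A a w \<delta> z) \<le> (\<Sum>i\<in>A. a i * ?k i z)"
      unfolding potential_grad_def
    proof (rule sum_norm_le)
      fix i assume "i \<in> A"
      then show "norm ((- a i / ((norm (z - w i))\<^sup>2 + \<delta>\<^sup>2)) *\<^sub>R (z - w i)) \<le> a i * ?k i z"
        using A(2) by (simp add: cauchy_kernel_def abs_mult)
    qed
    then have "(norm (potential_grad A a w \<delta> z))\<^sup>2 \<le> (\<Sum>i\<in>A. a i * ?k i z)\<^sup>2" by (intro power_mono) auto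
    also have "\<dots> = (\<Sum>i\<in>A. \<Sum>j\<in>A. a i * a j * (?k i z * ?k j z))"
      unfolding power2_eq_square sum_product by (intro sum.cong refl) (simp only: mult_ac)
    finally show ?thesis .
  qed
  have "(\<integral>\<^sup>+z. ennreal (indicator (ball 0 M) z * (norm (potential_grad A a w \<delta> z))\<^sup>2) \<partial>lborel)
      \<le> (\<integral>\<^sup>+z. (\<Sum>i\<in>A. \<Sum>j\<in>A. ennreal (a i * a j) * ennreal (indicator (ball 0 M) z * (?k i z * ?k j z))) \<partial>lborel)"
  proof (rule nn_integral_mono)
    fix z
    have "indicator (ball 0 M) z * (norm (potential_grad A a w \<delta> z))\<^sup>2
        \<le> (\<Sum>i\<in>A. \<Sum>j\<in>A. (a i * a j) * (indicator (ball 0 M) z * (?k i z * ?k j z)))"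
      using mult_left_mono[OF le[of z], of "indicator (ball 0 M) z"] by (simp add: sum_distrib_left mult_ac)
    then have "ennreal (indicator (ball 0 M) z * (norm (potential_grad A a w \<delta> z))\<^sup>2)
        \<le> ennreal (\<Sum>i\<in>A. \<Sum>j\<in>A. (a i * a j) * (indicator (ball 0 M) z * (?k i z * ?k j z)))"
      by (rule ennreal_leI)
    also have "\<dots> = (\<Sum>i\<in>A. \<Sum>j\<in>A. ennreal (a i * a j) * ennreal (indicator (ball 0 M) z * (?k i z * ?k j z)))"
      using A(2) by (simp add: sum_ennreal[symmetric] ennreal_mult' sum_nonneg cauchy_kernel_nonneg)
    finally show "ennreal (indicator (ball 0 M) z * (norm (potential_grad A a w \<delta> z))\<^sup>2)
        \<le> (\<Sum>i\<in>A. \<Sum>j\<in>A. ennreal (a i * a j) * ennreal (indicator (ball 0 M) z * (?k i z * ?k j z)))" .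
  qed
  also have "\<dots> = (\<Sum>i\<in>A. \<Sum>j\<in>A. ennreal (a i * a j) *
      (\<integral>\<^sup>+z. ennreal (indicator (ball 0 M) z * (?k i z * ?k j z)) \<partial>lborel))"
  proof -
    have "(\<lambda>z. ennreal (indicator (ball 0 M) z * (?k i z * ?k j z))) \<in> borel_measurable lborel" for i j
    proof -
      have k: "(\<lambda>z. ?k i z) \<in> borel_measurable borel" for i
        by (rule measurable_compose[OF _ cauchy_kernel_measurable]) simp
      have "(\<lambda>z. indicator (ball 0 M) z * (?k i z * ?k j z)) \<in> borel_measurable borel"
        by (intro borel_measurable_times borel_measurable_indicator k) simp
      then show ?thesis by simp
    qed
    then show ?thesis by (rule nn_integral_double_sum)
  qed
  also have "\<dots> \<le> (\<Sum>i\<in>A. \<Sum>j\<in>A. ennreal (a i * a j) * ennreal (?c i j))"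
    using A assms(4) rho
    by (intro sum_mono mult_left_mono nn_integral_cauchy_kernel_product) (auto simp: less_max_iff_disj)
  also have "\<dots> = ennreal (\<Sum>i\<in>A. \<Sum>j\<in>A. a i * a j * ?c i j)"
  proof -
    have nn: "0 \<le> a i * a j * ?c i j" if "i \<in> A" "j \<in> A" for i j
      by (rule mult_nonneg_nonneg[OF mult_nonneg_nonneg[OF A(2)[OF that(1)] A(2)[OF that(2)]] c[OF that]])
    have "(\<Sum>i\<in>A. \<Sum>j\<in>A. ennreal (a i * a j) * ennreal (?c i j)) = (\<Sum>i\<in>A. \<Sum>j\<in>A. ennreal (a i * a j * ?c i j))"
      using A(2) by (intro sum.cong refl) (simp add: ennreal_mult'[symmetric])
    also have "\<dots> = (\<Sum>i\<in>A. ennreal (\<Sum>j\<in>A. a i * a j * ?c i j))"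
      by (intro sum.cong refl sum_ennreal nn)
    also have "\<dots> = ennreal (\<Sum>i\<in>A. \<Sum>j\<in>A. a i * a j * ?c i j)"
      by (intro sum_ennreal sum_nonneg nn)
    finally show ?thesis .
  qed
  finally show ?thesis .
qed



lemma cell_of_level:
  assumes "cell_of L 0 z = (0, 0)" shows "cell_of L n z \<in> level n"
  by (induction n) (use assms in \<open>auto simp: parent_cell_of\<close>)

lemma norm_lt_of_root:
  assumes "L > 0" "cell_of L 0 z = (0, 0)" shows "norm z < 2 * L"
proof -
  have "\<bar>Re z\<bar> \<le> L" "\<bar>Im z\<bar> \<le> L" using assms by (auto simp: cell_of_root)
  then have "(norm z)\<^sup>2 \<le> L\<^sup>2 + L\<^sup>2"
    unfolding cmod_power2 by (intro add_mono) (auto simp: abs_le_square_iff[symmetric])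
  also have "\<dots> < (2 * L)\<^sup>2" using assms(1) by (simp add: power2_eq_square)
  finally show ?thesis using power_less_imp_less_base[of "norm z" 2 "2 * L"] assms(1) by simp
qed

text \<open>The unit current of the truncated tree, with each leaf mass placed at a point of
  \<open>E\<close> in the leaf. The two last clauses count common cells and neighbouring cells;
  they say that the tree potential is constant on \<open>E\<close> and that the tree energy is
  comparable to it.\<close>

lemma discrete_equilibrium:
  fixes N :: nat
  assumes L: "L > 0" and e0: "e0 \<in> E" "cell_of L 0 e0 = (0, 0)"
  defines "H \<equiv> (\<lambda>n Q. \<exists>z\<in>E. cell_of L n z = Q)"
  defines "V \<equiv> 1 / trunc_conductance H N 0 (0, 0)"
  obtains A :: "cell set" and a w where "finite A" "\<And>Q. Q \<in> A \<Longrightarrow> 0 < a Q" "sum a A = 1"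
    "\<And>Q. Q \<in> A \<Longrightarrow> w Q \<in> E" "\<And>Q. Q \<in> A \<Longrightarrow> cell_of L 0 (w Q) = (0, 0)"
    "\<And>z. z \<in> E \<Longrightarrow> cell_of L 0 z = (0, 0) \<Longrightarrow>
      (\<Sum>Q\<in>A. a Q * (\<Sum>n\<le>N. of_bool (cell_of L n z = cell_of L n (w Q)))) = V"
    "(\<Sum>P\<in>A. \<Sum>Q\<in>A. a P * a Q * (\<Sum>n\<le>N. of_bool (near (cell_of L n (w P)) (cell_of L n (w Q))))) \<le> 9 * V"
proof -
  define S where "S = (\<lambda>n. trunc_conductance H (N - n) n)"
  have c: "conductances N S" unfolding S_def by (rule conductances_trunc_conductance)
  have Spos: "S n (cell_of L n z) > 0" if "z \<in> E" for n z
    unfolding S_def by (rule trunc_conductance_pos) (use that in \<open>auto simp: H_def parent_cell_of\<close>)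
  have pos: "S 0 (0, 0) > 0" using Spos[OF e0(1), of 0] e0(2) by simp
  have V: "1 / S 0 (0, 0) = V" by (simp add: S_def V_def)
  have Hpar: "H n (parent Q)" if "H (Suc n) Q" for n Q
    using that by (auto simp: H_def parent_cell_of)
  define A where "A = {Q \<in> level N. flow S N Q \<noteq> 0}"
  have Apos: "0 < flow S N Q" if "Q \<in> A" for Q
    using that flow_nonneg[OF c, of N Q] by (auto simp: A_def)
  have SA: "S N Q = 1 \<and> H N Q" if "flow S N Q \<noteq> 0" for Q
  proof -
    have "S N Q \<noteq> 0" using flow_nonzero_imp[of S N Q] that pos by auto
    then show ?thesis by (auto simp: S_def)
  qed
  then have "\<forall>Q\<in>A. \<exists>z. z \<in> E \<and> cell_of L N z = Q" by (auto simp: A_def H_def)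
  then obtain w where w: "\<And>Q. Q \<in> A \<Longrightarrow> w Q \<in> E" "\<And>Q. Q \<in> A \<Longrightarrow> cell_of L N (w Q) = Q"
    by metis
  have anc: "cell_of L n (w Q) = (parent ^^ (N - n)) Q" if "Q \<in> A" "n \<le> N" for n Q
    using funpow_parent_cell_of[of "N - n" L n "w Q"] w(2)[OF that(1)] that(2) by simp
  have sum: "(\<Sum>Q\<in>A. flow S N Q * \<phi> (cell_of L n (w Q))) = (\<Sum>P\<in>level n. flow S n P * \<phi> P)"
    if "n \<le> N" for n and \<phi> :: "cell \<Rightarrow> real"
  proof -
    have "(\<Sum>Q\<in>A. flow S N Q * \<phi> (cell_of L n (w Q))) = (\<Sum>Q\<in>A. flow S N Q * \<phi> ((parent ^^ (N - n)) Q))"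
      using that by (intro sum.cong refl) (simp add: anc)
    also have "\<dots> = (\<Sum>Q\<in>level N. flow S N Q * \<phi> ((parent ^^ (N - n)) Q))"
      by (rule sum.mono_neutral_left) (auto simp: A_def)
    also have "\<dots> = (\<Sum>P\<in>level n. flow S n P * \<phi> P)"
      using sum_flow_ancestor[OF c pos, of n "N - n" \<phi>] that by simp
    finally show ?thesis .
  qed
  have root: "cell_of L 0 (w Q) = (0, 0)" if "Q \<in> A" for Q
  proof -
    have "(parent ^^ j) P \<in> level n" if "P \<in> level (n + j)" for j n P
      using that by (induction j arbitrary: n P) (auto simp: funpow_Suc_right simp del: funpow.simps)
    from this[of Q 0 N] show ?thesis using anc[OF that, of 0] that by (auto simp: A_def)
  qed
  have fin: "finite A" by (simp add: A_def)
  have one: "sum (flow S N) A = 1" using sum[of 0 "\<lambda>_. 1"] by simp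
  have lower: "(\<Sum>Q\<in>A. flow S N Q * (\<Sum>n\<le>N. of_bool (cell_of L n z = cell_of L n (w Q)))) = V"
    if z: "z \<in> E" "cell_of L 0 z = (0, 0)" for z
  proof -
    have "(\<Sum>Q\<in>A. flow S N Q * (\<Sum>n\<le>N. of_bool (cell_of L n z = cell_of L n (w Q))))
        = (\<Sum>n\<le>N. \<Sum>Q\<in>A. flow S N Q * of_bool (cell_of L n z = cell_of L n (w Q)))"
      unfolding sum_distrib_left by (rule sum.swap)
    also have "\<dots> = (\<Sum>n\<le>N. flow S n (cell_of L n z))"
    proof (intro sum.cong refl)
      fix n assume "n \<in> {..N}"
      then have "(\<Sum>Q\<in>A. flow S N Q * of_bool (cell_of L n z = cell_of L n (w Q)))
          = (\<Sum>P\<in>level n. flow S n P * of_bool (cell_of L n z = P))"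
        using sum[of n "\<lambda>P. of_bool (cell_of L n z = P)"] by simp
      also have "\<dots> = (\<Sum>P\<in>level n. if cell_of L n z = P then flow S n P else 0)"
        by (intro sum.cong refl) simp
      also have "\<dots> = flow S n (cell_of L n z)"
        using cell_of_level[OF z(2), of n] by (subst sum.delta') auto
      finally show "(\<Sum>Q\<in>A. flow S N Q * of_bool (cell_of L n z = cell_of L n (w Q))) = flow S n (cell_of L n z)" .
    qed
    also have "\<dots> = (\<Sum>n<N. flow S n (cell_of L n z)) + flow S N (cell_of L N z)"
      by (simp flip: lessThan_Suc_atMost)
    also have "\<dots> = (\<Sum>n<N. flow S n (cell_of L n z)) + flow S N (cell_of L N z) / S N (cell_of L N z)"
      using SA[of "cell_of L N z"] by (cases "flow S N (cell_of L N z) = 0") auto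
    also have "\<dots> = V"
      using sum_path_flow[OF c pos order_refl, of "\<lambda>n. cell_of L n z"] z Spos by (simp add: parent_cell_of V)
    finally show ?thesis .
  qed
  have energy: "(\<Sum>P\<in>A. \<Sum>Q\<in>A. flow S N P * flow S N Q *
      (\<Sum>n\<le>N. of_bool (near (cell_of L n (w P)) (cell_of L n (w Q))))) \<le> 9 * V"
  proof -
    have "(\<Sum>P\<in>A. \<Sum>Q\<in>A. flow S N P * flow S N Q * (\<Sum>n\<le>N. of_bool (near (cell_of L n (w P)) (cell_of L n (w Q)))))
       = (\<Sum>n\<le>N. \<Sum>P\<in>A. \<Sum>Q\<in>A. flow S N P * flow S N Q * of_bool (near (cell_of L n (w P)) (cell_of L n (w Q))))"
    proof -
      have "(\<Sum>P\<in>A. \<Sum>Q\<in>A. flow S N P * flow S N Q * (\<Sum>n\<le>N. of_bool (near (cell_of L n (w P)) (cell_of L n (w Q)))))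
         = (\<Sum>P\<in>A. \<Sum>n\<le>N. \<Sum>Q\<in>A. flow S N P * flow S N Q * of_bool (near (cell_of L n (w P)) (cell_of L n (w Q))))"
        unfolding sum_distrib_left by (rule sum.cong[OF refl], rule sum.swap)
      also have "\<dots> = (\<Sum>n\<le>N. \<Sum>P\<in>A. \<Sum>Q\<in>A. flow S N P * flow S N Q * of_bool (near (cell_of L n (w P)) (cell_of L n (w Q))))"
        by (rule sum.swap)
      finally show ?thesis .
    qed
    also have "\<dots> = (\<Sum>n\<le>N. \<Sum>P\<in>level n. \<Sum>Q\<in>level n. of_bool (near P Q) * (flow S n P * flow S n Q))"
    proof (rule sum.cong[OF refl])
      fix n assume "n \<in> {..N}"
      then have n: "n \<le> N" by simp
      define \<psi> where "\<psi> P = (\<Sum>Q\<in>level n. flow S n Q * of_bool (near P Q))" for P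
      have "(\<Sum>P\<in>A. \<Sum>Q\<in>A. flow S N P * flow S N Q * of_bool (near (cell_of L n (w P)) (cell_of L n (w Q))))
          = (\<Sum>P\<in>A. flow S N P * \<psi> (cell_of L n (w P)))"
        unfolding \<psi>_def sum[OF n, symmetric] by (simp add: sum_distrib_left mult.assoc)
      also have "\<dots> = (\<Sum>P\<in>level n. flow S n P * \<psi> P)" by (rule sum[OF n])
      also have "\<dots> = (\<Sum>P\<in>level n. \<Sum>Q\<in>level n. of_bool (near P Q) * (flow S n P * flow S n Q))"
        unfolding \<psi>_def sum_distrib_left by (intro sum.cong refl) (simp only: mult_ac)
      finally show "(\<Sum>P\<in>A. \<Sum>Q\<in>A. flow S N P * flow S N Q * of_bool (near (cell_of L n (w P)) (cell_of L n (w Q))))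
        = (\<Sum>P\<in>level n. \<Sum>Q\<in>level n. of_bool (near P Q) * (flow S n P * flow S n Q))" .
    qed
    also have "\<dots> \<le> (\<Sum>n\<le>N. 9 * (\<Sum>Q\<in>level n. (flow S n Q)\<^sup>2))"
      by (intro sum_mono sum_near_le) simp
    also have "\<dots> = 9 * ((\<Sum>n<N. \<Sum>Q\<in>level n. (flow S n Q)\<^sup>2) + (\<Sum>Q\<in>level N. (flow S N Q)\<^sup>2))"
      by (simp add: sum_distrib_left flip: lessThan_Suc_atMost)
    also have "(\<Sum>Q\<in>level N. (flow S N Q)\<^sup>2) = (\<Sum>Q\<in>level N. (flow S N Q)\<^sup>2 / S N Q)"
    proof (intro sum.cong refl)
      fix Q show "(flow S N Q)\<^sup>2 = (flow S N Q)\<^sup>2 / S N Q"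
        using SA[of Q] by (cases "flow S N Q = 0") auto
    qed
    also have "(\<Sum>n<N. \<Sum>Q\<in>level n. (flow S n Q)\<^sup>2) + (\<Sum>Q\<in>level N. (flow S N Q)\<^sup>2 / S N Q) = V"
      using sum_level_flow_energy[OF c pos order_refl] V by simp
    finally show ?thesis .
  qed
  show ?thesis
    by (rule that[OF fin Apos one w(1) root lower energy])
qed

section \<open>Cutoffs of small energy around a set of capacity zero\<close>

text \<open>Points that share a cell of side \<open>\<sigma>\<close> are at distance at most \<open>2
  \<sigma>\<close>, and the number of shared levels exceeds the last shared level by at most 1.\<close>

lemma log_kernel_ge_common_cells:
  assumes L: "L > 0" and root: "cell_of L 0 z' = cell_of L 0 w" and z: "norm (z - z') \<le> 2 * L / 2 ^ N"
  shows "- (1 / 2) * ln ((norm (z - w))\<^sup>2 + (2 * L / 2 ^ N)\<^sup>2)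
      \<ge> ln 2 * (\<Sum>n\<le>N. of_bool (cell_of L n z' = cell_of L n w)) - ln (16 * L)"
proof -
  define C where "C = {n. n \<le> N \<and> cell_of L n z' = cell_of L n w}"
  have finC: "finite C" by (simp add: C_def)
  define n where "n = Max C"
  have "0 \<in> C" using root by (simp add: C_def)
  then have n: "n \<in> C" unfolding n_def using finC by (intro Max_in) auto
  have "C \<subseteq> {..n}" using finC by (auto simp: n_def)
  then have "card C \<le> n + 1" using card_mono[of "{..n}" C] by simp
  moreover have "(\<Sum>n\<le>N. of_bool (cell_of L n z' = cell_of L n w)) = real (card C)"
    by (simp add: C_def of_bool_def sum.If_cases Int_def)
  ultimately have count: "(\<Sum>n\<le>N. of_bool (cell_of L n z' = cell_of L n w)) \<le> real n + 1" by simp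
  define \<sigma> where "\<sigma> = 2 * L / 2 ^ n"
  have \<sigma>: "\<sigma> > 0" using L by (simp add: \<sigma>_def)
  have \<delta>: "2 * L / 2 ^ N \<le> \<sigma>" unfolding \<sigma>_def
    using n L by (intro divide_left_mono power_increasing) (auto simp: C_def)
  have "norm (z' - w) \<le> 2 * \<sigma>" unfolding \<sigma>_def using n by (intro same_cell_dist[OF L]) (simp add: C_def)
  then have "norm (z - w) \<le> 3 * \<sigma>" using norm_triangle_ineq[of "z - z'" "z' - w"] z \<delta> by simp
  then have "(norm (z - w))\<^sup>2 \<le> (3 * \<sigma>)\<^sup>2" by (intro power_mono) auto
  moreover have "(2 * L / 2 ^ N)\<^sup>2 \<le> \<sigma>\<^sup>2" using \<delta> L by (intro power_mono) auto
  ultimately have "(norm (z - w))\<^sup>2 + (2 * L / 2 ^ N)\<^sup>2 \<le> (3 * \<sigma>)\<^sup>2 + \<sigma>\<^sup>2" by (rule add_mono)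
  also have "\<dots> \<le> (4 * \<sigma>)\<^sup>2" by (simp add: power_mult_distrib)
  finally have "(norm (z - w))\<^sup>2 + (2 * L / 2 ^ N)\<^sup>2 \<le> (4 * \<sigma>)\<^sup>2" .
  moreover have "0 < (norm (z - w))\<^sup>2 + (2 * L / 2 ^ N)\<^sup>2" using L by (intro add_nonneg_pos) auto
  ultimately have "ln ((norm (z - w))\<^sup>2 + (2 * L / 2 ^ N)\<^sup>2) \<le> ln ((4 * \<sigma>)\<^sup>2)"
    using \<sigma> by (subst ln_le_cancel_iff) auto
  also have "\<dots> = 2 * ln (4 * \<sigma>)" using \<sigma> ln_realpow[of "4 * \<sigma>" 2] by simp
  also have "ln (4 * \<sigma>) = ln (16 * L) - ln 2 - real n * ln 2"
  proof -
    have "ln (16 * L) = ln 2 + ln (8 * L)" using ln_mult[of 2 "8 * L"] L by simp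
    moreover have "4 * \<sigma> = 8 * L / 2 ^ n" by (simp add: \<sigma>_def)
    ultimately show ?thesis using L by (simp add: ln_div ln_realpow)
  qed
  finally have "- (1 / 2) * ln ((norm (z - w))\<^sup>2 + (2 * L / 2 ^ N)\<^sup>2) \<ge> ln 2 * (real n + 1) - ln (16 * L)"
    by (simp add: algebra_simps)
  moreover have "ln 2 * (\<Sum>n\<le>N. of_bool (cell_of L n z' = cell_of L n w)) \<le> ln 2 * (real n + 1)"
    by (intro mult_left_mono count) simp
  ultimately show ?thesis by linarith
qed

lemma ln_ratio_le_near_count:
  assumes L: "L > 0"
  shows "ln (4 * (2 * L) / max (norm (z - w)) (2 * L / 2 ^ N))
     \<le> ln 4 + ln 2 * (\<Sum>n\<le>N. of_bool (near (cell_of L n z) (cell_of L n w)))"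
proof -
  define \<rho> where "\<rho> = max (norm (z - w)) (2 * L / 2 ^ N)"
  have \<rho>: "\<rho> > 0" using L by (simp add: \<rho>_def less_max_iff_disj)
  let ?C = "{n. \<rho> < 2 * L / 2 ^ n}"
  have "?C \<subseteq> {..N} \<inter> {n. near (cell_of L n z) (cell_of L n w)}"
  proof
    fix n assume "n \<in> ?C"
    then have "norm (z - w) < 2 * L / 2 ^ n" "2 * L / 2 ^ N < 2 * L / 2 ^ n" by (auto simp: \<rho>_def)
    then have "near (cell_of L n z) (cell_of L n w)" "(2::real) ^ n < 2 ^ N"
      using L dist_imp_near[OF L] by (auto simp: field_simps)
    then show "n \<in> {..N} \<inter> {n. near (cell_of L n z) (cell_of L n w)}" by simp
  qed
  then have "card ?C \<le> card ({..N} \<inter> {n. near (cell_of L n z) (cell_of L n w)})" by (intro card_mono) auto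
  also have "real \<dots> = (\<Sum>n\<le>N. of_bool (near (cell_of L n z) (cell_of L n w)))"
    by (simp add: of_bool_def sum.If_cases)
  finally have "real (card ?C) \<le> (\<Sum>n\<le>N. of_bool (near (cell_of L n z) (cell_of L n w)))" by simp
  then have "ln 2 * real (card ?C) \<le> ln 2 * (\<Sum>n\<le>N. of_bool (near (cell_of L n z) (cell_of L n w)))"
    by (intro mult_left_mono) auto
  with scales_above(2)[OF L \<rho>] have "ln (2 * L / \<rho>) \<le> ln 2 * (\<Sum>n\<le>N. of_bool (near (cell_of L n z) (cell_of L n w)))"
    by linarith
  moreover have "ln (4 * (2 * L) / \<rho>) = ln 4 + ln (2 * L / \<rho>)"
    using L \<rho> ln_mult[of 4 "2 * L / \<rho>"] by simp
  ultimately show ?thesis unfolding \<rho>_def by linarith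
qed

text \<open>The potential is large near \<open>E\<close>, bounded away from \<open>E\<close> independently
  of \<open>N\<close>, and its energy is only linear in its size.\<close>

lemma equilibrium_potential:
  fixes N :: nat
  assumes L: "L > 0" and e0: "e0 \<in> E" "cell_of L 0 e0 = (0, 0)"
  defines "V \<equiv> 1 / trunc_conductance (\<lambda>n Q. \<exists>z\<in>E. cell_of L n z = Q) N 0 (0, 0)"
  obtains U g where "\<And>z. GDERIV U z :> g z" "continuous_on UNIV g"
    "\<And>z z'. z' \<in> E \<Longrightarrow> cell_of L 0 z' = (0, 0) \<Longrightarrow> norm (z - z') \<le> 2 * L / 2 ^ N \<Longrightarrow> ln 2 * V - ln (16 * L) \<le> U z"
    "\<And>z r. 0 < r \<Longrightarrow> \<forall>w\<in>E. r \<le> norm (z - w) \<Longrightarrow> U z \<le> - ln r"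
    "(\<integral>\<^sup>+z. ennreal (indicator (ball 0 (2 * L)) z * (norm (g z))\<^sup>2) \<partial>lborel)
       \<le> ennreal (4 * pi * (1 + ln 4 + 9 * ln 2 * V))"
proof -
  obtain A :: "cell set" and a w where A: "finite A" "\<And>Q. Q \<in> A \<Longrightarrow> 0 < a Q" "sum a A = 1"
    "\<And>Q. Q \<in> A \<Longrightarrow> w Q \<in> E" "\<And>Q. Q \<in> A \<Longrightarrow> cell_of L 0 (w Q) = (0, 0)"
    and lower: "\<And>z. z \<in> E \<Longrightarrow> cell_of L 0 z = (0, 0) \<Longrightarrow>
      (\<Sum>Q\<in>A. a Q * (\<Sum>n\<le>N. of_bool (cell_of L n z = cell_of L n (w Q)))) = V"
    and energy: "(\<Sum>P\<in>A. \<Sum>Q\<in>A. a P * a Q * (\<Sum>n\<le>N. of_bool (near (cell_of L n (w P)) (cell_of L n (w Q))))) \<le> 9 * V"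
    by (rule discrete_equilibrium[OF L e0, of N, folded V_def], rule that) assumption+
  define \<delta> where "\<delta> = 2 * L / 2 ^ N"
  have \<delta>: "\<delta> > 0" using L by (simp add: \<delta>_def)
  have \<delta>4: "\<delta> \<le> 4 * (2 * L)"
  proof -
    have "1 \<le> (2::real) ^ N" by simp
    then have "\<delta> \<le> 2 * L / 1" unfolding \<delta>_def using L by (intro divide_left_mono) auto
    then show ?thesis using L by simp
  qed
  show ?thesis
  proof (rule that[of "potential A a w \<delta>" "potential_grad A a w \<delta>"])
    show "GDERIV (potential A a w \<delta>) z :> potential_grad A a w \<delta> z" for z
      by (rule GDERIV_potential[OF \<delta>])
    show "continuous_on UNIV (potential_grad A a w \<delta>)" by (rule continuous_potential_grad[OF \<delta>])
    show "ln 2 * V - ln (16 * L) \<le> potential A a w \<delta> z"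
      if z': "z' \<in> E" "cell_of L 0 z' = (0, 0)" "norm (z - z') \<le> 2 * L / 2 ^ N" for z z'
    proof -
      have "ln 2 * V - ln (16 * L) = (\<Sum>Q\<in>A. a Q * (ln 2 * (\<Sum>n\<le>N. of_bool (cell_of L n z' = cell_of L n (w Q))) - ln (16 * L)))"
        using lower[OF z'(1,2)] A(3)
        by (simp add: right_diff_distrib sum_subtractf sum_distrib_right[symmetric] mult.left_commute[of _ "ln 2"] sum_distrib_left[symmetric])
      also have "\<dots> \<le> potential A a w \<delta> z"
        unfolding potential_def \<delta>_def
        by (intro sum_mono mult_left_mono log_kernel_ge_common_cells L z')
          (use A z' in \<open>auto intro: less_imp_le\<close>)
      finally show ?thesis .
    qed
    show "potential A a w \<delta> z \<le> - ln r" if r: "0 < r" "\<forall>w\<in>E. r \<le> norm (z - w)" for z r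
    proof -
      have "potential A a w \<delta> z \<le> (\<Sum>Q\<in>A. a Q * (- ln r))"
        unfolding potential_def
      proof (intro sum_mono mult_left_mono)
        fix Q assume Q: "Q \<in> A"
        have "r\<^sup>2 \<le> (norm (z - w Q))\<^sup>2" using r A(4)[OF Q] by (intro power_mono) auto
        then have "r\<^sup>2 \<le> (norm (z - w Q))\<^sup>2 + \<delta>\<^sup>2" using zero_le_power2[of \<delta>] by linarith
        moreover have r2: "0 < r\<^sup>2" using r by simp
        moreover have "0 < (norm (z - w Q))\<^sup>2 + \<delta>\<^sup>2" using calculation by linarith
        ultimately have "ln (r\<^sup>2) \<le> ln ((norm (z - w Q))\<^sup>2 + \<delta>\<^sup>2)" by (subst ln_le_cancel_iff) auto
        then show "- (1 / 2) * ln ((norm (z - w Q))\<^sup>2 + \<delta>\<^sup>2) \<le> - ln r"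
          using r by (simp add: ln_realpow)
      qed (use A in \<open>auto intro: less_imp_le\<close>)
      also have "\<dots> = - ln r" using A(3) by (simp add: sum_negf sum_distrib_right[symmetric])
      finally show ?thesis .
    qed
    have "(\<integral>\<^sup>+z. ennreal (indicator (ball 0 (2 * L)) z * (norm (potential_grad A a w \<delta> z))\<^sup>2) \<partial>lborel)
       \<le> ennreal (\<Sum>P\<in>A. \<Sum>Q\<in>A. a P * a Q * (4 * pi * (1 + ln (4 * (2 * L) / max (norm (w P - w Q)) \<delta>))))"
      using A norm_lt_of_root[OF L] \<delta> \<delta>4 by (intro nn_integral_potential_grad) (auto intro: less_imp_le)
    also have "\<dots> \<le> ennreal (4 * pi * (1 + ln 4 + 9 * ln 2 * V))"
    proof (rule ennreal_leI)
      have "(\<Sum>P\<in>A. \<Sum>Q\<in>A. a P * a Q * (4 * pi * (1 + ln (4 * (2 * L) / max (norm (w P - w Q)) \<delta>))))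
          \<le> (\<Sum>P\<in>A. \<Sum>Q\<in>A. a P * a Q * (4 * pi * (1 + (ln 4 + ln 2 * (\<Sum>n\<le>N. of_bool (near (cell_of L n (w P)) (cell_of L n (w Q))))))))"
        unfolding \<delta>_def using A(2)
        by (intro sum_mono mult_left_mono add_left_mono ln_ratio_le_near_count[OF L]) (auto intro: less_imp_le)
      also have "\<dots> = (\<Sum>P\<in>A. \<Sum>Q\<in>A. (a P * (a Q * (4 * pi * (1 + ln 4))))
            + 4 * pi * ln 2 * (a P * a Q * (\<Sum>n\<le>N. of_bool (near (cell_of L n (w P)) (cell_of L n (w Q))))))"
        by (intro sum.cong refl) (simp only: distrib_left distrib_right mult_ac add_ac)
      also have "\<dots> = (\<Sum>P\<in>A. a P * (\<Sum>Q\<in>A. a Q * (4 * pi * (1 + ln 4))))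
            + 4 * pi * ln 2 * (\<Sum>P\<in>A. \<Sum>Q\<in>A. a P * a Q * (\<Sum>n\<le>N. of_bool (near (cell_of L n (w P)) (cell_of L n (w Q)))))"
        by (simp only: sum.distrib sum_distrib_left)
      also have "(\<Sum>P\<in>A. a P * (\<Sum>Q\<in>A. a Q * (4 * pi * (1 + ln 4)))) = 4 * pi * (1 + ln 4)"
        using A(3) by (simp only: sum_distrib_right[symmetric] mult_1_left)
      also have "4 * pi * (1 + ln 4) + 4 * pi * ln 2 * (\<Sum>P\<in>A. \<Sum>Q\<in>A. a P * a Q * (\<Sum>n\<le>N. of_bool (near (cell_of L n (w P)) (cell_of L n (w Q)))))
          \<le> 4 * pi * (1 + ln 4) + 4 * pi * ln 2 * (9 * V)"
        by (intro add_left_mono mult_left_mono energy) simp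
      finally show "(\<Sum>P\<in>A. \<Sum>Q\<in>A. a P * a Q * (4 * pi * (1 + ln (4 * (2 * L) / max (norm (w P - w Q)) \<delta>))))
          \<le> 4 * pi * (1 + ln 4 + 9 * ln 2 * V)" by (simp add: algebra_simps)
    qed
    finally show "(\<integral>\<^sup>+z. ennreal (indicator (ball 0 (2 * L)) z * (norm (potential_grad A a w \<delta> z))\<^sup>2) \<partial>lborel)
       \<le> ennreal (4 * pi * (1 + ln 4 + 9 * ln 2 * V))" .
  qed
qed

text \<open>Otherwise the limit network would charge \<open>E\<close>.\<close>

lemma trunc_conductance_tendsto_0:
  assumes "closed E" "L > 0" "log_capacity E = 0"
  shows "(\<lambda>N. trunc_conductance (\<lambda>n Q. \<exists>z\<in>E. cell_of L n z = Q) N 0 (0, 0)) \<longlonglongrightarrow> 0"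
proof -
  let ?H = "\<lambda>n Q. \<exists>z\<in>E. cell_of L n z = Q"
  have par: "?H n (parent Q)" if "?H (Suc n) Q" for n Q using that by (auto simp: parent_cell_of)
  obtain S where S: "\<And>n Q. (\<lambda>k. trunc_conductance ?H k n Q) \<longlonglongrightarrow> S n Q" "\<And>N. conductances N S" "\<And>n Q. S n Q \<le> trunc_conductance ?H 0 n Q"
    by (rule trunc_conductance_limit[of ?H, OF par], assumption, rule that) assumption+
  have "S 0 (0, 0) = 0"
  proof (rule ccontr)
    assume "S 0 (0, 0) \<noteq> 0"
    then have pos: "S 0 (0, 0) > 0" using conductances_nonneg[OF S(2), of 0 "(0, 0)"] by simp
    have "\<exists>z\<in>E. cell_of L n z = Q" if "S n Q > 0" for n Q
    proof (rule ccontr)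
      assume "\<not> ?thesis"
      then have "trunc_conductance ?H 0 n Q = 0" by simp
      with S(3)[of n Q] that show False by simp
    qed
    from log_capacity_pos_of_conductance[OF assms(1,2) S(2) pos this] assms(3) show False by simp
  qed
  with S(1)[of 0 "(0, 0)"] show ?thesis by simp
qed



lemma GDERIV_cutoff_product:
  assumes u: "\<And>z. GDERIV u z :> u' z" and U: "\<And>z. GDERIV U z :> g z" and "D \<noteq> 0"
  shows "GDERIV (\<lambda>z. u z * (1 - step ((U z - c) / D))) z
     :> (1 - step ((U z - c) / D)) *\<^sub>R u' z - (u z * step' ((U z - c) / D) / D) *\<^sub>R g z"
proof -
  have d: "((\<lambda>t. (t - c) / D) has_real_derivative 1 / D) (at t)" for t
    using \<open>D \<noteq> 0\<close> by (auto intro!: derivative_eq_intros)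
  have "((\<lambda>t. 1 - step ((t - c) / D)) has_real_derivative 0 - step' ((t - c) / D) * (1 / D)) (at t)" for t
    by (intro derivative_intros DERIV_chain2[OF DERIV_step d])
  from GDERIV_mult[OF u GDERIV_DERIV_compose[OF U this], of z]
  show ?thesis by (rule GDERIV_subst) simp
qed

text \<open>Multiply a logarithmic cutoff at infinity by \<open>1 - step ((U - c) / D)\<close>, where
  \<open>U\<close> is the potential of a discrete equilibrium measure. With \<open>V\<close> the
  resistance of the truncated tree, \<open>D\<close> is of order \<open>V\<close> and the energy
  of \<open>U\<close> at most of order \<open>V\<close>, so the energy of the second factor is of
  order \<open>1 / V\<close>.\<close>

lemma exists_cutoff_small_energy:
  assumes E: "closed E" "log_capacity E = 0" and z0: "z0 \<notin> E"
  obtains r where "r > 0" "cball z0 r \<inter> E = {}"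
    "\<And>\<epsilon>. \<epsilon> > 0 \<Longrightarrow> \<exists>\<eta> g. cutoff_on (- E) \<eta> g \<and> (\<forall>z. 0 \<le> \<eta> z) \<and> (\<forall>z\<in>cball z0 r. \<eta> z = 1)
       \<and> (\<integral>\<^sup>+z. ennreal ((norm (g z))\<^sup>2) \<partial>lborel) \<le> ennreal \<epsilon>"
proof -
  have "open (- E)" "z0 \<in> - E" using E z0 by auto
  then obtain r0 where r0: "r0 > 0" "cball z0 r0 \<subseteq> - E" by (meson open_contains_cball)
  define r where "r = r0 / 2"
  have r: "r > 0" using r0 by (simp add: r_def)
  have far: "r \<le> norm (z - w)" if "z \<in> cball z0 r" "w \<in> E" for z w
  proof (rule ccontr)
    assume "\<not> ?thesis"
    then have "dist z0 w \<le> r0"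
      using that(1) dist_triangle[of z0 w z] by (auto simp: r_def dist_norm norm_minus_commute)
    then show False using r0(2) that(2) by auto
  qed
  show ?thesis
  proof (rule that[OF r])
    have "cball z0 r \<subseteq> cball z0 r0" using r0(1) by (intro subset_cball) (simp add: r_def)
    then show "cball z0 r \<inter> E = {}" using r0(2) by blast
    fix \<epsilon> :: real assume \<epsilon>: "\<epsilon> > 0"
    \<comment> \<open>The first bound makes the energy of the cutoff at infinity at most \<open>\<epsilon> / 4\<close>, the second makes it 1 on the disc.\<close>
    define m where "m = max 1 (max (4 * (96 * pi) / \<epsilon>) (ln ((norm z0 + r)\<^sup>2 + 1)))"
    have m: "m \<ge> 1" "4 * (96 * pi) / \<epsilon> \<le> m" "ln ((norm z0 + r)\<^sup>2 + 1) \<le> m"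
      unfolding m_def by auto
    have m0: "m > 0" using m by simp
    have chi_energy: "(\<integral>\<^sup>+z. ennreal ((norm (log_cutoff_grad m z))\<^sup>2) \<partial>lborel) \<le> ennreal (\<epsilon> / 4)"
    proof -
      have "16 / m\<^sup>2 * (2 * pi * (1 + 2 * m)) \<le> 16 / m\<^sup>2 * (2 * pi * (3 * m))"
        using m by (intro mult_left_mono) auto
      also have "\<dots> = 96 * pi / m" using m0 by (simp add: power2_eq_square field_simps)
      also have "\<dots> \<le> \<epsilon> / 4" using m(2) m0 \<epsilon> by (simp add: field_simps)
      finally show ?thesis
        using nn_integral_log_cutoff_grad[OF m0] by (meson ennreal_leI order_trans)
    qed
    have chi_eq_1: "log_cutoff m z = 1" if "z \<in> cball z0 r" for z
    proof -
      have "norm z \<le> norm z0 + r" using that norm_triangle_ineq2[of z z0] by (simp add: dist_norm norm_minus_commute)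
      then have "(norm z)\<^sup>2 + 1 \<le> (norm z0 + r)\<^sup>2 + 1" by (simp add: power_mono)
      moreover have "0 < (norm z)\<^sup>2 + 1" by (simp add: add_nonneg_pos)
      ultimately have "ln ((norm z)\<^sup>2 + 1) \<le> ln ((norm z0 + r)\<^sup>2 + 1)" by (subst ln_le_cancel_iff) auto
      then have "ln ((norm z)\<^sup>2 + 1) \<le> 2 * m" using m by linarith
      then show ?thesis unfolding log_cutoff_def using m0 by (intro step_eq_1) (simp add: field_simps)
    qed
    define L where "L = exp (2 * m) + 1"
    have L: "L > 0" unfolding L_def by (simp add: add_pos_pos)
    have chi_eq_0: "log_cutoff m z = 0" if "L - 1 \<le> norm z" for z
      using log_cutoff_eq_0(1)[OF m0] that by (simp add: L_def)
    have bnd: "bounded {z. log_cutoff m z \<noteq> 0}"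
    proof (rule bounded_subset[of "cball 0 L"])
      show "{z. log_cutoff m z \<noteq> 0} \<subseteq> cball 0 L" using chi_eq_0 by (force simp: not_le[symmetric])
    qed simp
    have out: "log_cutoff m z = 0" if "e \<in> E" "cell_of L 0 e \<noteq> (0, 0)" "dist z e < 1" for e z
    proof -
      have "L \<le> norm e"
        using that(2) abs_Re_le_cmod[of e] abs_Im_le_cmod[of e] by (auto simp: cell_of_root[OF L])
      then show ?thesis using that(3) norm_triangle_ineq2[of e z] by (intro chi_eq_0) (simp add: dist_norm norm_minus_commute)
    qed
    have closure_sub: "closure {z. \<eta> z \<noteq> 0} \<subseteq> - E"
      if zero: "\<And>e. e \<in> E \<Longrightarrow> \<exists>d>0. \<forall>z. dist z e < d \<longrightarrow> \<eta> z = (0::real)" for \<eta>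
    proof
      fix e assume e: "e \<in> closure {z. \<eta> z \<noteq> 0}"
      show "e \<in> - E"
      proof
        assume "e \<in> E"
        then obtain d where d: "d > 0" "\<And>z. dist z e < d \<Longrightarrow> \<eta> z = 0" using zero by blast
        obtain y where "y \<in> {z. \<eta> z \<noteq> 0}" "dist y e < d" using e d(1) by (auto simp: closure_approachable)
        with d(2) show False by auto
      qed
    qed
    show "\<exists>\<eta> g. cutoff_on (- E) \<eta> g \<and> (\<forall>z. 0 \<le> \<eta> z) \<and> (\<forall>z\<in>cball z0 r. \<eta> z = 1)
       \<and> (\<integral>\<^sup>+z. ennreal ((norm (g z))\<^sup>2) \<partial>lborel) \<le> ennreal \<epsilon>"
    proof (cases "\<exists>e\<in>E. cell_of L 0 e = (0, 0)")
      case False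
      show ?thesis
      proof (intro exI conjI)
        show "cutoff_on (- E) (log_cutoff m) (log_cutoff_grad m)"
          unfolding cutoff_on_def
        proof (intro conjI allI)
          show "closure {z. log_cutoff m z \<noteq> 0} \<subseteq> - E"
            by (rule closure_sub) (use False out in \<open>auto intro!: exI[of _ 1]\<close>)
        qed (use GDERIV_log_cutoff[OF m0] continuous_log_cutoff_grad[OF m0] bnd in auto)
        show "\<forall>z. 0 \<le> log_cutoff m z" by (simp add: log_cutoff_def step_bounds)
        show "\<forall>z\<in>cball z0 r. log_cutoff m z = 1" using chi_eq_1 by blast
        show "(\<integral>\<^sup>+z. ennreal ((norm (log_cutoff_grad m z))\<^sup>2) \<partial>lborel) \<le> ennreal \<epsilon>"
          using chi_energy by (rule order_trans) (use \<epsilon> in \<open>auto intro: ennreal_leI\<close>)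
      qed
    next
      case True
      then obtain e0 where e0: "e0 \<in> E" "cell_of L 0 e0 = (0, 0)" by auto
      define C0 where "C0 = \<bar>ln r\<bar>"
      define c1 where "c1 = \<bar>ln (16 * L)\<bar>"
      define C1 where "C1 = 4 * pi * (1 + ln 4 + 9 * ln 2)"
      define C2 where "C2 = C1 * 64 / (ln 2)\<^sup>2"
      \<comment> \<open>Beyond this size, \<open>D\<close> is at least half of \<open>ln 2 * V\<close> and the energy of the second factor is at most \<open>\<epsilon> / 4\<close>.\<close>
      define V0 where "V0 = 1 + 2 * (c1 + C0) / ln 2 + 4 * C2 / \<epsilon>"
      have C: "C0 \<ge> 0" "c1 \<ge> 0" "C1 \<ge> 0" "C2 \<ge> 0"
        by (auto simp: C0_def c1_def C1_def C2_def intro!: mult_nonneg_nonneg add_nonneg_nonneg divide_nonneg_nonneg)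
      have V0: "V0 > 0" using C \<epsilon> unfolding V0_def by (intro add_pos_nonneg divide_nonneg_pos) auto
      let ?H = "\<lambda>n Q. \<exists>z\<in>E. cell_of L n z = Q"
      have pos: "0 < trunc_conductance ?H N 0 (0, 0)" for N
        using trunc_conductance_pos[of ?H "\<lambda>n. cell_of L n e0" N 0] e0 by (auto simp: parent_cell_of)
      have "\<forall>\<^sub>F N in sequentially. trunc_conductance ?H N 0 (0, 0) < 1 / V0"
        using trunc_conductance_tendsto_0[OF E(1) L E(2)] V0 by (intro order_tendstoD) auto
      then obtain N where N: "trunc_conductance ?H N 0 (0, 0) < 1 / V0" by (auto simp: eventually_sequentially)
      define V where "V = 1 / trunc_conductance ?H N 0 (0, 0)"
      have V: "V0 \<le> V" using N V0 pos[of N] by (simp add: V_def field_simps)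
      have V1: "1 \<le> V" "2 * (c1 + C0) / ln 2 \<le> V" "4 * C2 / \<epsilon> \<le> V"
      proof -
        have "0 \<le> 2 * (c1 + C0) / ln 2" "0 \<le> 4 * C2 / \<epsilon>" using C \<epsilon> by auto
        with V show "1 \<le> V" "2 * (c1 + C0) / ln 2 \<le> V" "4 * C2 / \<epsilon> \<le> V" unfolding V0_def by linarith+
      qed
      obtain U g where U: "\<And>z. GDERIV U z :> g z" "continuous_on UNIV g"
        and Ulow: "\<And>z z'. z' \<in> E \<Longrightarrow> cell_of L 0 z' = (0, 0) \<Longrightarrow> norm (z - z') \<le> 2 * L / 2 ^ N \<Longrightarrow> ln 2 * V - ln (16 * L) \<le> U z"
        and Uup: "\<And>z r. 0 < r \<Longrightarrow> \<forall>w\<in>E. r \<le> norm (z - w) \<Longrightarrow> U z \<le> - ln r"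
        and Uen: "(\<integral>\<^sup>+z. ennreal (indicator (ball 0 (2 * L)) z * (norm (g z))\<^sup>2) \<partial>lborel)
           \<le> ennreal (4 * pi * (1 + ln 4 + 9 * ln 2 * V))"
        by (rule equilibrium_potential[OF L e0, of N, folded V_def], rule that) assumption+
      define D where "D = ln 2 * V - c1 - C0"
      have D: "D \<ge> ln 2 / 2 * V"
      proof -
        have "2 * (c1 + C0) \<le> ln 2 * V" using V1(2) by (simp add: field_simps)
        then show ?thesis unfolding D_def by argo
      qed
      have D0: "D > 0" 
      proof (rule less_le_trans[OF _ D])
        show "0 < ln 2 / 2 * V" using V1(1) by (intro mult_pos_pos) auto
      qed
      define \<eta> where "\<eta> z = log_cutoff m z * (1 - step ((U z - C0) / D))" for z
      define G where "G z = (1 - step ((U z - C0) / D)) *\<^sub>R log_cutoff_grad m z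
         - (log_cutoff m z * step' ((U z - C0) / D) / D) *\<^sub>R g z" for z
      have contU: "continuous_on UNIV U"
        by (rule continuous_at_imp_continuous_on, rule ballI) (rule has_derivative_continuous[OF U(1)[unfolded gderiv_def]])
      have cont_cut: "continuous_on UNIV (log_cutoff m)"
        by (rule continuous_at_imp_continuous_on, rule ballI)
          (rule has_derivative_continuous[OF GDERIV_log_cutoff[OF m0, unfolded gderiv_def]])
      have cont_step: "continuous_on UNIV step"
        by (rule continuous_at_imp_continuous_on, rule ballI) (rule DERIV_isCont[OF DERIV_step])
      have contG: "continuous_on UNIV G"
        unfolding G_def
        by (intro continuous_intros continuous_log_cutoff_grad m0 U(2) cont_cut
            continuous_on_compose2[OF cont_step] continuous_on_compose2[OF continuous_step'] contU)
          (use D0 in auto)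
      show ?thesis
      proof (intro exI conjI)
        show "cutoff_on (- E) \<eta> G"
          unfolding cutoff_on_def
        proof (intro conjI allI)
          show "GDERIV \<eta> z :> G z" for z
            unfolding \<eta>_def[abs_def] G_def by (rule GDERIV_cutoff_product[OF GDERIV_log_cutoff[OF m0] U(1)]) (use D0 in simp)
          show "continuous_on UNIV G" by (rule contG)
          show "bounded {z. \<eta> z \<noteq> 0}" by (rule bounded_subset[OF bnd]) (auto simp: \<eta>_def)
          show "closure {z. \<eta> z \<noteq> 0} \<subseteq> - E"
          proof (rule closure_sub)
            fix e assume e: "e \<in> E"
            show "\<exists>d>0. \<forall>z. dist z e < d \<longrightarrow> \<eta> z = 0"
            proof (cases "cell_of L 0 e = (0, 0)")
              case True
              have "\<eta> z = 0" if "dist z e < 2 * L / 2 ^ N" for z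
              proof -
                have "ln 2 * V - ln (16 * L) \<le> U z"
                  using that by (intro Ulow[OF e True]) (simp add: dist_norm)
                then have "1 \<le> (U z - C0) / D" using D0 by (simp add: D_def c1_def)
                then show ?thesis by (simp add: \<eta>_def step_eq_1)
              qed
              then show ?thesis using L by (intro exI[of _ "2 * L / 2 ^ N"]) auto
            next
              case False
              then show ?thesis using out[OF e] by (intro exI[of _ 1]) (auto simp: \<eta>_def)
            qed
          qed
        qed
        show "\<forall>z. 0 \<le> \<eta> z" by (simp add: \<eta>_def log_cutoff_def step_bounds)
        show "\<forall>z\<in>cball z0 r. \<eta> z = 1"
        proof
          fix z assume z: "z \<in> cball z0 r"
          have "U z \<le> - ln r" using far[OF z] by (intro Uup[OF r]) blast
          then have "(U z - C0) / D \<le> 0" using D0 by (simp add: C0_def divide_le_0_iff)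
          then show "\<eta> z = 1" by (simp add: \<eta>_def chi_eq_1[OF z] step_eq_0)
        qed
        have G_le: "(norm (G z))\<^sup>2 \<le> 2 * (norm (log_cutoff_grad m z))\<^sup>2
            + 2 * (16 / D\<^sup>2) * (indicator (ball 0 (2 * L)) z * (norm (g z))\<^sup>2)" for z
        proof -
          let ?a = "norm (log_cutoff_grad m z)" and ?b = "4 / D * (indicator (ball 0 (2 * L)) z * norm (g z))"
          have 1: "norm ((1 - step ((U z - C0) / D)) *\<^sub>R log_cutoff_grad m z) \<le> ?a"
            using step_bounds[of "(U z - C0) / D"] by (simp add: mult_left_le_one_le)
          have 2: "norm ((log_cutoff m z * step' ((U z - C0) / D) / D) *\<^sub>R g z) \<le> ?b"
          proof (cases "norm z < 2 * L")
            case True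
            have "\<bar>log_cutoff m z\<bar> \<le> 1" by (simp add: log_cutoff_def abs_le_iff step_bounds)
            then have "\<bar>log_cutoff m z\<bar> * step' ((U z - C0) / D) \<le> 1 * 4"
              using step'_bounds by (intro mult_mono) auto
            then have "\<bar>log_cutoff m z\<bar> * step' ((U z - C0) / D) / D * norm (g z) \<le> 4 / D * norm (g z)"
              using D0 by (intro mult_right_mono divide_right_mono) auto
            then show ?thesis using True D0 step'_bounds(1) by (simp add: abs_mult)
          next
            case False
            then have "log_cutoff m z = 0" using L by (intro chi_eq_0) linarith
            then show ?thesis using False by simp
          qed
          have "norm (G z) \<le> ?a + ?b" unfolding G_def using 1 2 norm_triangle_ineq4 by (smt (verit))
          then have "(norm (G z))\<^sup>2 \<le> (?a + ?b)\<^sup>2" by (intro power_mono) auto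
          also have "\<dots> \<le> 2 * ?a\<^sup>2 + 2 * ?b\<^sup>2"
            using sum_squares_bound[of ?a ?b] unfolding power2_sum by linarith
          also have "?b\<^sup>2 = 16 / D\<^sup>2 * (indicator (ball 0 (2 * L)) z * (norm (g z))\<^sup>2)"
            by (simp add: power_mult_distrib power_divide indicator_def)
          finally show ?thesis by simp
        qed
        have mg [measurable]: "g \<in> borel_measurable borel" "log_cutoff_grad m \<in> borel_measurable borel"
          using U(2) continuous_log_cutoff_grad[OF m0] by (auto intro: borel_measurable_continuous_onI)
        have mi: "(\<lambda>z. ennreal (indicator (ball 0 (2 * L)) z * (norm (g z))\<^sup>2)) \<in> borel_measurable lborel"
        proof -
          have "(\<lambda>z. indicator (ball 0 (2 * L)) z * (norm (g z))\<^sup>2) \<in> borel_measurable borel"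
            by (intro borel_measurable_times borel_measurable_indicator) auto
          then show ?thesis by simp
        qed
        have "(\<integral>\<^sup>+z. ennreal ((norm (G z))\<^sup>2) \<partial>lborel) \<le> (\<integral>\<^sup>+z. ennreal 2 * ennreal ((norm (log_cutoff_grad m z))\<^sup>2)
            + ennreal (2 * (16 / D\<^sup>2)) * ennreal (indicator (ball 0 (2 * L)) z * (norm (g z))\<^sup>2) \<partial>lborel)"
        proof (rule nn_integral_mono)
          fix z
          have "ennreal ((norm (G z))\<^sup>2) \<le> ennreal (2 * (norm (log_cutoff_grad m z))\<^sup>2
            + 2 * (16 / D\<^sup>2) * (indicator (ball 0 (2 * L)) z * (norm (g z))\<^sup>2))" by (rule ennreal_leI[OF G_le])
          also have "\<dots> = ennreal (2 * (norm (log_cutoff_grad m z))\<^sup>2)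
            + ennreal (2 * (16 / D\<^sup>2) * (indicator (ball 0 (2 * L)) z * (norm (g z))\<^sup>2))"
            by (rule ennreal_plus) auto
          also have "\<dots> = ennreal 2 * ennreal ((norm (log_cutoff_grad m z))\<^sup>2)
            + ennreal (2 * (16 / D\<^sup>2)) * ennreal (indicator (ball 0 (2 * L)) z * (norm (g z))\<^sup>2)"
            by (subst (1 2) ennreal_mult) auto
          finally show "ennreal ((norm (G z))\<^sup>2) \<le> \<dots>" .
        qed
        also have "\<dots> = ennreal 2 * (\<integral>\<^sup>+z. ennreal ((norm (log_cutoff_grad m z))\<^sup>2) \<partial>lborel)
            + ennreal (2 * (16 / D\<^sup>2)) * (\<integral>\<^sup>+z. ennreal (indicator (ball 0 (2 * L)) z * (norm (g z))\<^sup>2) \<partial>lborel)"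
          using mi by (subst nn_integral_add) (auto simp: nn_integral_cmult)
        also have "\<dots> \<le> ennreal 2 * ennreal (\<epsilon> / 4) + ennreal (2 * (16 / D\<^sup>2)) * ennreal (4 * pi * (1 + ln 4 + 9 * ln 2 * V))"
          by (intro add_mono mult_left_mono chi_energy Uen) auto
        also have "\<dots> = ennreal (\<epsilon> / 2) + ennreal (2 * (16 / D\<^sup>2) * (4 * pi * (1 + ln 4 + 9 * ln 2 * V)))"
        proof (rule arg_cong2[of _ _ _ _ "(+)"])
          have "ennreal 2 * ennreal (\<epsilon> / 4) = ennreal (2 * (\<epsilon> / 4))" by (rule ennreal_mult'[symmetric]) simp
          also have "2 * (\<epsilon> / 4) = \<epsilon> / 2" by simp
          finally show "ennreal 2 * ennreal (\<epsilon> / 4) = ennreal (\<epsilon> / 2)" .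
        qed (rule ennreal_mult'[symmetric], simp)
        also have "\<dots> \<le> ennreal (\<epsilon> / 2) + ennreal (\<epsilon> / 2)"
        proof (intro add_left_mono ennreal_leI)
          have "1 + ln 4 + 9 * ln 2 * V \<le> (1 + ln 4 + 9 * ln 2) * V"
          proof -
            have "(1 + ln 4) * 1 \<le> (1 + ln 4) * V" using V1(1) by (intro mult_left_mono) (auto intro: add_nonneg_nonneg)
            then show ?thesis by (simp add: algebra_simps)
          qed
          then have a: "4 * pi * (1 + ln 4 + 9 * ln 2 * V) \<le> C1 * V"
            unfolding C1_def by (simp add: mult.assoc)
          have "(ln 2 / 2 * V)\<^sup>2 \<le> D\<^sup>2" using D V1(1) by (intro power_mono) auto
          moreover have "0 < (ln 2 / 2 * V)\<^sup>2" using V1(1) by simp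
          ultimately have b: "16 / D\<^sup>2 \<le> 16 / (ln 2 / 2 * V)\<^sup>2" by (intro divide_left_mono mult_pos_pos) auto
          have "2 * (16 / D\<^sup>2) * (4 * pi * (1 + ln 4 + 9 * ln 2 * V)) \<le> 2 * (16 / (ln 2 / 2 * V)\<^sup>2) * (C1 * V)"
            by (rule mult_mono[OF mult_left_mono[OF b] a]) (use V1(1) in \<open>auto intro!: mult_nonneg_nonneg add_nonneg_nonneg\<close>)
          also have "\<dots> = 2 * C2 / V" using V1(1) by (simp add: C2_def field_simps power2_eq_square)
          also have "\<dots> \<le> \<epsilon> / 2" using V1 \<epsilon> by (simp add: field_simps)
          finally show "2 * (16 / D\<^sup>2) * (4 * pi * (1 + ln 4 + 9 * ln 2 * V)) \<le> \<epsilon> / 2" .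
        qed
        also have "\<dots> = ennreal \<epsilon>" using \<epsilon> by (subst ennreal_plus[symmetric]) auto
        finally show "(\<integral>\<^sup>+z. ennreal ((norm (G z))\<^sup>2) \<partial>lborel) \<le> ennreal \<epsilon>" .
      qed
    qed
  qed
qed

section \<open>Capacity zero excludes bounded strictly subharmonic functions\<close>

lemma complex_basis_sum: "(\<Sum>b\<in>(Basis :: complex set). f b) = f 1 + f \<i>"
  by (simp add: Basis_complex_def)

lemma Ck_on_2D:
  fixes \<phi> :: "'a::real_normed_vector \<Rightarrow> real"
  assumes "\<phi> smooth_on S" "x \<in> S"
  shows "(\<phi> has_derivative frechet_derivative \<phi> (at x)) (at x)"
    "((\<lambda>y. frechet_derivative \<phi> (at y) b) has_derivative frechet_derivative (\<lambda>y. frechet_derivative \<phi> (at y) b) (at x)) (at x)"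
    "continuous_on S (\<lambda>y. frechet_derivative (\<lambda>y. frechet_derivative \<phi> (at y) b) (at y) v)"
proof -
  have "Ck_on (Suc (Suc 0)) \<phi> S" using assms(1) by (simp only: smooth_on_def)
  then have 1: "\<forall>x\<in>S. \<phi> differentiable (at x)" and 2: "\<forall>v. Ck_on (Suc 0) (\<lambda>x. frechet_derivative \<phi> (at x) v) S"
    unfolding Ck_on.simps(2)[of "Suc 0"] by blast+
  from 2 have 3: "\<forall>v. \<forall>x\<in>S. (\<lambda>x. frechet_derivative \<phi> (at x) v) differentiable (at x)"
    "\<forall>v w. continuous_on S (\<lambda>x. frechet_derivative (\<lambda>x. frechet_derivative \<phi> (at x) v) (at x) w)"
    unfolding Ck_on.simps by blast+
  from 1 assms(2) show "(\<phi> has_derivative frechet_derivative \<phi> (at x)) (at x)"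
    by (simp only: frechet_derivative_works[symmetric])
  from 3(1) assms(2) show "((\<lambda>y. frechet_derivative \<phi> (at y) b) has_derivative frechet_derivative (\<lambda>y. frechet_derivative \<phi> (at y) b) (at x)) (at x)"
    by (simp only: frechet_derivative_works[symmetric])
  from 3(2) show "continuous_on S (\<lambda>y. frechet_derivative (\<lambda>y. frechet_derivative \<phi> (at y) b) (at y) v)"
    by blast
qed

lemma cutoff_on_square:
  assumes "cutoff_on \<Omega> \<eta> g"
  shows "cutoff_on \<Omega> (\<lambda>z. (\<eta> z)\<^sup>2) (\<lambda>z. (2 * \<eta> z) *\<^sub>R g z)"
  unfolding cutoff_on_def
proof (intro conjI allI)
  fix z
  have "GDERIV \<eta> z :> g z" using assms unfolding cutoff_on_def by blast
  from GDERIV_mult[OF this this] show "GDERIV (\<lambda>z. (\<eta> z)\<^sup>2) z :> (2 * \<eta> z) *\<^sub>R g z"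
    by (simp add: power2_eq_square scaleR_2 flip: scaleR_scaleR)
  show "continuous_on UNIV (\<lambda>z. (2 * \<eta> z) *\<^sub>R g z)"
    by (intro continuous_intros cutoff_onD[OF assms])
qed (use assms in \<open>simp_all add: cutoff_on_def\<close>)


text \<open>Test the identity \<open>\<Delta>(e\<^sup>\<phi>) = e\<^sup>\<phi> (\<Delta>\<phi> +
  \<bar>\<nabla>\<phi>\<bar>\<^sup>2)\<close> against \<open>\<eta>\<^sup>2\<close>. The
  exponential produces the gradient term that absorbs the mixed term \<open>2 \<eta>
  \<nabla>\<eta> \<nabla>\<phi>\<close> when the square is completed.\<close>

lemma caccioppoli:
  fixes \<phi> :: "complex \<Rightarrow> real"
  assumes cut: "cutoff_on \<Omega> \<eta> g" and "open \<Omega>" and smooth: "\<phi> smooth_on \<Omega>"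
    and M: "\<And>z. z \<in> \<Omega> \<Longrightarrow> \<bar>\<phi> z\<bar> \<le> M" and pos: "\<And>z. z \<in> \<Omega> \<Longrightarrow> 0 < laplacian \<phi> z"
    and disc: "cball z0 r \<subseteq> \<Omega>" "\<And>z. z \<in> cball z0 r \<Longrightarrow> \<eta> z = 1"
    and lap: "\<And>z. z \<in> cball z0 r \<Longrightarrow> c \<le> laplacian \<phi> z" "c \<ge> 0" "r > 0"
    and en: "(\<integral>\<^sup>+z. ennreal ((norm (g z))\<^sup>2) \<partial>lborel) \<le> ennreal \<epsilon>" "\<epsilon> \<ge> 0"
  shows "exp (- M) * c * (pi * r\<^sup>2) \<le> exp M * \<epsilon>"
proof -
  note cD = cutoff_onD[OF cut]
  define D where "D b z = frechet_derivative \<phi> (at z) b" for b z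
  define DD where "DD b z = frechet_derivative (\<lambda>y. frechet_derivative \<phi> (at y) b) (at z)" for b z
  have d\<phi>: "(\<phi> has_derivative (\<lambda>v. D v z)) (at z)" if "z \<in> \<Omega>" for z
    using Ck_on_2D(1)[OF smooth that] by (simp add: D_def[abs_def])
  have dD: "(D b has_derivative DD b z) (at z)" if "z \<in> \<Omega>" for b z
    using Ck_on_2D(2)[OF smooth that] by (simp add: D_def[abs_def] DD_def)
  have contDD: "continuous_on \<Omega> (\<lambda>z. DD b z v)" for b v
  proof (cases "\<Omega> = {}")
    case False
    then show ?thesis using Ck_on_2D(3)[OF smooth] unfolding DD_def by blast
  qed simp
  have cont\<phi>: "continuous_on \<Omega> \<phi>"
    by (rule continuous_at_imp_continuous_on, rule ballI) (rule has_derivative_continuous[OF d\<phi>])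
  have contD: "continuous_on \<Omega> (D b)" for b
    by (rule continuous_at_imp_continuous_on, rule ballI) (rule has_derivative_continuous[OF dD])
  define F where "F b z = (2 * \<eta> z * (b \<bullet> g z)) * (exp (\<phi> z) * D b z) + (\<eta> z)\<^sup>2 * (exp (\<phi> z) * (D b z)\<^sup>2 + exp (\<phi> z) * DD b z b)" for b z
  have F: "integrable lborel (F b)" "integral\<^sup>L lborel (F b) = 0" for b
  proof -
    have der: "((\<lambda>z. exp (\<phi> z) * D b z) has_derivative (\<lambda>v. exp (\<phi> z) * DD b z v + (exp (\<phi> z) * D v z) * D b z)) (at z)"
      if "z \<in> \<Omega>" for z
    proof -
      have e: "((\<lambda>z. exp (\<phi> z)) has_derivative (\<lambda>v. exp (\<phi> z) * D v z)) (at z)"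
        by (rule has_derivative_eq_rhs[OF has_derivative_exp[OF d\<phi>[OF that]]]) (simp add: mult.commute)
      show ?thesis by (rule has_derivative_mult[OF e dD[OF that]])
    qed
    have cont: "continuous_on \<Omega> (\<lambda>z. exp (\<phi> z) * DD b z b + (exp (\<phi> z) * D b z) * D b z)"
      by (intro continuous_intros cont\<phi> contD contDD)
    have eq: "(b \<bullet> ((2 * \<eta> z) *\<^sub>R g z)) *\<^sub>R (exp (\<phi> z) * D b z)
        + (\<eta> z)\<^sup>2 *\<^sub>R (exp (\<phi> z) * DD b z b + (exp (\<phi> z) * D b z) * D b z) = F b z" for z
      by (simp add: F_def power2_eq_square algebra_simps)
    from integral_cutoff_by_parts[OF cutoff_on_square[OF cut] \<open>open \<Omega>\<close> der cont]
    show "integrable lborel (F b)" "integral\<^sup>L lborel (F b) = 0" unfolding eq by auto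
  qed
  have mg: "g \<in> borel_measurable borel" by (rule borel_measurable_continuous_onI[OF cD(2)])
  have ig: "integrable lborel (\<lambda>z. (norm (g z))\<^sup>2)"
    by (rule integrableI_nonneg) (use mg en in \<open>auto simp: top_unique intro: le_less_trans\<close>)
  have "integral\<^sup>L lborel (\<lambda>z. (norm (g z))\<^sup>2) \<le> \<epsilon>"
    using en by (subst integral_eq_nn_integral) (use mg in \<open>auto simp: enn2real_leI\<close>)
  then have ub: "integral\<^sup>L lborel (\<lambda>z. exp M * (norm (g z))\<^sup>2) \<le> exp M * \<epsilon>"
    by simp
  have point: "indicator (cball z0 r) z * (exp (- M) * c) \<le> F 1 z + F \<i> z + exp M * (norm (g z))\<^sup>2" for z
  proof (cases "z \<in> \<Omega>")
    case True
    define e x y where "e = exp (\<phi> z)" and "x = \<eta> z * D 1 z" and "y = \<eta> z * D \<i> z"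
    have e: "e > 0" "exp (- M) \<le> e" "e \<le> exp M" using M[OF True] by (auto simp: e_def)
    have lapl: "laplacian \<phi> z = DD 1 z 1 + DD \<i> z \<i>" by (simp add: laplacian_def complex_basis_sum DD_def)
    have alg: "(2 * n * A) * (e * p) + n\<^sup>2 * (e * p\<^sup>2 + e * s) + ((2 * n * B) * (e * q) + n\<^sup>2 * (e * q\<^sup>2 + e * t)) + e * (A\<^sup>2 + B\<^sup>2)
        = e * ((n * p + A)\<^sup>2 + (n * q + B)\<^sup>2) + n\<^sup>2 * e * (s + t)" for n A B p q s t :: real
      by algebra
    have "F 1 z + F \<i> z + e * (norm (g z))\<^sup>2 = e * ((x + Re (g z))\<^sup>2 + (y + Im (g z))\<^sup>2) + (\<eta> z)\<^sup>2 * e * laplacian \<phi> z"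
      unfolding F_def e_def[symmetric] lapl x_def y_def cmod_power2 complex_inner_1 complex_inner_i_left
      by (rule alg)
    moreover have "0 \<le> e * ((x + Re (g z))\<^sup>2 + (y + Im (g z))\<^sup>2)" using e by simp
    ultimately have 1: "(\<eta> z)\<^sup>2 * e * laplacian \<phi> z \<le> F 1 z + F \<i> z + e * (norm (g z))\<^sup>2" by linarith
    have "e * (norm (g z))\<^sup>2 \<le> exp M * (norm (g z))\<^sup>2" using e by (intro mult_right_mono) auto
    with 1 have 2: "(\<eta> z)\<^sup>2 * e * laplacian \<phi> z \<le> F 1 z + F \<i> z + exp M * (norm (g z))\<^sup>2" by linarith
    show ?thesis
    proof (cases "z \<in> cball z0 r")
      case True
      have "exp (- M) * c \<le> e * laplacian \<phi> z" using e lap(1)[OF True] lap(2) by (intro mult_mono) auto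
      then show ?thesis using 2 True disc(2)[OF True] by simp
    next
      case False
      have "0 \<le> (\<eta> z)\<^sup>2 * e * laplacian \<phi> z" using e pos[OF \<open>z \<in> \<Omega>\<close>] by simp
      then show ?thesis using 2 False by simp
    qed
  next
    case False
    then have "z \<notin> closure {z. \<eta> z \<noteq> 0}" using cD(6) by blast
    then have "\<eta> z = 0" "g z = 0" using cD(4)[of z] cD(5)[of z] by blast+
    moreover have "z \<notin> cball z0 r" using False disc(1) by blast
    ultimately show ?thesis by (simp add: F_def)
  qed
  have "integral\<^sup>L lborel (\<lambda>z. indicator (cball z0 r) z * (exp (- M) * c)) \<le> integral\<^sup>L lborel (\<lambda>z. F 1 z + F \<i> z + exp M * (norm (g z))\<^sup>2)"
  proof (rule integral_mono)
    show "integrable lborel (\<lambda>z. indicator (cball z0 r) z * (exp (- M) * c))"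
      by (intro integrable_mult_left integrable_real_indicator emeasure_lborel_cball_finite) auto
    show "integrable lborel (\<lambda>z. F 1 z + F \<i> z + exp M * (norm (g z))\<^sup>2)"
      by (intro Bochner_Integration.integrable_add F ig integrable_mult_right)
  qed (rule point)
  also have "\<dots> = integral\<^sup>L lborel (\<lambda>z. exp M * (norm (g z))\<^sup>2)"
    using F ig by (simp add: Bochner_Integration.integral_add)
  also note ub
  also have "integral\<^sup>L lborel (\<lambda>z. indicator (cball z0 r) z * (exp (- M) * c)) = exp (- M) * c * (pi * r\<^sup>2)"
    using lap(3) content_cball[of r z0] by (simp add: unit_ball_vol_2)
  finally show ?thesis .
qed




lemma zero_capacity_no_bounded_subharmonic:
  fixes \<phi> :: "complex \<Rightarrow> real"
  assumes "open \<Omega>" "\<Omega> \<noteq> {}" "log_capacity (- \<Omega>) = 0"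
    and bd: "bounded (\<phi> ` \<Omega>)" and smooth: "\<phi> smooth_on \<Omega>" and pos: "\<forall>z\<in>\<Omega>. laplacian \<phi> z > 0"
  shows False
proof -
  obtain z0 where z0: "z0 \<in> \<Omega>" using assms(2) by blast
  obtain M where M: "\<And>z. z \<in> \<Omega> \<Longrightarrow> \<bar>\<phi> z\<bar> \<le> M" using bd by (auto simp: bounded_iff)
  have cl: "closed (- \<Omega>)" and nz: "z0 \<notin> - \<Omega>" using assms(1) z0 by auto
  obtain r where r: "r > 0" "cball z0 r \<inter> - \<Omega> = {}"
    and ex: "\<And>\<epsilon>. \<epsilon> > 0 \<Longrightarrow> \<exists>\<eta> g. cutoff_on (- (- \<Omega>)) \<eta> g \<and> (\<forall>z. 0 \<le> \<eta> z) \<and> (\<forall>z\<in>cball z0 r. \<eta> z = 1)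
       \<and> (\<integral>\<^sup>+z. ennreal ((norm (g z))\<^sup>2) \<partial>lborel) \<le> ennreal \<epsilon>"
    by (rule exists_cutoff_small_energy[OF cl assms(3) nz], rule that) assumption+
  have disc: "cball z0 r \<subseteq> \<Omega>" using r(2) by blast
  have "continuous_on \<Omega> (laplacian \<phi>)"
    unfolding laplacian_def[abs_def] by (intro continuous_on_sum Ck_on_2D(3)[OF smooth z0])
  then have "continuous_on (cball z0 r) (laplacian \<phi>)" using disc by (rule continuous_on_subset)
  then obtain p where p: "p \<in> cball z0 r" "\<And>z. z \<in> cball z0 r \<Longrightarrow> laplacian \<phi> p \<le> laplacian \<phi> z"
    using continuous_attains_inf[of "cball z0 r" "laplacian \<phi>"] r(1) by auto
  define c where "c = laplacian \<phi> p"
  have c: "c > 0" using p(1) disc pos by (auto simp: c_def)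
  define q where "q = exp (- M) * c * (pi * r\<^sup>2)"
  have q: "q > 0" using c r by (simp add: q_def)
  define \<epsilon> where "\<epsilon> = q / (2 * exp M)"
  have \<epsilon>: "\<epsilon> > 0" using q by (simp add: \<epsilon>_def)
  obtain \<eta> g where cut: "cutoff_on \<Omega> \<eta> g" "\<forall>z\<in>cball z0 r. \<eta> z = 1"
    and en: "(\<integral>\<^sup>+z. ennreal ((norm (g z))\<^sup>2) \<partial>lborel) \<le> ennreal \<epsilon>"
    using ex[OF \<epsilon>] by auto
  have "q \<le> exp M * \<epsilon>"
    unfolding q_def
  proof (rule caccioppoli[OF cut(1) assms(1) smooth M])
    show "\<And>z. z \<in> cball z0 r \<Longrightarrow> c \<le> laplacian \<phi> z" using p(2) by (simp only: c_def)
  qed (use pos disc cut(2) c r en \<epsilon> in auto)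
  also have "\<dots> = q / 2" by (simp add: \<epsilon>_def)
  finally show False using q by simp
qed

section \<open>Capacity zero forces the Bergman space to vanish\<close>

text \<open>The gradient \<open>g\<close>, read as a complex number, is twice the derivative of
  \<open>\<eta>\<close> with respect to the conjugate variable, and that derivative of
  \<open>h\<close> vanishes.\<close>

lemma integral_cutoff_holomorphic:
  assumes cut: "cutoff_on \<Omega> \<eta> g" and "open \<Omega>" and h: "h holomorphic_on \<Omega>"
  shows "integrable lborel (\<lambda>z. g z * h z)" "(LBINT z. g z * h z) = 0"
proof -
  have der: "(h has_derivative (\<lambda>v. deriv h z * v)) (at z)" if "z \<in> \<Omega>" for z
    using holomorphic_derivI[OF h \<open>open \<Omega>\<close> that] by (simp add: has_field_derivative_def)
  have cont: "continuous_on \<Omega> (\<lambda>z. deriv h z * v)" for v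
    by (intro continuous_intros holomorphic_on_imp_continuous_on holomorphic_deriv h \<open>open \<Omega>\<close>)
  note P = integral_cutoff_by_parts[where h' = "\<lambda>z v. deriv h z * v", OF cut \<open>open \<Omega>\<close> der cont]
  define a where "a v z = (v \<bullet> g z) *\<^sub>R h z + \<eta> z *\<^sub>R (deriv h z * v)" for v z
  have a: "integrable lborel (a v)" "integral\<^sup>L lborel (a v) = 0" for v
    unfolding a_def[abs_def] using P by blast+
  have "g z * h z = a 1 z + \<i> * a \<i> z" for z
  proof -
    have "g z = of_real (1 \<bullet> g z) + \<i> * of_real (\<i> \<bullet> g z)" by (simp add: complex_eq_iff inner_complex_def)
    then have "g z * h z = (of_real (1 \<bullet> g z) + \<i> * of_real (\<i> \<bullet> g z)) * h z" by simp
    also have "\<dots> = a 1 z + \<i> * a \<i> z"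
      by (simp add: a_def scaleR_conv_of_real algebra_simps)
    finally show ?thesis .
  qed
  then have eq: "(\<lambda>z. g z * h z) = (\<lambda>z. a 1 z + \<i> * a \<i> z)" by auto
  show "integrable lborel (\<lambda>z. g z * h z)" unfolding eq by (intro Bochner_Integration.integrable_add integrable_mult_right a)
  show "(LBINT z. g z * h z) = 0" unfolding eq using a by (simp add: Bochner_Integration.integral_add)
qed


text \<open>The Cauchy kernel \<open>1 / u\<close>, smoothed at the scale \<open>\<surd>t\<close>.\<close>

definition reg_cauchy :: "real \<Rightarrow> complex \<Rightarrow> complex" where
  "reg_cauchy t u = cnj u / of_real ((norm u)\<^sup>2 + t)"

text \<open>Twice the derivative of the kernel with respect to the conjugate variable is the Poisson-type
  bump \<open>2 t / (\<bar>u\<bar>\<^sup>2 + t)\<^sup>2\<close>, an approximation of \<open>2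
  \<pi>\<close> times a point mass.\<close>

lemma integral_cutoff_reg_cauchy:
  assumes cut: "cutoff_on \<Omega> \<eta> g" and "t > 0"
  shows "integrable lborel (\<lambda>z. g z * reg_cauchy t (z - z0) + of_real (\<eta> z * (2 * t / ((norm (z - z0))\<^sup>2 + t)\<^sup>2)))"
    "(LBINT z. g z * reg_cauchy t (z - z0) + of_real (\<eta> z * (2 * t / ((norm (z - z0))\<^sup>2 + t)\<^sup>2))) = 0"
proof -
  have pos: "(norm u)\<^sup>2 + t > 0" for u :: complex using assms(2) by (simp add: add_nonneg_pos)
  have cut': "cutoff_on UNIV \<eta> g" using cut by (simp add: cutoff_on_def)
  define k where "k z = reg_cauchy t (z - z0)" for z
  define s where "s z = (norm (z - z0))\<^sup>2 + t" for z
  define k' where "k' z v = inverse (s z) *\<^sub>R cnj v - (2 * (v \<bullet> (z - z0)) / (s z)\<^sup>2) *\<^sub>R cnj (z - z0)" for z v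
  have s: "s z > 0" for z unfolding s_def by (rule pos)
  have k: "k = (\<lambda>z. inverse (s z) *\<^sub>R cnj (z - z0))"
    by (auto simp: k_def reg_cauchy_def s_def scaleR_conv_of_real divide_inverse)
  have der: "(k has_derivative k' z) (at z)" for z
  proof -
    have "((\<lambda>z. (z - z0) \<bullet> (z - z0) + t) has_derivative (\<lambda>v. 2 * (v \<bullet> (z - z0)))) (at z)"
      by (auto intro!: derivative_eq_intros simp: inner_commute)
    then have ds: "(s has_derivative (\<lambda>v. 2 * (v \<bullet> (z - z0)))) (at z)"
      by (simp add: s_def[abs_def] power2_norm_eq_inner)
    have di: "((\<lambda>z. inverse (s z)) has_derivative (\<lambda>v. - (inverse (s z) * (2 * (v \<bullet> (z - z0))) * inverse (s z)))) (at z)"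
      by (rule Deriv.has_derivative_inverse[OF _ ds]) (use s[of z] in simp)
    have dc: "((\<lambda>z. cnj (z - z0)) has_derivative (\<lambda>v. cnj v)) (at z)"
      by (rule has_derivative_eq_rhs[OF bounded_linear.has_derivative[OF bounded_linear_cnj]]) (auto intro!: derivative_eq_intros)
    show ?thesis unfolding k
      by (rule has_derivative_eq_rhs[OF has_derivative_scaleR[OF di dc]])
        (simp add: k'_def fun_eq_iff power2_eq_square divide_inverse mult_ac)
  qed
  have cont: "continuous_on UNIV (\<lambda>z. k' z v)" for v
    unfolding k'_def s_def using pos by (intro continuous_intros) (auto simp: less_imp_neq[symmetric])
  define a where "a v z = (v \<bullet> g z) *\<^sub>R k z + \<eta> z *\<^sub>R k' z v" for v z
  have a: "integrable lborel (a v)" "integral\<^sup>L lborel (a v) = 0" for v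
    unfolding a_def[abs_def] using integral_cutoff_by_parts[where h' = k', OF cut' open_UNIV der cont] by blast+
  have eq: "g z * reg_cauchy t (z - z0) + of_real (\<eta> z * (2 * t / ((norm (z - z0))\<^sup>2 + t)\<^sup>2)) = a 1 z + \<i> * a \<i> z" for z
  proof -
    have "g z = of_real (1 \<bullet> g z) + \<i> * of_real (\<i> \<bullet> g z)" by (simp add: complex_eq_iff inner_complex_def)
    then have 1: "g z * k z = of_real (1 \<bullet> g z) * k z + \<i> * (of_real (\<i> \<bullet> g z) * k z)" by (metis distrib_right mult.assoc)
    define u where "u = z - z0"
    have nu: "(norm u)\<^sup>2 = (Re u)\<^sup>2 + (Im u)\<^sup>2" by (rule cmod_power2)
    have sz: "s z = (Re u)\<^sup>2 + (Im u)\<^sup>2 + t" by (simp add: s_def u_def[symmetric] nu)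
    have "k' z 1 + \<i> * k' z \<i> = of_real (2 / s z - 2 * ((Re u)\<^sup>2 + (Im u)\<^sup>2) / (s z)\<^sup>2)"
      unfolding k'_def u_def[symmetric]
      using s[of z] by (simp add: complex_eq_iff inner_complex_def power2_eq_square field_simps)
    also have "2 / s z - 2 * ((Re u)\<^sup>2 + (Im u)\<^sup>2) / (s z)\<^sup>2 = 2 * t / (s z)\<^sup>2"
    proof -
      have "2 / s z = 2 * s z / (s z)\<^sup>2" using s[of z] by (simp add: power2_eq_square)
      then have "2 / s z - 2 * ((Re u)\<^sup>2 + (Im u)\<^sup>2) / (s z)\<^sup>2 = (2 * s z - 2 * ((Re u)\<^sup>2 + (Im u)\<^sup>2)) / (s z)\<^sup>2"
        by (simp only: diff_divide_distrib)
      also have "2 * s z - 2 * ((Re u)\<^sup>2 + (Im u)\<^sup>2) = 2 * t" unfolding sz by simp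
      finally show ?thesis .
    qed
    finally have 2: "k' z 1 + \<i> * k' z \<i> = of_real (2 * t / (s z)\<^sup>2)" .
    have "a 1 z + \<i> * a \<i> z = g z * k z + of_real (\<eta> z) * (k' z 1 + \<i> * k' z \<i>)"
      unfolding 1 by (simp add: a_def scaleR_conv_of_real algebra_simps)
    also have "\<dots> = g z * k z + of_real (\<eta> z * (2 * t / (s z)\<^sup>2))" unfolding 2 by simp
    finally show ?thesis by (simp add: k_def s_def)
  qed
  show "integrable lborel (\<lambda>z. g z * reg_cauchy t (z - z0) + of_real (\<eta> z * (2 * t / ((norm (z - z0))\<^sup>2 + t)\<^sup>2)))"
    unfolding eq by (intro Bochner_Integration.integrable_add integrable_mult_right a)
  show "(LBINT z. g z * reg_cauchy t (z - z0) + of_real (\<eta> z * (2 * t / ((norm (z - z0))\<^sup>2 + t)\<^sup>2))) = 0"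
    unfolding eq using a by (simp add: Bochner_Integration.integral_add)
qed

lemma reg_cauchy_bound: "t > 0 \<Longrightarrow> 0 < r \<Longrightarrow> r \<le> norm u \<Longrightarrow> norm (reg_cauchy t u) \<le> 1 / r"
proof -
  assume *: "t > 0" "0 < r" "r \<le> norm u"
  have p: "0 < (norm u)\<^sup>2 + t" using * by (simp add: add_nonneg_pos)
  have "norm (reg_cauchy t u) = norm u / ((norm u)\<^sup>2 + t)"
    using p by (simp only: reg_cauchy_def norm_divide norm_of_real complex_mod_cnj abs_of_pos)
  also have "\<dots> \<le> 1 / r"
  proof -
    have "norm u * r \<le> norm u * norm u" using * by (intro mult_left_mono) auto
    also have "\<dots> \<le> (norm u)\<^sup>2 + t" using * by (simp add: power2_eq_square)
    finally show ?thesis using p * by (simp add: divide_simps mult_ac)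
  qed
  finally show ?thesis .
qed

text \<open>In the Cauchy formula for \<open>\<eta> f\<close> the kernel is bounded where the gradient of
  \<open>\<eta>\<close> lives, so \<open>f z0\<close> is controlled by the norm of
  \<open>f\<close> times the energy of \<open>\<eta>\<close>. Writing \<open>f z = f z0 + (z - z0)
  h z\<close> reduces the formula to a constant function, so that a lower bound for the integral
  of the bump suffices.\<close>

lemma zero_capacity_bergman_eq_0:
  assumes "open \<Omega>" "log_capacity (- \<Omega>) = 0" and f: "f \<in> bergman_space \<Omega>" and z0: "z0 \<in> \<Omega>"
  shows "f z0 = 0"
proof -
  have holo: "f holomorphic_on \<Omega>" and out: "\<And>z. z \<notin> \<Omega> \<Longrightarrow> f z = 0"
    and sq: "set_integrable lborel \<Omega> (\<lambda>z. (norm (f z))\<^sup>2)"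
    using f by (auto simp: bergman_space_def square_integrable_on_def)
  have sqf: "integrable lborel (\<lambda>z. (norm (f z))\<^sup>2)"
  proof -
    have "(\<lambda>z. indicator \<Omega> z *\<^sub>R (norm (f z))\<^sup>2) = (\<lambda>z. (norm (f z))\<^sup>2)"
    proof
      show "indicator \<Omega> z *\<^sub>R (norm (f z))\<^sup>2 = (norm (f z))\<^sup>2" for z
        by (cases "z \<in> \<Omega>") (simp_all add: out)
    qed
    then show ?thesis using sq by (simp add: set_integrable_def)
  qed
  define N where "N = integral\<^sup>L lborel (\<lambda>z. (norm (f z))\<^sup>2)"
  have N: "N \<ge> 0" unfolding N_def by simp
  have cl: "closed (- \<Omega>)" and nz: "z0 \<notin> - \<Omega>" using assms(1) z0 by auto
  obtain r where r: "r > 0" "cball z0 r \<inter> - \<Omega> = {}"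
    and ex: "\<And>\<epsilon>. \<epsilon> > 0 \<Longrightarrow> \<exists>\<eta> g. cutoff_on (- (- \<Omega>)) \<eta> g \<and> (\<forall>z. 0 \<le> \<eta> z) \<and> (\<forall>z\<in>cball z0 r. \<eta> z = 1)
       \<and> (\<integral>\<^sup>+z. ennreal ((norm (g z))\<^sup>2) \<partial>lborel) \<le> ennreal \<epsilon>"
    by (rule exists_cutoff_small_energy[OF cl assms(2) nz], rule that) assumption+
  define h where "h = (\<lambda>z. if z = z0 then deriv f z0 else (f z - f z0) / (z - z0))"
  have h: "h holomorphic_on \<Omega>" unfolding h_def by (rule pole_lemma_open[OF holo assms(1)])
  have fh: "f z = f z0 + (z - z0) * h z" for z by (simp add: h_def)
  have main: "norm (f z0) * (pi / 2) \<le> (1 + N) / (2 * r) * (1 / k)" if k: "k > 0" for k :: real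
  proof -
    obtain \<eta> g where cut: "cutoff_on \<Omega> \<eta> g" "\<forall>z. 0 \<le> \<eta> z" "\<forall>z\<in>cball z0 r. \<eta> z = 1"
      and en: "(\<integral>\<^sup>+z. ennreal ((norm (g z))\<^sup>2) \<partial>lborel) \<le> ennreal (1 / k\<^sup>2)"
      using ex[of "1 / k\<^sup>2"] k by auto
    note cD = cutoff_onD[OF cut(1)]
    have mg: "g \<in> borel_measurable borel" by (rule borel_measurable_continuous_onI[OF cD(2)])
    have g2: "integrable lborel (\<lambda>z. (norm (g z))\<^sup>2)" "integral\<^sup>L lborel (\<lambda>z. (norm (g z))\<^sup>2) \<le> 1 / k\<^sup>2"
    proof -
      show "integrable lborel (\<lambda>z. (norm (g z))\<^sup>2)"
        by (rule integrableI_nonneg) (use mg en in \<open>auto simp: top_unique intro: le_less_trans\<close>)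
      show "integral\<^sup>L lborel (\<lambda>z. (norm (g z))\<^sup>2) \<le> 1 / k\<^sup>2"
        using en by (subst integral_eq_nn_integral) (use mg in \<open>auto simp: enn2real_leI\<close>)
    qed
    have g0: "g z = 0" if "norm (z - z0) < r" for z
    proof -
      have "((\<lambda>_. 1) has_derivative (\<lambda>v. v \<bullet> g z)) (at z)"
      proof (rule has_derivative_transform_within_open[OF cD(1)])
        show "open (ball z0 r)" by simp
        show "z \<in> ball z0 r" using that by (simp add: dist_norm norm_minus_commute)
        show "\<eta> x = 1" if "x \<in> ball z0 r" for x using cut(3) that by auto
      qed
      then have "(\<lambda>v. v \<bullet> g z) = (\<lambda>v. 0)" by (rule has_derivative_unique) (rule has_derivative_const)
      from fun_cong[OF this, of "g z"] show "g z = 0" by simp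
    qed
    have gout: "g z = 0" if "z \<notin> \<Omega>" for z using cD(5)[of z] cD(6) that by blast
    have gh: "integrable lborel (\<lambda>z. g z * h z)" "(LBINT z. g z * h z) = 0"
      by (rule integral_cutoff_holomorphic[OF cut(1) assms(1) h])+
    define I where "I = (LBINT z. norm (g z * h z))"
    \<comment> \<open>The last summand comes from regularising the kernel and vanishes as \<open>t\<close> tends to 0 with the cutoff fixed.\<close>
    have step: "norm (f z0) * (pi / 2) \<le> (1 + N) / (2 * r) * (1 / k) + t / r\<^sup>2 * I" if t: "0 < t" "t \<le> r\<^sup>2" for t
    proof -
      define w where "w z = t / ((norm (z - z0))\<^sup>2 + t)" for z
      have p: "0 < (norm (z - z0))\<^sup>2 + t" for z using t by (simp add: add_nonneg_pos)
      have w: "0 \<le> w z" "w z \<le> 1" for z using p[of z] t by (auto simp: w_def)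
      have mw [measurable]: "w \<in> borel_measurable borel" unfolding w_def by measurable
      have ureg: "(z - z0) * reg_cauchy t (z - z0) = 1 - of_real (w z)" for z
      proof -
        have "(z - z0) * cnj (z - z0) = of_real ((norm (z - z0))\<^sup>2)" by (rule complex_norm_square[symmetric])
        then have "(z - z0) * reg_cauchy t (z - z0) = of_real ((norm (z - z0))\<^sup>2 / ((norm (z - z0))\<^sup>2 + t))"
          by (simp add: reg_cauchy_def)
        also have "(norm (z - z0))\<^sup>2 / ((norm (z - z0))\<^sup>2 + t) = 1 - w z" using p[of z] by (simp add: w_def field_simps)
        finally show ?thesis by simp
      qed
      have contreg: "continuous_on UNIV (\<lambda>z. reg_cauchy t (z - z0))"
        unfolding reg_cauchy_def using p
        by (intro continuous_intros) (auto simp flip: of_real_add of_real_power simp: less_imp_neq[symmetric])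
      have greg: "integrable lborel (\<lambda>z. g z * reg_cauchy t (z - z0))"
        by (rule integrable_continuous_bounded_support[OF _ bounded_closure[OF cD(7)]])
          (auto intro!: continuous_intros cD(2) contreg simp: cD(5))
      have gb: "\<bar>w z\<bar> * norm (g z * h z) \<le> t / r\<^sup>2 * norm (g z * h z)" for z
      proof (cases "norm (z - z0) < r")
        case False
        then have "r\<^sup>2 \<le> (norm (z - z0))\<^sup>2" using r by (intro power_mono) auto
        then have "r\<^sup>2 \<le> (norm (z - z0))\<^sup>2 + t" by (rule add_increasing2[rotated]) (use t in simp)
        then have "w z \<le> t / r\<^sup>2" unfolding w_def using t r by (intro divide_left_mono mult_pos_pos p) auto
        then show ?thesis using w[of z] by (intro mult_right_mono) auto
      qed (simp add: g0)
      have ghw: "integrable lborel (\<lambda>z. of_real (w z) * (g z * h z))"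
        by (rule Bochner_Integration.integrable_bound[OF gh(1)])
          (use gh(1) w in \<open>auto simp: norm_mult intro!: mult_left_le_one_le borel_measurable_times borel_measurable_integrable\<close>)
      define A where "A z = g z * (f z * reg_cauchy t (z - z0))" for z
      have A_eq: "A z = f z0 * (g z * reg_cauchy t (z - z0)) + (g z * h z - of_real (w z) * (g z * h z))" for z
      proof -
        have "A z = f z0 * (g z * reg_cauchy t (z - z0)) + g z * h z * ((z - z0) * reg_cauchy t (z - z0))"
          unfolding A_def by (subst fh[of z]) (simp add: algebra_simps)
        then show ?thesis unfolding ureg by (simp add: algebra_simps)
      qed
      have intA: "integrable lborel A" unfolding A_eq[abs_def]
        by (intro Bochner_Integration.integrable_add Bochner_Integration.integrable_diff integrable_mult_right greg gh ghw)
      have "integral\<^sup>L lborel A = f z0 * (LBINT z. g z * reg_cauchy t (z - z0)) - (LBINT z. of_real (w z) * (g z * h z))"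
        unfolding A_eq[abs_def] using greg gh ghw
        by (simp add: Bochner_Integration.integral_add Bochner_Integration.integral_diff integrable_mult_right)
      then have eq: "f z0 * (LBINT z. g z * reg_cauchy t (z - z0)) = integral\<^sup>L lborel A + (LBINT z. of_real (w z) * (g z * h z))"
        by simp
      have b2: "norm (LBINT z. of_real (w z) * (g z * h z)) \<le> t / r\<^sup>2 * I"
      proof -
        have "norm (LBINT z. of_real (w z) * (g z * h z)) \<le> (LBINT z. t / r\<^sup>2 * norm (g z * h z))"
          using gb by (intro Bochner_Integration.integral_norm_bound_integral ghw integrable_mult_right integrable_norm gh) (auto simp: norm_mult)
        then show ?thesis by (simp add: I_def)
      qed
      have b1: "norm (integral\<^sup>L lborel A) \<le> (1 + N) / (2 * r) * (1 / k)"
      proof -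
        have "norm (A z) \<le> k / (2 * r) * (norm (g z))\<^sup>2 + 1 / (2 * r * k) * (norm (f z))\<^sup>2" for z
        proof (cases "norm (z - z0) < r")
          case True
          then show ?thesis using g0[OF True] r k by (simp add: A_def)
        next
          case False
          have "norm (A z) = norm (g z) * norm (f z) * norm (reg_cauchy t (z - z0))" by (simp add: A_def norm_mult)
          also have "\<dots> \<le> norm (g z) * norm (f z) * (1 / r)"
            using False t r by (intro mult_left_mono reg_cauchy_bound) auto
          also have "norm (g z) * norm (f z) \<le> k / 2 * (norm (g z))\<^sup>2 + 1 / (2 * k) * (norm (f z))\<^sup>2"
          proof -
            have "0 \<le> (k * norm (g z) - norm (f z))\<^sup>2" by simp
            then have "2 * k * (norm (g z) * norm (f z)) \<le> k\<^sup>2 * (norm (g z))\<^sup>2 + (norm (f z))\<^sup>2"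
              by (simp add: power2_eq_square algebra_simps)
            then have "(2 * k * (norm (g z) * norm (f z))) / (2 * k) \<le> (k\<^sup>2 * (norm (g z))\<^sup>2 + (norm (f z))\<^sup>2) / (2 * k)"
              using k by (intro divide_right_mono) auto
            then show ?thesis using k by (simp add: add_divide_distrib power2_eq_square mult_ac)
          qed
          then have "norm (g z) * norm (f z) * (1 / r) \<le> (k / 2 * (norm (g z))\<^sup>2 + 1 / (2 * k) * (norm (f z))\<^sup>2) * (1 / r)"
            using r by (intro mult_right_mono) auto
          also have "\<dots> = k / (2 * r) * (norm (g z))\<^sup>2 + 1 / (2 * r * k) * (norm (f z))\<^sup>2"
            using r k by (simp add: field_simps)
          finally show ?thesis by simp
        qed
        then have "norm (integral\<^sup>L lborel A) \<le> (LBINT z. k / (2 * r) * (norm (g z))\<^sup>2 + 1 / (2 * r * k) * (norm (f z))\<^sup>2)"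
          by (intro Bochner_Integration.integral_norm_bound_integral intA Bochner_Integration.integrable_add integrable_mult_right g2 sqf)
        also have "\<dots> = k / (2 * r) * (LBINT z. (norm (g z))\<^sup>2) + 1 / (2 * r * k) * N"
          using g2 sqf by (simp add: Bochner_Integration.integral_add N_def)
        also have "\<dots> \<le> k / (2 * r) * (1 / k\<^sup>2) + 1 / (2 * r * k) * N"
          using r k g2 by (intro add_right_mono mult_left_mono) auto
        also have "\<dots> = (1 + N) / (2 * r) * (1 / k)" using r k by (simp add: field_simps power2_eq_square)
        finally show ?thesis .
      qed
      have b3: "pi / 2 \<le> norm (LBINT z. g z * reg_cauchy t (z - z0))"
      proof -
        define \<kappa> where "\<kappa> z = \<eta> z * (2 * t / ((norm (z - z0))\<^sup>2 + t)\<^sup>2)" for z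
        have i\<kappa>: "integrable lborel \<kappa>"
        proof (rule integrable_continuous_bounded_support[OF _ cD(7)])
          show "continuous_on UNIV \<kappa>" unfolding \<kappa>_def using p
            by (intro continuous_intros cD(3)) (auto simp: less_imp_neq[symmetric])
        qed (auto simp: \<kappa>_def)
        have "(LBINT z. g z * reg_cauchy t (z - z0) + of_real (\<kappa> z)) = 0"
          unfolding \<kappa>_def by (rule integral_cutoff_reg_cauchy(2)[OF cut(1) t(1)])
        moreover have "(LBINT z. g z * reg_cauchy t (z - z0) + of_real (\<kappa> z))
            = (LBINT z. g z * reg_cauchy t (z - z0)) + (LBINT z. of_real (\<kappa> z))"
          by (intro Bochner_Integration.integral_add greg integrable_of_real i\<kappa>)
        ultimately have "(LBINT z. g z * reg_cauchy t (z - z0)) + of_real (integral\<^sup>L lborel \<kappa>) = 0"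
          by simp
        then have "(LBINT z. g z * reg_cauchy t (z - z0)) = - of_real (integral\<^sup>L lborel \<kappa>)"
          by (simp add: add_eq_0_iff)
        then have "norm (LBINT z. g z * reg_cauchy t (z - z0)) = \<bar>integral\<^sup>L lborel \<kappa>\<bar>" by simp
        moreover have "(LBINT z. indicator (ball z0 (sqrt t)) z * (1 / (2 * t))) \<le> integral\<^sup>L lborel \<kappa>"
        proof (rule integral_mono)
          show "integrable lborel (\<lambda>z. indicator (ball z0 (sqrt t)) z * (1 / (2 * t)))"
            by (intro integrable_mult_left integrable_real_indicator emeasure_lborel_ball_finite) auto
          fix z
          show "indicator (ball z0 (sqrt t)) z * (1 / (2 * t)) \<le> \<kappa> z"
          proof (cases "z \<in> ball z0 (sqrt t)")
            case True
            then have n: "norm (z - z0) < sqrt t" by (simp add: dist_norm norm_minus_commute)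
            have "sqrt t \<le> r" using t r real_le_lsqrt by simp
            then have \<eta>1: "\<eta> z = 1" using cut(3) n by (simp add: dist_norm norm_minus_commute)
            have "(norm (z - z0))\<^sup>2 \<le> (sqrt t)\<^sup>2" using n by (intro power_mono) auto
            then have "(norm (z - z0))\<^sup>2 + t \<le> 2 * t" using t by simp
            then have "((norm (z - z0))\<^sup>2 + t)\<^sup>2 \<le> (2 * t)\<^sup>2" using p[of z] by (intro power_mono) auto
            then have "2 * t / (2 * t)\<^sup>2 \<le> 2 * t / ((norm (z - z0))\<^sup>2 + t)\<^sup>2"
              using t p[of z] by (intro divide_left_mono mult_pos_pos) auto
            then show ?thesis using True \<eta>1 t by (simp add: \<kappa>_def power2_eq_square)
          qed (use cut(2) t in \<open>simp add: \<kappa>_def\<close>)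
        qed (rule i\<kappa>)
        moreover have "(LBINT z. indicator (ball z0 (sqrt t)) z * (1 / (2 * t))) = pi / 2"
          using t content_ball[of "sqrt t" z0] by (simp add: unit_ball_vol_2)
        ultimately show ?thesis by simp
      qed
      have "norm (f z0) * (pi / 2) \<le> norm (f z0) * norm (LBINT z. g z * reg_cauchy t (z - z0))"
        by (intro mult_left_mono b3) auto
      also have "\<dots> = norm (integral\<^sup>L lborel A + (LBINT z. of_real (w z) * (g z * h z)))"
        by (simp only: eq[symmetric] norm_mult)
      also have "\<dots> \<le> norm (integral\<^sup>L lborel A) + norm (LBINT z. of_real (w z) * (g z * h z))"
        by (rule norm_triangle_ineq)
      also have "\<dots> \<le> (1 + N) / (2 * r) * (1 / k) + t / r\<^sup>2 * I" by (intro add_mono b1 b2)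
      finally show ?thesis .
    qed
    have lim: "((\<lambda>t. (1 + N) / (2 * r) * (1 / k) + t / r\<^sup>2 * I) \<longlongrightarrow> (1 + N) / (2 * r) * (1 / k) + 0 / r\<^sup>2 * I) (at_right 0)"
      by (intro tendsto_intros) (use r in auto)
    have ev: "\<forall>\<^sub>F t in at_right 0. norm (f z0) * (pi / 2) \<le> (1 + N) / (2 * r) * (1 / k) + t / r\<^sup>2 * I"
      unfolding eventually_at_right[OF zero_less_one] using step r by (intro exI[of _ "r\<^sup>2"]) auto
    show ?thesis using tendsto_lowerbound[OF lim ev] by simp
  qed
  have lim: "((\<lambda>l. (1 + N) / (2 * r) * (1 / l)) \<longlongrightarrow> (1 + N) / (2 * r) * 0) at_top"
    by (intro tendsto_intros tendsto_divide_0[OF tendsto_const] filterlim_at_top_imp_at_infinity filterlim_ident)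
  have "\<forall>\<^sub>F l in at_top. norm (f z0) * (pi / 2) \<le> (1 + N) / (2 * r) * (1 / l)"
    using eventually_gt_at_top[of 0] by eventually_elim (rule main)
  from tendsto_lowerbound[OF lim this] have "norm (f z0) * (pi / 2) \<le> 0" by simp
  then show "f z0 = 0" using pi_gt_zero by (simp add: mult_le_0_iff)
qed

section \<open>Positive capacity gives an infinite-dimensional Bergman space\<close>

text \<open>Expand \<open>1 / (z - w)\<close> in a geometric series in \<open>(z - z0) / (w - z0)\<close>.\<close>

lemma cauchy_transform_sums:
  fixes g :: "complex \<Rightarrow> complex"
  assumes "prob_space \<mu>" and sets [measurable_cong]: "sets \<mu> = sets borel"
    and [measurable]: "g \<in> borel_measurable borel" and gC: "\<And>w. norm (g w) \<le> C"
    and d: "d > 0" "\<And>w. g w \<noteq> 0 \<Longrightarrow> d \<le> norm (w - z0)" and z: "norm (z - z0) < d"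
  shows "(\<lambda>n. (LINT w|\<mu>. - (g w / (w - z0) ^ Suc n)) * (z - z0) ^ n) sums (LINT w|\<mu>. g w / (z - w))"
proof -
  interpret prob_space \<mu> by fact
  have C: "0 \<le> C" using order_trans[OF norm_ge_zero gC] .
  define f where "f n w = - (g w / (w - z0) ^ Suc n) * (z - z0) ^ n" for n w
  have [measurable]: "f n \<in> borel_measurable \<mu>" for n unfolding f_def by measurable
  define q where "q = norm (z - z0) / d"
  have q: "0 \<le> q" "q < 1" using d z by (auto simp: q_def)
  have fb: "norm (f n w) \<le> C / d * q ^ n" for n w
  proof (cases "g w = 0")
    case False
    have "d ^ Suc n \<le> norm (w - z0) ^ Suc n" using d False by (intro power_mono) auto
    then have "norm (f n w) \<le> C / d ^ Suc n * norm (z - z0) ^ n"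
      unfolding f_def norm_mult norm_minus_cancel norm_divide norm_power
      using gC[of w] d(1) C by (intro mult_right_mono frac_le) auto
    also have "\<dots> = C / d * q ^ n" by (simp add: q_def power_divide)
    finally show ?thesis .
  qed (use C d q in \<open>simp add: f_def\<close>)
  have fi: "integrable \<mu> (f n)" for n
    by (rule integrable_const_bound[where B = "C / d * q ^ n"], rule AE_I2, rule fb) measurable
  have geo: "summable (\<lambda>n. C / d * q ^ n)" using q by (intro summable_mult summable_geometric) auto
  have "(\<lambda>n. integral\<^sup>L \<mu> (f n)) sums (LINT w|\<mu>. (\<Sum>n. f n w))"
  proof (rule sums_integral[OF fi])
    show "AE w in \<mu>. summable (\<lambda>n. norm (f n w))"
      by (intro AE_I2 summable_comparison_test[OF _ geo] exI[of _ 0] allI impI) (simp only: real_norm_def abs_norm_cancel fb)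
    show "summable (\<lambda>n. LINT w|\<mu>. norm (f n w))"
    proof (rule summable_comparison_test[OF _ geo], intro exI[of _ 0] allI impI)
      fix n
      have "(LINT w|\<mu>. norm (f n w)) \<le> (LINT w|\<mu>. C / d * q ^ n)"
        by (intro integral_mono integrable_norm fi fb) auto
      then show "norm (LINT w|\<mu>. norm (f n w)) \<le> C / d * q ^ n" by (simp add: prob_space)
    qed
  qed
  moreover have "(\<Sum>n. f n w) = g w / (z - w)" for w
  proof (cases "g w = 0")
    case False
    have n1: "norm (w - z0) \<ge> d" by (rule d(2)[OF False])
    then have n2: "w \<noteq> z0" using d(1) by auto
    note n = n1 n2
    have "norm ((z - z0) / (w - z0)) < 1" using n z d by (simp add: norm_divide divide_less_eq)
    then have "(\<lambda>n. - (g w / (w - z0)) * ((z - z0) / (w - z0)) ^ n) sums (- (g w / (w - z0)) * (1 / (1 - (z - z0) / (w - z0))))"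
      by (intro sums_mult geometric_sums)
    moreover have "- (g w / (w - z0)) * ((z - z0) / (w - z0)) ^ n = f n w" for n
      by (simp add: f_def power_divide)
    moreover have "- (g w / (w - z0)) * (1 / (1 - (z - z0) / (w - z0))) = g w / (z - w)"
    proof -
      have "1 - (z - z0) / (w - z0) = (w - z) / (w - z0)" using n by (simp add: divide_simps)
      then have "- (g w / (w - z0)) * (1 / (1 - (z - z0) / (w - z0))) = - (g w / (w - z))" using n by simp
      then show ?thesis by (metis minus_diff_eq minus_divide_right)
    qed
    ultimately show ?thesis by (simp add: sums_iff)
  qed (simp add: f_def)
  moreover have "integral\<^sup>L \<mu> (f n) = (LINT w|\<mu>. - (g w / (w - z0) ^ Suc n)) * (z - z0) ^ n" for n
    unfolding f_def by (rule integral_mult_left_zero)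
  ultimately show ?thesis by (simp only:)
qed

lemma power_series_coeffs_unique:
  fixes z0 :: complex
  assumes "e > 0" "\<And>z. norm (z - z0) < e \<Longrightarrow> (\<lambda>n. a n * (z - z0) ^ n) sums F z"
    "\<And>z. norm (z - z0) < e \<Longrightarrow> (\<lambda>n. b n * (z - z0) ^ n) sums F z"
  shows "a = b"
proof (rule ccontr)
  assume "a \<noteq> b"
  then obtain m where m: "a m - b m \<noteq> 0" by (auto simp: fun_eq_iff)
  have s: "(\<lambda>n. (a n - b n) * (z - z0) ^ n) sums 0" if "norm (z - z0) < e" for z
    using sums_diff[OF assms(2,3)[OF that]] by (simp add: algebra_simps)
  show False
  proof (cases "m = 0")
    case True
    have "(\<lambda>n. (a n - b n) * 0 ^ n) sums 0" using s[of z0] assms(1) by simp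
    then have "a 0 - b 0 = 0" by (subst (asm) powser_sums_zero_iff)
    then show False using m True by simp
  next
    case False
    obtain s' where s': "0 < s'" "\<And>z. z \<in> cball z0 s' - {z0} \<Longrightarrow> (0::complex) \<noteq> 0"
      by (rule powser_0_nonzero[where f = "\<lambda>_. 0" and r = e and a = "\<lambda>n. a n - b n" and m = m and \<xi> = z0])
        (use s assms(1) False m in auto)
    have "z0 + of_real s' \<in> cball z0 s' - {z0}" using s'(1) by (auto simp: dist_norm)
    from s'(2)[OF this] show False by simp
  qed
qed

text \<open>Finitely many linear functionals have a common zero on an infinite-dimensional space.
  Divisibility by arbitrarily high powers keeps two solutions of the induction hypothesis
  independent, so that a combination of them kills one more functional.\<close>

lemma exists_poly_annihilated:
  fixes \<Phi> :: "'b \<Rightarrow> complex poly \<Rightarrow> complex"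
  assumes "finite B" and add: "\<And>b P Q. \<Phi> b (P + Q) = \<Phi> b P + \<Phi> b Q" and smult: "\<And>b c P. \<Phi> b (smult c P) = c * \<Phi> b P"
  shows "\<exists>P. P \<noteq> 0 \<and> monom 1 n dvd P \<and> (\<forall>b\<in>B. \<Phi> b P = 0)"
  using assms(1)
proof (induction B arbitrary: n rule: finite_induct)
  case empty
  show ?case by (intro exI[of _ "monom 1 n"]) (simp add: monom_eq_0_iff)
next
  case (insert b B)
  obtain P where P: "P \<noteq> 0" "monom 1 n dvd P" "\<forall>b\<in>B. \<Phi> b P = 0" using insert.IH[of n] by blast
  obtain Q where Q: "Q \<noteq> 0" "monom 1 (Suc (n + degree P)) dvd Q" "\<forall>b\<in>B. \<Phi> b Q = 0"
    using insert.IH[of "Suc (n + degree P)"] by blast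
  show ?case
  proof (cases "\<Phi> b P = 0")
    case True
    then show ?thesis using P by auto
  next
    case False
    define c where "c = - (\<Phi> b Q / \<Phi> b P)"
    have "degree (monom 1 (Suc (n + degree P)) :: complex poly) \<le> degree Q" by (rule dvd_imp_degree_le[OF Q(2,1)])
    then have deg: "degree P < degree Q" by (simp add: degree_monom_eq)
    have "Q + smult c P \<noteq> 0"
    proof
      assume "Q + smult c P = 0"
      then have "Q = - smult c P" by (rule eq_neg_iff_add_eq_0[THEN iffD2])
      then have "degree Q \<le> degree P" using degree_smult_le[of c P] by (simp only: degree_minus)
      then show False using deg by simp
    qed
    moreover have "monom 1 n dvd (monom 1 (Suc (n + degree P)) :: complex poly)"
      by (rule dvdI[of _ _ "monom 1 (Suc (degree P))"]) (simp add: mult_monom)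
    then have "monom 1 n dvd Q + smult c P" using Q(2) P(2) by (intro dvd_add dvd_smult) (auto intro: dvd_trans)
    moreover have "\<Phi> b' (Q + smult c P) = 0" if "b' \<in> insert b B" for b'
    proof -
      have "\<Phi> b' (Q + smult c P) = \<Phi> b' Q + c * \<Phi> b' P" by (simp only: add smult)
      then show ?thesis using that P(3) Q(3) False unfolding c_def by auto
    qed
    ultimately show ?thesis by blast
  qed
qed

text \<open>Exchange the order of integration and use the bound for a product of two Cauchy kernels.\<close>

lemma cauchy_transform_square_integrable_ball:
  assumes "prob_space \<mu>" and sets [measurable_cong]: "sets \<mu> = sets borel"
    and fin: "(\<integral>\<^sup>+z. \<integral>\<^sup>+w. neg_log z w \<partial>\<mu> \<partial>\<mu>) < \<infinity>"
    and K: "AE w in \<mu>. norm w < M" and M: "M \<ge> 1"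
  shows "(\<integral>\<^sup>+z. ennreal (indicator (ball 0 M) z) * (\<integral>\<^sup>+w. ennreal (cauchy_kernel 0 (z - w)) \<partial>\<mu>)\<^sup>2 \<partial>lborel) < \<infinity>"
proof -
  interpret prob_space \<mu> by fact
  interpret pair_sigma_finite lborel \<mu> by unfold_locales
  let ?k = "\<lambda>z w. ennreal (cauchy_kernel 0 (z - w))"
  let ?i = "\<lambda>z. ennreal (indicator (ball 0 M) (z::complex))"
  have mk [measurable]: "(\<lambda>x. ?k (f x) (g x)) \<in> borel_measurable N" if [measurable]: "f \<in> borel_measurable N" "g \<in> borel_measurable N" for f g and N :: "'z measure"
  proof -
    have "(\<lambda>x. f x - g x) \<in> borel_measurable N" by measurable
    then show ?thesis by (intro measurable_compose[OF _ measurable_ennreal] measurable_compose[OF _ cauchy_kernel_measurable])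
  qed
  have mi [measurable]: "?i \<in> borel_measurable borel"
    by (intro measurable_compose[OF _ measurable_ennreal] borel_measurable_indicator) simp
  have "(\<integral>\<^sup>+z. ?i z * (\<integral>\<^sup>+w. ?k z w \<partial>\<mu>)\<^sup>2 \<partial>lborel) = (\<integral>\<^sup>+z. \<integral>\<^sup>+w. \<integral>\<^sup>+v. ?i z * (?k z w * ?k z v) \<partial>\<mu> \<partial>\<mu> \<partial>lborel)"
    by (intro nn_integral_cong) (simp add: power2_eq_square nn_integral_cmult nn_integral_multc mult.assoc)
  also have "\<dots> = (\<integral>\<^sup>+w. \<integral>\<^sup>+z. \<integral>\<^sup>+v. ?i z * (?k z w * ?k z v) \<partial>\<mu> \<partial>lborel \<partial>\<mu>)"
    by (rule Fubini'[symmetric]) measurable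
  also have "\<dots> = (\<integral>\<^sup>+w. \<integral>\<^sup>+v. \<integral>\<^sup>+z. ?i z * (?k z w * ?k z v) \<partial>lborel \<partial>\<mu> \<partial>\<mu>)"
    by (intro nn_integral_cong Fubini'[symmetric]) measurable
  also have "\<dots> \<le> (\<integral>\<^sup>+w. \<integral>\<^sup>+v. ennreal (4 * pi) * (ennreal (1 + ln (4 * M)) + neg_log w v) \<partial>\<mu> \<partial>\<mu>)"
  proof (rule nn_integral_mono_AE, use K in eventually_elim, rule nn_integral_mono_AE, use K in eventually_elim)
    fix w v :: complex assume w: "norm w < M" "norm v < M"
    show "(\<integral>\<^sup>+z. ?i z * (?k z w * ?k z v) \<partial>lborel) \<le> ennreal (4 * pi) * (ennreal (1 + ln (4 * M)) + neg_log w v)"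
    proof (cases "w = v")
      case True
      then show ?thesis by (simp add: neg_log_eq ennreal_mult_top)
    next
      case False
      define \<rho> where "\<rho> = norm (w - v)"
      have \<rho>: "\<rho> > 0" "\<rho> \<le> 4 * M" using False norm_triangle_ineq4[of w v] w M by (auto simp: \<rho>_def)
      have "(\<integral>\<^sup>+z. ?i z * (?k z w * ?k z v) \<partial>lborel) = (\<integral>\<^sup>+z. ennreal (indicator (ball 0 M) z * (cauchy_kernel 0 (z - w) * cauchy_kernel 0 (z - v))) \<partial>lborel)"
        by (intro nn_integral_cong) (simp add: ennreal_mult' cauchy_kernel_nonneg)
      also have "\<dots> \<le> ennreal (4 * pi * (1 + ln (4 * M / \<rho>)))"
        using w \<rho> by (intro nn_integral_cauchy_kernel_product) (auto simp: \<rho>_def)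
      also have "ln (4 * M / \<rho>) = ln (4 * M) - ln \<rho>" using \<rho> M by (simp add: ln_div)
      also have "ennreal (4 * pi * (1 + (ln (4 * M) - ln \<rho>))) = ennreal (4 * pi) * ennreal ((1 + ln (4 * M)) + - ln \<rho>)"
        by (subst ennreal_mult'[symmetric]) (simp_all add: algebra_simps)
      also have "\<dots> \<le> ennreal (4 * pi) * (ennreal (1 + ln (4 * M)) + ennreal (- ln \<rho>))"
      proof (rule mult_left_mono)
        have "0 \<le> ln (4 * M)" using M by simp
        then have "ennreal ((1 + ln (4 * M)) + - ln \<rho>) \<le> ennreal ((1 + ln (4 * M)) + max 0 (- ln \<rho>))" by (intro ennreal_leI) simp
        also have "\<dots> = ennreal (1 + ln (4 * M)) + ennreal (max 0 (- ln \<rho>))" using \<open>0 \<le> ln (4 * M)\<close> by (intro ennreal_plus) auto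
        also have "ennreal (max 0 (- ln \<rho>)) = ennreal (- ln \<rho>)" by (simp add: max_def ennreal_neg)
        finally show "ennreal ((1 + ln (4 * M)) + - ln \<rho>) \<le> ennreal (1 + ln (4 * M)) + ennreal (- ln \<rho>)" .
      qed simp
      finally show ?thesis using False by (simp add: neg_log_eq \<rho>_def)
    qed
  qed
  also have "\<dots> = ennreal (4 * pi) * (ennreal (1 + ln (4 * M)) + (\<integral>\<^sup>+w. \<integral>\<^sup>+v. neg_log w v \<partial>\<mu> \<partial>\<mu>))"
    by (simp add: nn_integral_cmult nn_integral_add emeasure_space_1)
  also have "\<dots> < \<infinity>" using fin by (simp add: ennreal_mult_less_top)
  finally show ?thesis .
qed

lemma nn_integral_norm_power_minus_4:
  assumes "R > 0"
  shows "(\<integral>\<^sup>+z. ennreal (indicator {R..} (norm z) / norm z ^ 4) \<partial>(lborel :: complex measure)) < \<infinity>"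
proof -
  have "(\<integral>\<^sup>+z. ennreal (indicator {R..} (norm z) / norm z ^ 4) \<partial>(lborel :: complex measure))
      = (\<integral>\<^sup>+r. ennreal (2 * pi * r) * indicator {0<..} r * ennreal (indicator {R..} r / r ^ 4) \<partial>lborel)"
    by (rule nn_integral_radial) measurable
  also have "\<dots> = (\<integral>\<^sup>+r. ennreal (2 * pi / r ^ 3) * indicator {R..} r \<partial>lborel)"
  proof (rule nn_integral_cong)
    fix r :: real
    show "ennreal (2 * pi * r) * indicator {0<..} r * ennreal (indicator {R..} r / r ^ 4) = ennreal (2 * pi / r ^ 3) * indicator {R..} r"
      using assms by (cases "R \<le> r") (simp_all add: ennreal_mult'[symmetric] power3_eq_cube power4_eq_xxxx)
  qed
  also have "\<dots> = ennreal (0 - (- (pi / R\<^sup>2)))"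
  proof (rule nn_integral_FTC_atLeast)
    have "((\<lambda>r. pi / r\<^sup>2) \<longlongrightarrow> 0) at_top"
      by (intro tendsto_divide_0[OF tendsto_const] filterlim_at_top_imp_at_infinity filterlim_pow_at_top filterlim_ident) simp
    from tendsto_minus[OF this] show "((\<lambda>r. - (pi / r\<^sup>2)) \<longlongrightarrow> 0) at_top" by simp
    fix r assume "R \<le> r"
    then have "r > 0" using assms by simp
    then show "((\<lambda>r. - (pi / r\<^sup>2)) has_real_derivative 2 * pi / r ^ 3) (at r)"
      by (auto intro!: derivative_eq_intros simp: field_simps power2_eq_square power3_eq_cube)
    show "0 \<le> 2 * pi / r ^ 3" using \<open>r > 0\<close> by simp
  qed simp
  finally show ?thesis by simp
qed

text \<open>If finitely many functions spanned the space, some nonzero polynomial \<open>P\<close> would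
  annihilate the Taylor coefficients at \<open>z0\<close> of all its elements. For the Cauchy
  transform of \<open>g\<mu>\<close> these are the moments \<open>- \<integral> g
  q\<^sup>n\<^sup>+\<^sup>1 d\<mu>\<close> with \<open>q w = 1 / (w - z0)\<close>, so
  \<open>\<integral> g Q(q) d\<mu> = 0\<close> with \<open>Q = X P\<close>. Take for
  \<open>g\<close> the conjugate of \<open>Q(q)\<close> minus its mean: then \<open>Q(q)\<close>
  is almost everywhere constant.\<close>

lemma positive_capacity_bergman_infinite_dimensional:
  assumes "open \<Omega>" "\<Omega> \<noteq> {}" and cap: "log_capacity (- \<Omega>) > 0"
  shows "infinite_dimensional (bergman_space \<Omega>)"
proof -
  obtain \<mu> K where "prob_space \<mu>" and sets [measurable_cong]: "sets \<mu> = sets borel" and K: "compact K" "K \<subseteq> - \<Omega>" "AE z in \<mu>. z \<in> K"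
    and fin: "(\<integral>\<^sup>+z. \<integral>\<^sup>+w. neg_log z w \<partial>\<mu> \<partial>\<mu>) < \<infinity>"
    by (rule log_capacity_pos_imp_finite_energy[OF cap], rule that) assumption+
  interpret prob_space \<mu> by fact
  obtain z0 where z0: "z0 \<in> \<Omega>" using assms(2) by blast
  obtain d where d: "d > 0" "ball z0 d \<subseteq> \<Omega>" using assms(1) z0 by (meson open_contains_ball)
  have dK: "d \<le> norm (w - z)" if "w \<in> K" "ball z d \<subseteq> \<Omega>" for w z d
  proof (rule ccontr)
    assume "\<not> ?thesis"
    then have "w \<in> ball z d" by (simp add: dist_norm norm_minus_commute)
    then show False using that K(2) by blast
  qed
  have Kc: "K \<in> sets borel" by (rule borel_closed[OF compact_imp_closed[OF K(1)]])
  define q where "q w = (if w \<in> K then 1 / (w - z0) else 0)" for w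
  have mq [measurable]: "q \<in> borel_measurable borel"
    unfolding q_def using Kc by measurable
  have qb: "norm (q w) \<le> 1 / d" for w
    using dK[OF _ d(2), of w] d(1) by (auto simp: q_def norm_divide intro: frac_le)
  have mpoly: "(\<lambda>w. poly P (q w)) \<in> borel_measurable borel" for P
    by (rule borel_measurable_continuous_onI[THEN measurable_compose[OF mq]]) (intro continuous_intros)
  have bpoly: "\<exists>C. \<forall>w. norm (poly P (q w)) \<le> C" for P
  proof -
    have "compact (poly P ` cball 0 (1 / d))" by (intro compact_continuous_image continuous_intros) auto
    then obtain C where "\<forall>x\<in>poly P ` cball 0 (1 / d). norm x \<le> C" using compact_imp_bounded bounded_iff by metis
    then show ?thesis using qb by (intro exI[of _ C]) auto
  qed
  have nondeg: "\<not> (AE w in \<mu>. poly P (q w) = 0)" if "P \<noteq> 0" for P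
  proof
    assume "AE w in \<mu>. poly P (q w) = 0"
    moreover have "finite ((\<lambda>x. z0 + 1 / x) ` {x. poly P x = 0})" using poly_roots_finite[OF that] by simp
    then have "AE w in \<mu>. \<forall>a\<in>(\<lambda>x. z0 + 1 / x) ` {x. poly P x = 0}. w \<noteq> a"
      by (subst AE_ball_countable) (auto intro: countable_finite finite_energy_no_atoms[OF \<open>prob_space \<mu>\<close> sets fin])
    ultimately have "AE w in \<mu>. False" using K(3)
    proof eventually_elim
      case (elim w)
      have "w = z0 + 1 / q w" using elim(3) by (simp add: q_def)
      then show False using elim(1,2) by blast
    qed
    then show False by simp
  qed
  show ?thesis unfolding infinite_dimensional_def
  proof
    assume "\<exists>B. finite B \<and> B \<subseteq> bergman_space \<Omega> \<and> bergman_space \<Omega> \<subseteq> cfun.span B"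
    then obtain B where B: "finite B" "B \<subseteq> bergman_space \<Omega>" "bergman_space \<Omega> \<subseteq> cfun.span B" by blast
    define t where "t f n = (deriv ^^ n) f z0 / fact n" for f n
    define \<Phi> where "\<Phi> f P = (\<Sum>n\<le>degree P. coeff P n * t f n)" for f and P :: "complex poly"
    have \<Phi>: "\<Phi> f P = (\<Sum>n\<le>m. coeff P n * t f n)" if "degree P \<le> m" for f P m
      unfolding \<Phi>_def using that by (intro sum.mono_neutral_left) (auto simp: coeff_eq_0)
    have add: "\<Phi> f (P + Q) = \<Phi> f P + \<Phi> f Q" for f P Q
      using \<Phi>[of "P + Q" "max (degree P) (degree Q)" f] \<Phi>[of P "max (degree P) (degree Q)" f] \<Phi>[of Q "max (degree P) (degree Q)" f]
      by (simp add: degree_add_le_max sum.distrib algebra_simps)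
    have smult: "\<Phi> f (smult c P) = c * \<Phi> f P" for f c P
      using \<Phi>[of "smult c P" "degree P" f] degree_smult_le[of c P] by (simp add: \<Phi>_def sum_distrib_left mult.assoc)
    obtain P where P: "P \<noteq> 0" "\<forall>b\<in>B. \<Phi> b P = 0"
      using exists_poly_annihilated[of B \<Phi>, OF B(1) add smult] by blast
    define V where "V = {f. f holomorphic_on \<Omega> \<and> \<Phi> f P = 0}"
    have "cfun.subspace V"
    proof (rule cfun.subspaceI)
      have "t (0::complex \<Rightarrow> complex) n = 0" for n
        using higher_deriv_cmult[of "\<lambda>_. 0" \<Omega> z0 n 0] assms(1) z0 by (simp add: t_def zero_fun_def)
      then show "0 \<in> V" by (simp add: V_def \<Phi>_def zero_fun_def)
    next
      fix f g assume fg: "f \<in> V" "g \<in> V"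
      have "t (f + g) n = t f n + t g n" for n
        using fg higher_deriv_add[of f \<Omega> g z0 n] assms(1) z0 by (simp add: V_def t_def plus_fun_def add_divide_distrib)
      then have "\<Phi> (f + g) P = \<Phi> f P + \<Phi> g P" by (simp add: \<Phi>_def sum.distrib algebra_simps)
      then show "f + g \<in> V" using fg by (auto simp: V_def plus_fun_def intro: holomorphic_on_add)
    next
      fix c f assume f: "f \<in> V"
      have "t (cfun_scale c f) n = c * t f n" for n
        using f higher_deriv_cmult[of f \<Omega> z0 n c] assms(1) z0 by (simp add: V_def t_def cfun_scale_def)
      then have "\<Phi> (cfun_scale c f) P = c * \<Phi> f P" by (simp add: \<Phi>_def sum_distrib_left mult_ac)
      then show "cfun_scale c f \<in> V" using f by (auto simp: V_def cfun_scale_def intro: holomorphic_on_mult)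
    qed
    moreover have "B \<subseteq> V" using B(2) P(2) by (auto simp: V_def bergman_space_def)
    ultimately have "cfun.span B \<subseteq> V" by (intro cfun.span_minimal)
    with B(3) have sub: "bergman_space \<Omega> \<subseteq> V" by blast
    \<comment> \<open>The shift by one degree accounts for the exponent of \<open>q\<close> in the Taylor coefficients, and makes \<open>Q\<close> nonconstant.\<close>
    define Q where "Q = pCons 0 P"
    define m where "m = (LINT w|\<mu>. poly Q (q w))"
    define g where "g w = (if w \<in> K then cnj (poly Q (q w) - m) else 0)" for w
    obtain C where C: "\<And>w. norm (poly (Q - [:m:]) (q w)) \<le> C" using bpoly by blast
    have C0: "0 \<le> C" using order_trans[OF norm_ge_zero C] .
    have gC: "norm (g w) \<le> C" for w
    proof (cases "w \<in> K")
      case True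
      then have "norm (g w) = norm (poly (Q - [:m:]) (q w))" by (simp add: g_def flip: complex_cnj_diff)
      then show ?thesis using C by simp
    qed (simp add: g_def C0)
    have mc: "(\<lambda>w. cnj (poly Q (q w) - m)) \<in> borel_measurable borel"
      by (intro borel_measurable_continuous_onI[THEN measurable_compose[rotated], of cnj] borel_measurable_diff mpoly continuous_intros) simp
    then have mg [measurable]: "g \<in> borel_measurable borel"
      unfolding g_def using Kc by (intro measurable_If_set) auto
    have iQ: "integrable \<mu> (\<lambda>w. poly R (q w))" for R
    proof -
      obtain C where "\<And>w. norm (poly R (q w)) \<le> C" using bpoly by blast
      moreover have "(\<lambda>w. poly R (q w)) \<in> borel_measurable \<mu>" using mpoly[of R] by measurable
      ultimately show ?thesis by (intro integrable_const_bound[of _ C]) auto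
    qed
    have gAE: "AE w in \<mu>. g w = cnj (poly Q (q w) - m)"
      using K(3) by eventually_elim (simp add: g_def)
    have ig: "integrable \<mu> g" by (rule integrable_const_bound[of _ C]) (use gC in auto)
    have g0: "(LINT w|\<mu>. g w) = 0"
    proof -
      have "(LINT w|\<mu>. g w) = (LINT w|\<mu>. cnj (poly Q (q w) - m))"
      proof (rule integral_cong_AE)
        show "(\<lambda>w. cnj (poly Q (q w) - m)) \<in> borel_measurable \<mu>" using mc by measurable
      qed (use gAE in auto)
      also have "\<dots> = cnj (LINT w|\<mu>. poly Q (q w) - m)"
        by (rule integral_bounded_linear[OF bounded_linear_cnj]) (intro Bochner_Integration.integrable_diff iQ, simp)
      also have "(LINT w|\<mu>. poly Q (q w) - m) = 0"
        using iQ[of Q] by (simp add: m_def Bochner_Integration.integral_diff prob_space)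
      finally show ?thesis by simp
    qed
    define F where "F z = (if z \<in> \<Omega> then LINT w|\<mu>. g w / (z - w) else 0)" for z
    have gK: "w \<in> K" if "g w \<noteq> 0" for w using that by (auto simp: g_def split: if_splits)
    have series: "(\<lambda>n. (LINT w|\<mu>. - (g w / (w - a) ^ Suc n)) * (z - a) ^ n) sums F z"
      if "e > 0" "ball a e \<subseteq> \<Omega>" "norm (z - a) < e" for a e z
    proof -
      have "z \<in> \<Omega>" using that by (auto simp: dist_norm norm_minus_commute subset_iff)
      then show ?thesis unfolding F_def
        using cauchy_transform_sums[OF \<open>prob_space \<mu>\<close> sets mg gC that(1) _ that(3)] dK[OF gK that(2)] by simp
    qed
    have F_holo: "F holomorphic_on \<Omega>"
    proof -
      have "\<exists>F'. (F has_field_derivative F') (at a)" if "a \<in> \<Omega>" for a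
      proof -
        obtain e where e: "e > 0" "ball a e \<subseteq> \<Omega>" using assms(1) \<open>a \<in> \<Omega>\<close> by (meson open_contains_ball)
        have "F holomorphic_on ball a e"
          by (rule power_series_holomorphic, rule series[OF e]) (simp add: dist_norm norm_minus_commute)
        then show ?thesis using e(1) by (meson holomorphic_on_open open_ball centre_in_ball)
      qed
      then show ?thesis using assms(1) by (simp add: holomorphic_on_open)
    qed
    obtain R where R: "R \<ge> 1" "\<And>w. w \<in> K \<Longrightarrow> norm w \<le> R"
    proof -
      obtain b where "\<forall>z\<in>K. norm z \<le> b" using compact_imp_bounded[OF K(1)] by (auto simp: bounded_iff)
      then show ?thesis by (intro that[of "max 1 b"]) auto
    qed
    let ?I = "\<lambda>z. \<integral>\<^sup>+w. ennreal (cauchy_kernel 0 (z - w)) \<partial>\<mu>"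
    have near_bound: "ennreal ((norm (F z))\<^sup>2) \<le> ennreal (C\<^sup>2) * (?I z)\<^sup>2" for z
    proof (cases "z \<in> \<Omega>")
      case True
      have "ennreal (norm (F z)) \<le> (\<integral>\<^sup>+w. ennreal (norm (g w / (z - w))) \<partial>\<mu>)"
      proof (cases "integrable \<mu> (\<lambda>w. g w / (z - w))")
        case int: True
        show ?thesis using integral_norm_bound_ennreal[OF int] True by (simp add: F_def)
      qed (simp add: F_def True not_integrable_integral_eq)
      also have "\<dots> \<le> (\<integral>\<^sup>+w. ennreal C * ennreal (cauchy_kernel 0 (z - w)) \<partial>\<mu>)"
      proof (rule nn_integral_mono)
        fix w
        have "norm (g w / (z - w)) \<le> C * cauchy_kernel 0 (z - w)"
        proof -
          have "cauchy_kernel 0 (z - w) = 1 / norm (z - w)" by (simp add: cauchy_kernel_def power2_eq_square)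
          then show ?thesis using gC[of w] by (simp add: norm_divide divide_right_mono)
        qed
        then show "ennreal (norm (g w / (z - w))) \<le> ennreal C * ennreal (cauchy_kernel 0 (z - w))"
          using C0 by (subst ennreal_mult'[symmetric]) (auto intro: ennreal_leI)
      qed
      also have "\<dots> = ennreal C * ?I z"
      proof (rule nn_integral_cmult)
        have "(\<lambda>w. z - w) \<in> borel_measurable \<mu>" by measurable
        then show "(\<lambda>w. ennreal (cauchy_kernel 0 (z - w))) \<in> borel_measurable \<mu>"
          by (intro measurable_compose[OF _ measurable_ennreal] measurable_compose[OF _ cauchy_kernel_measurable])
      qed
      finally have "(ennreal (norm (F z)))\<^sup>2 \<le> (ennreal C * ?I z)\<^sup>2" by (intro power_mono) auto
      then show ?thesis using C0 by (simp add: power_mult_distrib ennreal_power)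
    qed (simp add: F_def)
    have far_bound: "(norm (F z))\<^sup>2 \<le> (2 * C * R)\<^sup>2 / norm z ^ 4" if "2 * R \<le> norm z" for z
    proof -
      have nz: "norm z > 0" using that R by linarith
      have "norm (F z) \<le> 2 * C * R / (norm z)\<^sup>2"
      proof (cases "z \<in> \<Omega>")
        case True
        have half: "norm z / 2 \<le> norm (z - w)" if "w \<in> K" for w
          using R(2)[OF that] \<open>2 * R \<le> norm z\<close> norm_triangle_ineq2[of z w] by linarith
        have b: "norm (g w * w / (z * (z - w))) \<le> 2 * C * R / (norm z)\<^sup>2" for w
        proof (cases "g w = 0")
          case False
          then have "w \<in> K" by (rule gK)
          then have "norm (g w * w / (z * (z - w))) \<le> C * R / (norm z * (norm z / 2))"
            unfolding norm_divide norm_mult using nz gC R half C0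
            by (intro frac_le mult_mono mult_left_mono) auto
          then show ?thesis by (simp add: power2_eq_square mult_ac)
        qed (use C0 R in simp)
        have i2: "integrable \<mu> (\<lambda>w. g w * w / (z * (z - w)))"
          by (rule integrable_const_bound[where B = "2 * C * R / (norm z)\<^sup>2"], rule AE_I2, rule b) measurable
        \<comment> \<open>The first summand integrates to 0, and the second decays quadratically.\<close>
        have eq: "g w / (z - w) = g w / z + g w * w / (z * (z - w))" for w
        proof (cases "g w = 0")
          case False
          then have "w \<in> K" by (rule gK)
          then have "z - w \<noteq> 0" using True K(2) by auto
          then show ?thesis using nz by (simp add: divide_simps) (simp add: algebra_simps)
        qed simp
        have "F z = (LINT w|\<mu>. g w / z) + (LINT w|\<mu>. g w * w / (z * (z - w)))"
          using True ig i2 unfolding F_def eq by (simp add: Bochner_Integration.integral_add)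
        also have "(LINT w|\<mu>. g w / z) = 0" using g0 by simp
        finally have "norm (F z) = norm (LINT w|\<mu>. g w * w / (z * (z - w)))" by simp
        also have "\<dots> \<le> (LINT w|\<mu>. norm (g w * w / (z * (z - w))))" by (rule integral_norm_bound)
        also have "\<dots> \<le> (LINT w|\<mu>. 2 * C * R / (norm z)\<^sup>2)"
          by (intro integral_mono integrable_norm i2 b) auto
        finally show ?thesis by (simp add: prob_space)
      qed (use C0 R in \<open>simp add: F_def\<close>)
      then have "(norm (F z))\<^sup>2 \<le> (2 * C * R / (norm z)\<^sup>2)\<^sup>2" by (intro power_mono) auto
      then show ?thesis by (simp add: power_divide power_mult[symmetric])
    qed
    have mF: "(\<lambda>z. indicator \<Omega> z *\<^sub>R F z) \<in> borel_measurable borel"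
      using borel_measurable_continuous_on_indicator[OF _ holomorphic_on_imp_continuous_on[OF F_holo]] assms(1) by simp
    have Find: "indicator \<Omega> z *\<^sub>R F z = F z" for z by (simp add: F_def indicator_def)
    then have mF' [measurable]: "F \<in> borel_measurable borel" using mF by simp
    have FL2: "F \<in> bergman_space \<Omega>"
    proof -
      have "(\<integral>\<^sup>+z. ennreal ((norm (F z))\<^sup>2) \<partial>lborel)
          \<le> (\<integral>\<^sup>+z. ennreal (C\<^sup>2) * (ennreal (indicator (ball 0 (2 * R)) z) * (?I z)\<^sup>2)
             + ennreal ((2 * C * R)\<^sup>2) * ennreal (indicator {2 * R..} (norm z) / norm z ^ 4) \<partial>lborel)"
      proof (rule nn_integral_mono)
        fix z :: complex
        show "ennreal ((norm (F z))\<^sup>2) \<le> ennreal (C\<^sup>2) * (ennreal (indicator (ball 0 (2 * R)) z) * (?I z)\<^sup>2)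
             + ennreal ((2 * C * R)\<^sup>2) * ennreal (indicator {2 * R..} (norm z) / norm z ^ 4)"
        proof (cases "norm z < 2 * R")
          case True
          then show ?thesis using near_bound[of z] by (simp add: add_increasing2)
        next
          case False
          then have "ennreal ((norm (F z))\<^sup>2) \<le> ennreal ((2 * C * R)\<^sup>2 * (1 / norm z ^ 4))"
            using far_bound[of z] by (intro ennreal_leI) simp
          also have "\<dots> = ennreal ((2 * C * R)\<^sup>2) * ennreal (1 / norm z ^ 4)" by (rule ennreal_mult') simp
          finally show ?thesis using False by simp
        qed
      qed
      also have "\<dots> = ennreal (C\<^sup>2) * (\<integral>\<^sup>+z. ennreal (indicator (ball 0 (2 * R)) z) * (?I z)\<^sup>2 \<partial>lborel)
          + ennreal ((2 * C * R)\<^sup>2) * (\<integral>\<^sup>+z. ennreal (indicator {2 * R..} (norm z) / norm z ^ 4) \<partial>(lborel :: complex measure))"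
      proof -
        have mk: "(\<lambda>x. ennreal (cauchy_kernel 0 (fst x - snd x))) \<in> borel_measurable (lborel \<Otimes>\<^sub>M \<mu>)"
          by (intro measurable_compose[OF _ measurable_ennreal] measurable_compose[OF _ cauchy_kernel_measurable]) measurable
        have mI: "?I \<in> borel_measurable lborel"
          using borel_measurable_nn_integral_fst[OF mk] by simp
        have mi: "(\<lambda>z::complex. ennreal (indicator (ball 0 (2 * R)) z)) \<in> borel_measurable lborel"
          by (intro measurable_compose[OF _ measurable_ennreal] borel_measurable_indicator) simp
        have m1: "(\<lambda>z. ennreal (indicator (ball 0 (2 * R)) z) * (?I z)\<^sup>2) \<in> borel_measurable lborel"
          using mi mI unfolding power2_eq_square by (intro borel_measurable_times_ennreal)
        have m2: "(\<lambda>z::complex. ennreal (indicator {2 * R..} (norm z) / norm z ^ 4)) \<in> borel_measurable lborel"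
          by measurable
        show ?thesis using m1 m2 by (simp add: nn_integral_add nn_integral_cmult)
      qed
      also have "\<dots> < \<infinity>"
      proof -
        have "AE w in \<mu>. norm w < 2 * R" using K(3) by eventually_elim (use R in fastforce)
        then have "(\<integral>\<^sup>+z. ennreal (indicator (ball 0 (2 * R)) z) * (?I z)\<^sup>2 \<partial>lborel) < \<infinity>"
          using R by (intro cauchy_transform_square_integrable_ball[OF \<open>prob_space \<mu>\<close> sets fin]) auto
        moreover have "(\<integral>\<^sup>+z. ennreal (indicator {2 * R..} (norm z) / norm z ^ 4) \<partial>(lborel :: complex measure)) < \<infinity>"
          using R by (intro nn_integral_norm_power_minus_4) auto
        ultimately show ?thesis by (simp add: ennreal_mult_less_top)
      qed
      finally have L2: "integrable lborel (\<lambda>z. (norm (F z))\<^sup>2)"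
        by (intro integrableI_nonneg) auto
      have "(\<lambda>z. indicator \<Omega> z *\<^sub>R (norm (F z))\<^sup>2) = (\<lambda>z. (norm (F z))\<^sup>2)"
      proof
        show "indicator \<Omega> z *\<^sub>R (norm (F z))\<^sup>2 = (norm (F z))\<^sup>2" for z by (simp add: F_def)
      qed
      then show ?thesis using F_holo mF L2
        by (simp add: bergman_space_def square_integrable_on_def set_borel_measurable_def set_integrable_def) (simp add: F_def)
    qed
    then have "\<Phi> F P = 0" using sub by (auto simp: V_def)
    moreover have tF: "t F n = - (LINT w|\<mu>. g w * q w ^ Suc n)" for n
    proof -
      have "t F = (\<lambda>n. LINT w|\<mu>. - (g w / (w - z0) ^ Suc n))"
      proof (rule power_series_coeffs_unique[OF d(1), of z0 _ F])
        fix z assume z: "norm (z - z0) < d"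
        show "(\<lambda>n. (LINT w|\<mu>. - (g w / (w - z0) ^ Suc n)) * (z - z0) ^ n) sums F z" by (rule series[OF d z])
        show "(\<lambda>n. t F n * (z - z0) ^ n) sums F z" unfolding t_def
          using z by (intro holomorphic_power_series[OF holomorphic_on_subset[OF F_holo d(2)]]) (simp add: dist_norm norm_minus_commute)
      qed
      then have "t F n = (LINT w|\<mu>. - (g w / (w - z0) ^ Suc n))" by simp
      also have "\<dots> = (LINT w|\<mu>. - (g w * q w ^ Suc n))"
      proof (intro Bochner_Integration.integral_cong refl)
        fix w show "- (g w / (w - z0) ^ Suc n) = - (g w * q w ^ Suc n)"
          using gK[of w] by (cases "g w = 0") (simp_all add: q_def power_one_over divide_inverse power_inverse del: power_Suc)
      qed
      finally show ?thesis by simp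
    qed
    ultimately have z: "(\<Sum>n\<le>degree P. coeff P n * (LINT w|\<mu>. g w * q w ^ Suc n)) = 0"
      by (simp add: \<Phi>_def sum_negf)
    have igq: "integrable \<mu> (\<lambda>w. g w * poly R (q w))" for R
    proof -
      obtain C' where C': "\<And>w. norm (poly R (q w)) \<le> C'" using bpoly by blast
      have "norm (g w * poly R (q w)) \<le> C * C'" for w
        unfolding norm_mult by (intro mult_mono gC C' C0) auto
      moreover have "(\<lambda>w. g w * poly R (q w)) \<in> borel_measurable \<mu>" using mpoly[of R] mg by measurable
      ultimately show ?thesis by (intro integrable_const_bound[of _ "C * C'"]) auto
    qed
    have "(LINT w|\<mu>. g w * poly Q (q w)) = 0"
    proof -
      have "(LINT w|\<mu>. g w * poly Q (q w)) = (LINT w|\<mu>. (\<Sum>n\<le>degree P. coeff P n * (g w * q w ^ Suc n)))"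
        by (intro Bochner_Integration.integral_cong refl) (simp add: Q_def poly_altdef[of P] sum_distrib_left mult_ac)
      also have "\<dots> = (\<Sum>n\<le>degree P. LINT w|\<mu>. coeff P n * (g w * q w ^ Suc n))"
      proof (rule Bochner_Integration.integral_sum)
        fix n
        show "integrable \<mu> (\<lambda>w. coeff P n * (g w * q w ^ Suc n))"
          using igq[of "monom 1 (Suc n)"] by (intro integrable_mult_right) (simp add: poly_monom del: power_Suc)
      qed
      also have "\<dots> = 0" using z by simp
      finally show ?thesis .
    qed
    then have "(LINT w|\<mu>. g w * poly (Q - [:m:]) (q w)) = 0"
      using igq[of Q] ig g0 by (simp add: algebra_simps Bochner_Integration.integral_diff)
    moreover have "(LINT w|\<mu>. g w * poly (Q - [:m:]) (q w)) = (LINT w|\<mu>. of_real ((norm (poly (Q - [:m:]) (q w)))\<^sup>2))"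
    proof (rule integral_cong_AE)
      show "(\<lambda>w. g w * poly (Q - [:m:]) (q w)) \<in> borel_measurable \<mu>"
        by (rule borel_measurable_integrable[OF igq])
      show "(\<lambda>w. complex_of_real ((norm (poly (Q - [:m:]) (q w)))\<^sup>2)) \<in> borel_measurable \<mu>"
        using mpoly[of "Q - [:m:]"] by measurable
      show "AE w in \<mu>. g w * poly (Q - [:m:]) (q w) = of_real ((norm (poly (Q - [:m:]) (q w)))\<^sup>2)"
      proof -
        have pm: "poly (Q - [:m:]) x = poly Q x - m" for x by simp
        show ?thesis using gAE by eventually_elim (simp only: pm complex_norm_square mult.commute)
      qed
    qed
    ultimately have int0: "(LINT w|\<mu>. (norm (poly (Q - [:m:]) (q w)))\<^sup>2) = 0"
      by (simp only: integral_complex_of_real of_real_eq_0_iff)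
    have "AE w in \<mu>. (norm (poly (Q - [:m:]) (q w)))\<^sup>2 = 0"
    proof (subst integral_nonneg_eq_0_iff_AE[symmetric])
      have "norm ((norm (poly (Q - [:m:]) (q w)))\<^sup>2) \<le> C\<^sup>2" for w
        using C[of w] by (simp add: power_mono)
      moreover have "(\<lambda>w. (norm (poly (Q - [:m:]) (q w)))\<^sup>2) \<in> borel_measurable \<mu>" using mpoly[of "Q - [:m:]"] by measurable
      ultimately show "integrable \<mu> (\<lambda>w. (norm (poly (Q - [:m:]) (q w)))\<^sup>2)" by (intro integrable_const_bound[of _ "C\<^sup>2"]) auto
    qed (use int0 in auto)
    then have "AE w in \<mu>. poly (Q - [:m:]) (q w) = 0" by eventually_elim simp
    moreover have "Q - [:m:] \<noteq> 0"
    proof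
      assume "Q - [:m:] = 0"
      then have "Q = [:m:]" by simp
      then show False using P(1) by (simp add: Q_def)
    qed
    ultimately show False using nondeg by blast
  qed
qed

section \<open>Positive capacity gives a bounded strictly subharmonic function\<close>

text \<open>Allows any formula for the derivative on \<open>S\<close> in place of the Frechet derivative
  chosen in the definition.\<close>

lemma Ck_on_SucI:
  assumes "open S" and d: "\<And>x. x \<in> S \<Longrightarrow> (f has_derivative f' x) (at x)"
    and C: "\<And>v. Ck_on k (\<lambda>x. f' x v) S"
  shows "Ck_on (Suc k) f S"
proof -
  have cong: "Ck_on k g S" if "Ck_on k h S" "\<And>x. x \<in> S \<Longrightarrow> h x = g x" for k and g h :: "'a \<Rightarrow> 'b"
    using that
  proof (induction k arbitrary: g h)
    case 0
    then show ?case by (auto cong: continuous_on_cong)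
  next
    case (Suc k)
    have dh: "h differentiable (at x)" if "x \<in> S" for x using Suc.prems(1) that by simp
    have "frechet_derivative h (at x) = frechet_derivative g (at x)" if "x \<in> S" for x
      by (rule frechet_derivative_transform_within_open[OF dh[OF that] assms(1) that Suc.prems(2)])
    then have "Ck_on k (\<lambda>x. frechet_derivative g (at x) v) S" for v
      using Suc.IH[of "\<lambda>x. frechet_derivative h (at x) v"] Suc.prems(1) by simp
    moreover have "g differentiable (at x)" if "x \<in> S" for x
    proof -
      note dx = dh[OF that] and xS = that
      obtain D where "(h has_derivative D) (at x)" using dx unfolding differentiable_def by blast
      then have "(g has_derivative D) (at x)"
        by (rule has_derivative_transform_within_open[where s = S]) (use assms(1) xS Suc.prems(2) in auto)
      then show ?thesis by (rule differentiableI)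
    qed
    ultimately show ?case by simp
  qed
  have "f' x = frechet_derivative f (at x)" if "x \<in> S" for x
    by (rule frechet_derivative_at[OF d[OF that]])
  then have "Ck_on k (\<lambda>x. frechet_derivative f (at x) v) S" for v
    by (intro cong[OF C[of v]]) simp
  moreover have "f differentiable (at x)" if "x \<in> S" for x using d[OF that] by (rule differentiableI)
  ultimately show ?thesis by simp
qed

lemma Ck_on_SucD:
  assumes "Ck_on (Suc k) f S"
  shows "x \<in> S \<Longrightarrow> (f has_derivative frechet_derivative f (at x)) (at x)"
    "Ck_on k (\<lambda>x. frechet_derivative f (at x) v) S"
  using assms by (auto simp: frechet_derivative_works[symmetric])

lemma Ck_on_Suc_imp: "Ck_on (Suc k) f S \<Longrightarrow> Ck_on k f S"
proof (induction k arbitrary: f)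
  case 0
  then show ?case
    by (auto intro!: continuous_at_imp_continuous_on differentiable_imp_continuous_within)
next
  case (Suc k)
  have "f differentiable (at x)" if "x \<in> S" for x using Suc.prems that by simp
  moreover have "Ck_on k (\<lambda>x. frechet_derivative f (at x) v) S" for v
    by (rule Suc.IH, rule Ck_on_SucD(2)[OF Suc.prems])
  ultimately show ?case by simp
qed

lemma Ck_on_const: "open S \<Longrightarrow> Ck_on k (\<lambda>x. c) S"
proof (induction k arbitrary: c)
  case (Suc k)
  show ?case by (rule Ck_on_SucI[where f' = "\<lambda>_ _. 0"]) (use Suc in auto)
qed simp

lemma Ck_on_add:
  assumes "open S" shows "Ck_on k f S \<Longrightarrow> Ck_on k g S \<Longrightarrow> Ck_on k (\<lambda>x. f x + g x) S"
proof (induction k arbitrary: f g)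
  case 0 then show ?case by (auto intro: continuous_on_add)
next
  case (Suc k)
  show ?case
    by (rule Ck_on_SucI[OF assms has_derivative_add[OF Ck_on_SucD(1)[OF Suc.prems(1)] Ck_on_SucD(1)[OF Suc.prems(2)]]])
      (auto intro: Suc.IH Ck_on_SucD(2)[OF Suc.prems(1)] Ck_on_SucD(2)[OF Suc.prems(2)])
qed

lemma Ck_on_mult:
  fixes f g :: "'a::real_normed_vector \<Rightarrow> real"
  assumes "open S" shows "Ck_on k f S \<Longrightarrow> Ck_on k g S \<Longrightarrow> Ck_on k (\<lambda>x. f x * g x) S"
proof (induction k arbitrary: f g)
  case 0 then show ?case by (auto intro: continuous_on_mult)
next
  case (Suc k)
  have "Ck_on k (\<lambda>x. f x * frechet_derivative g (at x) v + frechet_derivative f (at x) v * g x) S" for v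
    by (intro Ck_on_add[OF assms] Suc.IH Ck_on_SucD(2)[OF Suc.prems(1)] Ck_on_SucD(2)[OF Suc.prems(2)]
        Ck_on_Suc_imp[OF Suc.prems(1)] Ck_on_Suc_imp[OF Suc.prems(2)])
  then show ?case
    by (intro Ck_on_SucI[OF assms has_derivative_mult[OF Ck_on_SucD(1)[OF Suc.prems(1)] Ck_on_SucD(1)[OF Suc.prems(2)]]])
qed

lemma Ck_on_inner: "Ck_on k (\<lambda>z::complex. z \<bullet> v) UNIV"
proof (cases k)
  case (Suc j)
  show ?thesis unfolding Suc
    by (rule Ck_on_SucI[where f' = "\<lambda>_ w. w \<bullet> v"]) (auto intro!: derivative_eq_intros Ck_on_const)
qed (auto intro!: continuous_intros)

lemma has_derivative_norm_square_1:
  "((\<lambda>z::complex. (norm z)\<^sup>2 + 1) has_derivative (\<lambda>v. 2 * (z \<bullet> v))) (at z)"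
proof -
  have "((\<lambda>z. z \<bullet> z + 1) has_derivative (\<lambda>v. 2 * (z \<bullet> v))) (at z)"
    by (auto intro!: derivative_eq_intros simp: inner_commute)
  then show ?thesis by (simp add: power2_norm_eq_inner)
qed

lemma has_derivative_inverse_norm_square_1:
  "((\<lambda>z::complex. inverse ((norm z)\<^sup>2 + 1)) has_derivative
     (\<lambda>v. - 2 * ((z \<bullet> v) * (inverse ((norm z)\<^sup>2 + 1) * inverse ((norm z)\<^sup>2 + 1))))) (at z)"
proof -
  have "(norm z)\<^sup>2 + 1 \<noteq> 0" using zero_le_power2[of "norm z"] by linarith
  from Deriv.has_derivative_inverse[OF this has_derivative_norm_square_1]
  show ?thesis by (rule has_derivative_eq_rhs) (simp add: fun_eq_iff)
qed

text \<open>The derivative is a polynomial expression in the function itself and in linear functions, so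
  smoothness follows by induction.\<close>

lemma Ck_on_inverse_norm_square_1: "Ck_on k (\<lambda>z::complex. inverse ((norm z)\<^sup>2 + 1)) UNIV"
proof (induction k)
  case 0
  have "(norm z)\<^sup>2 + 1 \<noteq> 0" for z :: complex using zero_le_power2[of "norm z"] by linarith
  then show ?case by (auto intro!: continuous_intros)
next
  case (Suc k)
  have "Ck_on k (\<lambda>z::complex. - 2 * ((z \<bullet> v) * (inverse ((norm z)\<^sup>2 + 1) * inverse ((norm z)\<^sup>2 + 1)))) UNIV" for v
    by (intro Ck_on_mult Ck_on_const Ck_on_inner Suc open_UNIV)
  then show ?case by (intro Ck_on_SucI[OF open_UNIV has_derivative_inverse_norm_square_1])
qed

lemma Ck_on_subset: "Ck_on k f S \<Longrightarrow> T \<subseteq> S \<Longrightarrow> Ck_on k f T"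
  by (induction k arbitrary: f) (auto intro: continuous_on_subset)

lemma has_derivative_Re_holomorphic:
  assumes "h holomorphic_on S" "open S" "z \<in> S"
  shows "((\<lambda>z. Re (h z * c)) has_derivative (\<lambda>v. Re (deriv h z * (v * c)))) (at z)"
proof -
  have "(h has_derivative (\<lambda>v. deriv h z * v)) (at z)"
    using holomorphic_derivI[OF assms] by (simp add: has_field_derivative_def)
  then have "((\<lambda>z. h z * c) has_derivative (\<lambda>v. deriv h z * v * c)) (at z)" by (rule has_derivative_mult_left)
  from has_derivative_Re[OF this] show ?thesis by (simp add: mult.assoc)
qed

lemma Ck_on_Re_holomorphic: "open S \<Longrightarrow> h holomorphic_on S \<Longrightarrow> Ck_on k (\<lambda>z. Re (h z * c)) S"
proof (induction k arbitrary: h c)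
  case 0
  then show ?case by (auto intro!: continuous_intros holomorphic_on_imp_continuous_on)
next
  case (Suc k)
  have "Ck_on k (\<lambda>z. Re (deriv h z * (v * c))) S" for v
    using Suc by (intro Suc.IH holomorphic_deriv)
  then show ?case by (intro Ck_on_SucI[OF Suc.prems(1) has_derivative_Re_holomorphic[OF Suc.prems(2,1)]])
qed

text \<open>With \<open>s = (y - z0) / (z0 - w)\<close>, the increment of the logarithm is the real part of
  \<open>Ln (1 + s)\<close>, which differs from \<open>s\<close> by a quadratic error, uniformly
  in \<open>w\<close>.\<close>

lemma log_potential_derivative:
  assumes "prob_space \<nu>" and sets [measurable_cong]: "sets \<nu> = sets borel"
    and K: "compact K" "AE w in \<nu>. w \<in> K" and d: "d > 0" "\<And>w. w \<in> K \<Longrightarrow> d \<le> norm (w - z0)"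
  shows "((\<lambda>z. LINT w|\<nu>. ln (norm (z - w))) has_derivative (\<lambda>v. Re ((LINT w|\<nu>. indicator K w / (z0 - w)) * v))) (at z0)"
proof (rule has_derivative_quadratic_error[where r = "d / 2" and C = "2 / d\<^sup>2"])
  interpret prob_space \<nu> by fact
  have Kc [measurable]: "K \<in> sets borel" by (rule borel_closed[OF compact_imp_closed[OF K(1)]])
  obtain R where R: "R > 0" "\<And>w. w \<in> K \<Longrightarrow> norm w \<le> R"
    using compact_imp_bounded[OF K(1)] by (auto simp: bounded_pos)
  show "bounded_linear (\<lambda>v. Re ((LINT w|\<nu>. indicator K w / (z0 - w)) * v))"
    by (intro bounded_linear_compose[OF bounded_linear_Re] bounded_linear_mult_right)
  have il: "integrable \<nu> (\<lambda>w. ln (norm (z - w)))" if z: "dist z z0 < d / 2" for z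
  proof (rule integrable_const_bound[where B = "\<bar>ln (d / 2)\<bar> + \<bar>ln (norm z + R)\<bar>"])
    show "AE w in \<nu>. norm (ln (norm (z - w))) \<le> \<bar>ln (d / 2)\<bar> + \<bar>ln (norm z + R)\<bar>"
      using K(2)
    proof eventually_elim
      case (elim w)
      have "norm (w - z0) \<le> norm (z - w) + norm (z - z0)" using norm_triangle_ineq4[of "z - z0" "z - w"] by (simp add: algebra_simps)
      then have l: "d / 2 \<le> norm (z - w)" using d(2)[OF elim] z by (simp add: dist_norm)
      have u: "norm (z - w) \<le> norm z + R" using norm_triangle_ineq4[of z w] R(2)[OF elim] by linarith
      have "ln (d / 2) \<le> ln (norm (z - w))" "ln (norm (z - w)) \<le> ln (norm z + R)"
        using l u d(1) by (subst ln_le_cancel_iff; linarith)+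
      then show ?case by simp
    qed
  qed measurable
  have ic: "integrable \<nu> (\<lambda>w. indicator K w / (z0 - w))"
  proof (rule integrable_const_bound[where B = "1 / d"])
    show "AE w in \<nu>. norm (indicator K w / (z0 - w) :: complex) \<le> 1 / d"
      using K(2) by eventually_elim (use d in \<open>auto simp: norm_divide norm_minus_commute intro!: frac_le\<close>)
  qed measurable
  fix y assume y: "dist y z0 < d / 2"
  let ?D = "\<lambda>w. ln (norm (y - w)) - ln (norm (z0 - w)) - Re (indicator K w / (z0 - w) * (y - z0))"
  have iD: "integrable \<nu> ?D"
    using il[OF y] il[of z0] ic d(1) by (intro Bochner_Integration.integrable_diff integrable_Re integrable_mult_left) auto
  have "(LINT w|\<nu>. ?D w) = (LINT w|\<nu>. ln (norm (y - w))) - (LINT w|\<nu>. ln (norm (z0 - w)))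
      - Re ((LINT w|\<nu>. indicator K w / (z0 - w)) * (y - z0))"
  proof -
    have i: "integrable \<nu> (\<lambda>w. indicator K w / (z0 - w) * (y - z0))" using ic by (intro integrable_mult_left)
    have "(LINT w|\<nu>. Re (indicator K w / (z0 - w) * (y - z0))) = Re ((LINT w|\<nu>. indicator K w / (z0 - w)) * (y - z0))"
      by (subst integral_Re[OF i]) (simp only: integral_mult_left_zero)
    then show ?thesis using il[OF y] il[of z0] d(1) i
      by (simp add: Bochner_Integration.integral_diff Bochner_Integration.integrable_diff integrable_Re)
  qed
  moreover have "norm (LINT w|\<nu>. ?D w) \<le> 2 / d\<^sup>2 * (norm (y - z0))\<^sup>2"
  proof -
    have "norm (LINT w|\<nu>. ?D w) \<le> (LINT w|\<nu>. norm (?D w))" by (rule integral_norm_bound)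
    also have "\<dots> \<le> (LINT w|\<nu>. 2 / d\<^sup>2 * (norm (y - z0))\<^sup>2)"
    proof (rule integral_mono_AE[OF integrable_norm[OF iD]])
      show "AE w in \<nu>. norm (?D w) \<le> 2 / d\<^sup>2 * (norm (y - z0))\<^sup>2"
        using K(2)
      proof eventually_elim
        case (elim w)
        define s where "s = (y - z0) / (z0 - w)"
        have dw: "d \<le> norm (z0 - w)" using d(2)[OF elim] by (simp add: norm_minus_commute)
        have nz: "z0 - w \<noteq> 0" using dw d(1) by auto
        have s2: "norm s \<le> norm (y - z0) / d"
          unfolding s_def norm_divide using dw d(1) by (intro frac_le) auto
        also have "norm (y - z0) / d < 1 / 2" using y d(1) by (simp add: dist_norm field_simps)
        finally have s1: "norm s < 1 / 2" .
        note s = s1 s2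
        have "y - w = (z0 - w) * (1 + s)" using nz by (simp add: s_def field_simps)
        moreover have "1 + s \<noteq> 0"
        proof
          assume "1 + s = 0"
          then have "s = - 1" by (simp add: add_eq_0_iff)
          then show False using s1 by simp
        qed
        ultimately have "ln (norm (y - w)) = ln (norm (z0 - w)) + Re (Ln (1 + s))"
          using nz by (simp add: norm_mult ln_mult)
        then have "norm (?D w) = \<bar>Re (Ln (1 + s) - s)\<bar>" using elim by (simp add: s_def)
        also have "\<dots> \<le> norm (Ln (1 + s) - s)" by (rule abs_Re_le_cmod)
        also have "\<dots> \<le> (norm s)\<^sup>2 / (1 - norm s)" using s by (intro Ln_approx_linear) simp
        also have "\<dots> \<le> (norm s)\<^sup>2 / (1 / 2)" using s by (intro divide_left_mono) auto
        also have "\<dots> \<le> 2 * (norm (y - z0) / d)\<^sup>2" using power_mono[OF s(2), of 2] by simp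
        finally show ?case by (simp add: power_divide)
      qed
    qed simp
    finally show ?thesis by (simp add: prob_space)
  qed
  ultimately show "norm ((LINT w|\<nu>. ln (norm (y - w))) - (LINT w|\<nu>. ln (norm (z0 - w)))
      - Re ((LINT w|\<nu>. indicator K w / (z0 - w)) * (y - z0))) \<le> 2 / d\<^sup>2 * (norm (y - z0))\<^sup>2" by simp
qed (use d in simp)


text \<open>Restrict \<open>\<mu>\<close> to a set \<open>F\<close> of positive measure on which its
  potential is bounded. A point of \<open>\<Omega>\<close> is, up to a factor 3 in all distances
  to \<open>F\<close>, as good as an almost nearest point of \<open>F\<close>, so the bound
  extends to \<open>\<Omega>\<close>. The growth of \<open>2 p\<close> at infinity is the growth
  of \<open>ln (1 + \<bar>z\<bar>\<^sup>2)\<close>, and \<open>p\<close> is harmonic on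
  \<open>\<Omega>\<close>.\<close>

lemma positive_capacity_bounded_subharmonic:
  assumes "open \<Omega>" "\<Omega> \<noteq> {}" and cap: "log_capacity (- \<Omega>) > 0"
  shows "\<exists>\<phi> :: complex \<Rightarrow> real. bounded (\<phi> ` \<Omega>) \<and> \<phi> smooth_on \<Omega> \<and> (\<forall>z\<in>\<Omega>. laplacian \<phi> z > 0)"
proof -
  obtain \<mu> K where "prob_space \<mu>" and sets [measurable_cong]: "sets \<mu> = sets borel" and K: "compact K" "K \<subseteq> - \<Omega>" "AE z in \<mu>. z \<in> K"
    and fin: "(\<integral>\<^sup>+z. \<integral>\<^sup>+w. neg_log z w \<partial>\<mu> \<partial>\<mu>) < \<infinity>"
    by (rule log_capacity_pos_imp_finite_energy[OF cap], rule that) assumption+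
  interpret \<mu>: prob_space \<mu> by fact
  have Kc [measurable]: "K \<in> sets borel" by (rule borel_closed[OF compact_imp_closed[OF K(1)]])
  define B where "B z = (\<integral>\<^sup>+w. neg_log z w \<partial>\<mu>)" for z
  have mB [measurable]: "B \<in> borel_measurable borel" unfolding B_def by measurable
  define F where "F n = {z \<in> K. B z \<le> ennreal (real n)}" for n :: nat
  have mF [measurable]: "F n \<in> sets borel" for n unfolding F_def by measurable
  obtain n where n: "emeasure \<mu> (F n) \<noteq> 0"
  proof (rule ccontr)
    assume "\<not> thesis"
    then have "F n \<in> null_sets \<mu>" for n using that sets mF by (auto simp: null_sets_def)
    then have "AE z in \<mu>. \<forall>n. z \<notin> F n" by (subst AE_all_countable) (auto intro: AE_not_in)
    moreover have "AE z in \<mu>. B z \<noteq> \<infinity>"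
      by (rule nn_integral_PInf_AE) (use fin in \<open>auto simp: B_def[symmetric]\<close>)
    ultimately have "AE z in \<mu>. False" using K(3)
    proof eventually_elim
      case (elim z)
      obtain x where x: "B z = ennreal x" "x \<ge> 0" using elim(2) by (cases "B z") auto
      obtain n :: nat where "x \<le> real n" using real_arch_simple by blast
      then have "z \<in> F n" using x elim(3) by (simp add: F_def ennreal_leI)
      then show False using elim(1) by blast
    qed
    then show False by simp
  qed
  define c where "c = emeasure \<mu> (F n)"
  have c: "c \<noteq> 0" "c \<noteq> \<infinity>" using n \<mu>.emeasure_finite by (auto simp: c_def)
  define \<nu> where "\<nu> = uniform_measure \<mu> (F n)"
  have sets\<nu> [measurable_cong]: "sets \<nu> = sets borel" using sets by (simp add: \<nu>_def)
  have "prob_space \<nu>" unfolding \<nu>_def by (rule prob_space_uniform_measure) (use c in \<open>auto simp: c_def\<close>)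
  then interpret \<nu>: prob_space \<nu> .
  have AEF: "AE w in \<nu>. w \<in> F n"
    unfolding \<nu>_def by (rule AE_uniform_measureI) (use sets mF in auto)
  have AEK: "AE w in \<nu>. w \<in> K" using AEF by eventually_elim (simp add: F_def)
  define m where "m = enn2real (ennreal (real n) / c)"
  have m: "ennreal m = ennreal (real n) / c"
    unfolding m_def using c by (intro ennreal_enn2real) (auto simp: ennreal_divide_eq_top_iff less_top[symmetric])
  have m0: "0 \<le> m" by (simp add: m_def)
  have pot: "(\<integral>\<^sup>+w. neg_log z w \<partial>\<nu>) \<le> ennreal m" if "z \<in> F n" for z
  proof -
    have "(\<integral>\<^sup>+w. neg_log z w \<partial>\<nu>) = (\<integral>\<^sup>+w. neg_log z w * indicator (F n) w \<partial>\<mu>) / c"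
      unfolding \<nu>_def c_def by (rule nn_integral_uniform_measure) (use sets mF in auto)
    also have "\<dots> \<le> B z / c"
      unfolding B_def by (intro divide_right_mono_ennreal nn_integral_mono) (simp add: indicator_def)
    also have "\<dots> \<le> ennreal (real n) / c" using that by (intro divide_right_mono_ennreal) (simp add: F_def)
    finally show ?thesis by (simp add: m)
  qed
  define p where "p z = (LINT w|\<nu>. ln (norm (z - w)))" for z
  define f where "f z = (LINT w|\<nu>. indicator K w / (z - w))" for z
  have dK: "e \<le> norm (w - a)" if "w \<in> K" "ball a e \<subseteq> \<Omega>" for w a e
  proof (rule ccontr)
    assume "\<not> ?thesis"
    then have "w \<in> ball a e" by (simp add: dist_norm norm_minus_commute)
    then show False using that K(2) by blast
  qed
  have dp: "(p has_derivative (\<lambda>v. Re (f a * v))) (at a)" if "a \<in> \<Omega>" for a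
  proof -
    obtain e where e: "e > 0" "ball a e \<subseteq> \<Omega>" using assms(1) \<open>a \<in> \<Omega>\<close> by (meson open_contains_ball)
    show ?thesis unfolding p_def[abs_def] f_def
      by (rule log_potential_derivative[OF \<open>prob_space \<nu>\<close> sets\<nu> K(1) AEK e(1)]) (rule dK[OF _ e(2)])
  qed
  have f_holo: "f holomorphic_on \<Omega>"
  proof -
    have "\<exists>f'. (f has_field_derivative f') (at a)" if "a \<in> \<Omega>" for a
    proof -
      obtain e where e: "e > 0" "ball a e \<subseteq> \<Omega>" using assms(1) \<open>a \<in> \<Omega>\<close> by (meson open_contains_ball)
      have "f holomorphic_on ball a e"
      proof (rule power_series_holomorphic)
        fix z assume z: "z \<in> ball a e"
        show "(\<lambda>n. (LINT w|\<nu>. - (indicator K w / (w - a) ^ Suc n)) * (z - a) ^ n) sums f z"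
          unfolding f_def
        proof (rule cauchy_transform_sums[OF \<open>prob_space \<nu>\<close> sets\<nu> _ _ e(1)])
          show "(indicator K :: complex \<Rightarrow> complex) \<in> borel_measurable borel" by measurable
          show "norm (indicator K w :: complex) \<le> 1" for w by (simp add: indicator_def)
          show "e \<le> norm (w - a)" if "(indicator K w :: complex) \<noteq> 0" for w
            using that by (intro dK[OF _ e(2)]) (simp add: indicator_def split: if_splits)
          show "norm (z - a) < e" using z by (simp add: dist_norm norm_minus_commute)
        qed
      qed
      then show ?thesis using e(1) by (meson holomorphic_on_open open_ball centre_in_ball)
    qed
    then show ?thesis using assms(1) by (simp add: holomorphic_on_open)
  qed
  define q where "q z = inverse ((norm z)\<^sup>2 + 1)" for z :: complex
  define \<phi> where "\<phi> z = ln ((norm z)\<^sup>2 + 1) - 2 * p z" for z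
  define \<phi>' where "\<phi>' z v = 2 * ((z \<bullet> v) * q z) + Re (f z * (- 2 * v))" for z v
  have q_pos: "0 < (norm z)\<^sup>2 + 1" for z :: complex by (simp add: add_nonneg_pos)
  have d\<phi>: "(\<phi> has_derivative \<phi>' z) (at z)" if "z \<in> \<Omega>" for z
  proof -
    have "((\<lambda>z. ln ((norm z)\<^sup>2 + 1)) has_derivative (\<lambda>v. 2 * (z \<bullet> v) * inverse ((norm z)\<^sup>2 + 1))) (at z)"
      using has_derivative_ln[OF q_pos has_derivative_norm_square_1, of z] by simp
    from has_derivative_diff[OF this has_derivative_mult_right[OF dp[OF that], of 2]]
    show ?thesis unfolding \<phi>_def[abs_def]
      by (rule has_derivative_eq_rhs) (simp add: \<phi>'_def q_def fun_eq_iff)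
  qed
  have smooth: "\<phi> smooth_on \<Omega>"
    unfolding smooth_on_def
  proof
    fix k
    have "Ck_on (Suc k) \<phi> \<Omega>"
    proof (rule Ck_on_SucI[OF assms(1) d\<phi>])
      show "Ck_on k (\<lambda>z. \<phi>' z v) \<Omega>" for v
        unfolding \<phi>'_def q_def
        by (intro Ck_on_add[OF assms(1)] Ck_on_Re_holomorphic[OF assms(1) f_holo] Ck_on_mult[OF assms(1)] Ck_on_const[OF assms(1)]
            Ck_on_subset[OF Ck_on_inner subset_UNIV] Ck_on_subset[OF Ck_on_inverse_norm_square_1 subset_UNIV])
    qed
    then show "Ck_on k \<phi> \<Omega>" by (rule Ck_on_Suc_imp)
  qed
  have lap: "laplacian \<phi> z > 0" if z: "z \<in> \<Omega>" for z
  proof -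
    have fd: "frechet_derivative \<phi> (at y) v = \<phi>' y v" if "y \<in> \<Omega>" for y v
      using frechet_derivative_at[OF d\<phi>[OF that]] by simp
    have second: "frechet_derivative (\<lambda>y. frechet_derivative \<phi> (at y) v) (at z) v
        = 2 * ((v \<bullet> v) * q z) - 4 * ((z \<bullet> v)\<^sup>2 * (q z)\<^sup>2) + Re (deriv f z * (v * (- 2 * v)))" for v
    proof -
      have "((\<lambda>y. \<phi>' y v) has_derivative (\<lambda>w. 2 * ((z \<bullet> v) * (- 2 * ((z \<bullet> w) * (q z * q z))) + (w \<bullet> v) * q z)
          + Re (deriv f z * (w * (- 2 * v))))) (at z)"
      proof -
        have dq: "(q has_derivative (\<lambda>w. - 2 * ((z \<bullet> w) * (q z * q z)))) (at z)"
          unfolding q_def[abs_def] by (rule has_derivative_inverse_norm_square_1)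
        have di: "((\<lambda>y. y \<bullet> v) has_derivative (\<lambda>w. w \<bullet> v)) (at z)" by (auto intro!: derivative_eq_intros)
        show ?thesis unfolding \<phi>'_def
          by (rule has_derivative_add[OF has_derivative_mult_right[OF has_derivative_mult[OF di dq]] has_derivative_Re_holomorphic[OF f_holo assms(1) z]])
      qed
      then have "((\<lambda>y. frechet_derivative \<phi> (at y) v) has_derivative (\<lambda>w. 2 * ((z \<bullet> v) * (- 2 * ((z \<bullet> w) * (q z * q z))) + (w \<bullet> v) * q z)
          + Re (deriv f z * (w * (- 2 * v))))) (at z)"
        by (rule has_derivative_transform_within_open[where s = \<Omega>]) (use assms(1) z fd in auto)
      from frechet_derivative_at[OF this, symmetric] show ?thesis by (simp add: power2_eq_square algebra_simps)
    qed
    have "laplacian \<phi> z = 4 * q z - 4 * (((z \<bullet> 1)\<^sup>2 + (z \<bullet> \<i>)\<^sup>2) * (q z)\<^sup>2)"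
      unfolding laplacian_def complex_basis_sum second by (simp add: algebra_simps)
    also have "(z \<bullet> 1)\<^sup>2 + (z \<bullet> \<i>)\<^sup>2 = (norm z)\<^sup>2" by (simp add: cmod_power2 inner_complex_def)
    also have "4 * q z - 4 * ((norm z)\<^sup>2 * (q z)\<^sup>2) = 4 * (q z)\<^sup>2"
    proof -
      have "q z = ((norm z)\<^sup>2 + 1) * (q z)\<^sup>2" using q_pos[of z] by (simp add: q_def power2_eq_square)
      then show ?thesis by (simp add: algebra_simps)
    qed
    also have "\<dots> > 0" using q_pos[of z] by (simp add: q_def)
    finally show ?thesis .
  qed
  obtain R where R: "R \<ge> 1" "\<And>w. w \<in> K \<Longrightarrow> norm w \<le> R"
  proof -
    obtain b where "\<forall>z\<in>K. norm z \<le> b" using compact_imp_bounded[OF K(1)] by (auto simp: bounded_iff)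
    then show ?thesis by (intro that[of "max 1 b"]) auto
  qed
  have ip: "integrable \<nu> (\<lambda>w. ln (norm (z - w)))" if z: "z \<in> \<Omega>" for z
  proof -
    obtain e where e: "e > 0" "ball z e \<subseteq> \<Omega>" using assms(1) z by (meson open_contains_ball)
    show ?thesis
    proof (rule \<nu>.integrable_const_bound[where B = "\<bar>ln e\<bar> + \<bar>ln (norm z + R)\<bar>"])
      show "AE w in \<nu>. norm (ln (norm (z - w))) \<le> \<bar>ln e\<bar> + \<bar>ln (norm z + R)\<bar>"
        using AEK
      proof eventually_elim
        case (elim w)
        have l: "e \<le> norm (z - w)" using dK[OF elim e(2)] by (simp add: norm_minus_commute)
        have u: "norm (z - w) \<le> norm z + R" using norm_triangle_ineq4[of z w] R(2)[OF elim] by linarith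
        have "ln e \<le> ln (norm (z - w))" "ln (norm (z - w)) \<le> ln (norm z + R)"
          using l u e(1) by (subst ln_le_cancel_iff; linarith)+
        then show ?case by simp
      qed
    qed measurable
  qed
  have p_le: "p z \<le> C" if "z \<in> \<Omega>" "\<And>w. w \<in> K \<Longrightarrow> ln (norm (z - w)) \<le> C" for z C
  proof -
    have "p z \<le> (LINT w|\<nu>. C)" unfolding p_def
      by (intro integral_mono_AE ip that(1)) (use AEK in \<open>auto elim!: eventually_mono intro: that(2)\<close>)
    then show ?thesis by (simp add: \<nu>.prob_space)
  qed
  have p_ge: "C \<le> p z" if "z \<in> \<Omega>" "\<And>w. w \<in> K \<Longrightarrow> C \<le> ln (norm (z - w))" for z C
  proof -
    have "(LINT w|\<nu>. C) \<le> p z" unfolding p_def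
      by (intro integral_mono_AE ip that(1)) (use AEK in \<open>auto elim!: eventually_mono intro: that(2)\<close>)
    then show ?thesis by (simp add: \<nu>.prob_space)
  qed
  have nK: "norm (z - w) > 0" if "z \<in> \<Omega>" "w \<in> K" for z w using that K(2) by auto
  have lower: "- ln (2 * R\<^sup>2) \<le> \<phi> z" if z: "z \<in> \<Omega>" for z
  proof -
    have "p z \<le> (ln (2 * R\<^sup>2) + ln ((norm z)\<^sup>2 + 1)) / 2"
    proof (rule p_le[OF z])
      fix w assume w: "w \<in> K"
      have "norm (z - w) \<le> norm z + R" using norm_triangle_ineq4[of z w] R(2)[OF w] by linarith
      then have "(norm (z - w))\<^sup>2 \<le> (norm z + R)\<^sup>2" by (intro power_mono) auto
      also have "\<dots> \<le> 2 * (norm z)\<^sup>2 + 2 * R\<^sup>2" using sum_squares_bound[of "norm z" R] by (simp add: power2_sum)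
      also have "\<dots> \<le> 2 * R\<^sup>2 * ((norm z)\<^sup>2 + 1)"
      proof -
        have "1 \<le> R\<^sup>2" using R(1) by (simp add: one_le_power)
        from mult_right_mono[OF this, of "(norm z)\<^sup>2"] show ?thesis by (simp add: algebra_simps)
      qed
      finally have "ln ((norm (z - w))\<^sup>2) \<le> ln (2 * R\<^sup>2 * ((norm z)\<^sup>2 + 1))"
        using nK[OF z w] q_pos[of z] R(1) by (subst ln_le_cancel_iff) auto
      also have "\<dots> = ln (2 * R\<^sup>2) + ln ((norm z)\<^sup>2 + 1)" using R(1) q_pos[of z] by (intro ln_mult_pos) auto
      also have "ln ((norm (z - w))\<^sup>2) = 2 * ln (norm (z - w))" using ln_realpow[of "norm (z - w)" 2] by simp
      finally show "ln (norm (z - w)) \<le> (ln (2 * R\<^sup>2) + ln ((norm z)\<^sup>2 + 1)) / 2" by simp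
    qed
    then show ?thesis by (simp add: \<phi>_def)
  qed
  have far: "\<phi> z \<le> ln 8" if z: "z \<in> \<Omega>" "2 * R \<le> norm z" for z
  proof -
    have nz: "1 \<le> norm z" using z(2) R(1) by linarith
    have "(ln ((norm z)\<^sup>2 + 1) - ln 8) / 2 \<le> p z"
    proof (rule p_ge[OF z(1)])
      fix w assume w: "w \<in> K"
      have "norm z \<le> 2 * norm (z - w)"
        using R(2)[OF w] z(2) norm_triangle_ineq2[of z w] by linarith
      then have "(norm z)\<^sup>2 \<le> (2 * norm (z - w))\<^sup>2" by (intro power_mono) auto
      moreover have "1 \<le> (norm z)\<^sup>2" using nz by (simp add: one_le_power)
      ultimately have "(norm z)\<^sup>2 + 1 \<le> 8 * (norm (z - w))\<^sup>2" by (simp add: power_mult_distrib)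
      then have "ln ((norm z)\<^sup>2 + 1) \<le> ln (8 * (norm (z - w))\<^sup>2)"
        using nK[OF z(1) w] q_pos[of z] by (subst ln_le_cancel_iff) auto
      also have "\<dots> = ln 8 + ln ((norm (z - w))\<^sup>2)" using nK[OF z(1) w] by (intro ln_mult_pos) auto
      also have "ln ((norm (z - w))\<^sup>2) = 2 * ln (norm (z - w))" using ln_realpow[of "norm (z - w)" 2] by simp
      finally show "(ln ((norm z)\<^sup>2 + 1) - ln 8) / 2 \<le> ln (norm (z - w))" by simp
    qed
    then show ?thesis by (simp add: \<phi>_def)
  qed
  have Fne: "F n \<noteq> {}" using n by auto
  have near: "- p z \<le> ln 3 + m" if z: "z \<in> \<Omega>" for z
  proof -
    \<comment> \<open>An almost nearest point of the set on which the potential is bounded.\<close>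
    define d where "d = infdist z (F n)"
    have "\<not> z \<in> closure (F n)"
    proof -
      have "closure (F n) \<subseteq> K" using compact_imp_closed[OF K(1)] by (intro closure_minimal) (auto simp: F_def)
      then show ?thesis using z K(2) by blast
    qed
    then have d: "d > 0" using Fne infdist_nonneg[of z "F n"] by (auto simp: d_def in_closure_iff_infdist_zero less_le)
    obtain z' where z': "z' \<in> F n" "dist z z' < 2 * d"
    proof -
      have "(INF a\<in>F n. dist z a) < 2 * d" using d Fne by (simp add: d_def infdist_notempty)
      then show ?thesis using that Fne by (subst (asm) cINF_less_iff) (auto intro: bdd_belowI2[where m = 0])
    qed
    have "- p z = (LINT w|\<nu>. - ln (norm (z - w)))" by (simp add: p_def)
    also have "\<dots> \<le> enn2real (\<integral>\<^sup>+w. ennreal (- ln (norm (z - w))) \<partial>\<nu>)"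
      using ip[OF z] by (subst real_lebesgue_integral_def) auto
    also have "\<dots> \<le> ln 3 + m"
    proof (rule enn2real_leI)
      have "(\<integral>\<^sup>+w. ennreal (- ln (norm (z - w))) \<partial>\<nu>) \<le> (\<integral>\<^sup>+w. ennreal (ln 3) + neg_log z' w \<partial>\<nu>)"
      proof (rule nn_integral_mono_AE, use AEF in eventually_elim)
        fix w assume w: "w \<in> F n"
        show "ennreal (- ln (norm (z - w))) \<le> ennreal (ln 3) + neg_log z' w"
        proof (cases "z' = w")
          case False
          have "d \<le> norm (z - w)" using infdist_le[OF w, of z] by (simp add: d_def dist_norm)
          moreover have "norm (z' - w) \<le> norm (z' - z) + norm (z - w)" using norm_triangle_ineq[of "z' - z" "z - w"] by simp
          moreover have "norm (z' - z) < 2 * d" using z'(2) by (simp add: dist_norm norm_minus_commute)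
          ultimately have "norm (z' - w) \<le> 3 * norm (z - w)" by argo
          moreover have "0 < norm (z' - w)" using False by simp
          moreover have zw: "0 < norm (z - w)" using nK[OF z, of w] w by (simp add: F_def)
          ultimately have "ln (norm (z' - w)) \<le> ln (3 * norm (z - w))" by (subst ln_le_cancel_iff) auto
          also have "\<dots> = ln 3 + ln (norm (z - w))" using zw by (intro ln_mult_pos) auto
          finally have "- ln (norm (z - w)) \<le> ln 3 + max 0 (- ln (norm (z' - w)))" by simp
          then have "ennreal (- ln (norm (z - w))) \<le> ennreal (ln 3 + max 0 (- ln (norm (z' - w))))" by (rule ennreal_leI)
          also have "\<dots> = ennreal (ln 3) + ennreal (max 0 (- ln (norm (z' - w))))" by (rule ennreal_plus) simp_all
          also have "ennreal (max 0 (- ln (norm (z' - w)))) = ennreal (- ln (norm (z' - w)))" by (simp add: max_def ennreal_neg)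
          finally show ?thesis using False by (simp add: neg_log_eq)
        qed (simp add: neg_log_eq)
      qed
      also have "\<dots> = ennreal (ln 3) + (\<integral>\<^sup>+w. neg_log z' w \<partial>\<nu>)"
        by (simp add: nn_integral_add \<nu>.emeasure_space_1)
      also have "\<dots> \<le> ennreal (ln 3) + ennreal m" by (intro add_left_mono pot z')
      also have "\<dots> = ennreal (ln 3 + m)" by (rule ennreal_plus[symmetric]) (use m0 in auto)
      finally show "(\<integral>\<^sup>+w. ennreal (- ln (norm (z - w))) \<partial>\<nu>) \<le> ennreal (ln 3 + m)" .
    qed (use m0 in simp)
    finally show ?thesis .
  qed
  have upper: "\<phi> z \<le> ln 8 + ln ((2 * R)\<^sup>2 + 1) + 2 * (ln 3 + m)" if z: "z \<in> \<Omega>" for z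
  proof (cases "2 * R \<le> norm z")
    case True
    have "0 \<le> ln ((2 * R)\<^sup>2 + 1)" "0 \<le> ln (3::real)" by simp_all
    then show ?thesis using far[OF z True] m0 by argo
  next
    case False
    then have "(norm z)\<^sup>2 + 1 \<le> (2 * R)\<^sup>2 + 1" by (intro add_right_mono power_mono) auto
    then have "ln ((norm z)\<^sup>2 + 1) \<le> ln ((2 * R)\<^sup>2 + 1)" using q_pos[of z] by (subst ln_le_cancel_iff) auto
    moreover have "0 \<le> ln (8::real)" by simp
    ultimately show ?thesis using near[OF z] unfolding \<phi>_def by argo
  qed
  have "bounded (\<phi> ` \<Omega>)"
  proof (rule bounded_subset)
    show "\<phi> ` \<Omega> \<subseteq> {- ln (2 * R\<^sup>2) .. ln 8 + ln ((2 * R)\<^sup>2 + 1) + 2 * (ln 3 + m)}" using lower upper by auto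
  qed (rule bounded_closed_interval)
  with smooth lap show ?thesis by blast
qed

section \<open>The equivalence\<close>

theorem theorem1p4:
  fixes \<Omega> :: "complex set"
  assumes "open \<Omega>" and "\<Omega> \<noteq> {}"
  shows "(bergman_space \<Omega> \<noteq> {0} \<longleftrightarrow> infinite_dimensional (bergman_space \<Omega>))
    \<and> (infinite_dimensional (bergman_space \<Omega>) \<longleftrightarrow> log_capacity (- \<Omega>) > 0)
    \<and> (log_capacity (- \<Omega>) > 0 \<longleftrightarrow>
        (\<exists>\<phi> :: complex \<Rightarrow> real. bounded (\<phi> ` \<Omega>) \<and> \<phi> smooth_on \<Omega> \<and> (\<forall>z\<in>\<Omega>. laplacian \<phi> z > 0)))"
proof -
  let ?A = "bergman_space \<Omega>"
  have zero: "0 \<in> ?A"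
    by (rule cfun.subspace_0[OF subspace_bergman_space[OF assms(1)]])
  have nonzero: "?A \<noteq> {0}" if "infinite_dimensional ?A"
  proof
    assume "?A = {0}"
    then have "?A \<subseteq> cfun.span {}" by simp
    then have "\<exists>B. finite B \<and> B \<subseteq> ?A \<and> ?A \<subseteq> cfun.span B"
      by (intro exI[of _ "{}"] conjI finite.emptyI empty_subsetI)
    with that show False unfolding infinite_dimensional_def by contradiction
  qed
  have capacity: "log_capacity (- \<Omega>) > 0" if "?A \<noteq> {0}"
  proof (rule ccontr)
    assume "\<not> ?thesis"
    then have cap: "log_capacity (- \<Omega>) = 0" by simp
    have "f = 0" if f: "f \<in> ?A" for f
    proof
      fix z
      show "f z = 0 z"
      proof (cases "z \<in> \<Omega>")
        case True
        then show ?thesis using zero_capacity_bergman_eq_0[OF assms(1) cap f] by (simp add: zero_fun_def)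
      next
        case False
        then show ?thesis using f by (simp add: bergman_space_def zero_fun_def)
      qed
    qed
    then have "?A = {0}" using zero by blast
    with that show False by contradiction
  qed
  have subharmonic: "log_capacity (- \<Omega>) > 0"
    if "bounded (\<phi> ` \<Omega>)" "\<phi> smooth_on \<Omega>" "\<forall>z\<in>\<Omega>. laplacian \<phi> z > 0" for \<phi> :: "complex \<Rightarrow> real"
  proof (rule ccontr)
    assume "\<not> ?thesis"
    then have "log_capacity (- \<Omega>) = 0" by simp
    from zero_capacity_no_bounded_subharmonic[OF assms this that] show False .
  qed
  note infinite = positive_capacity_bergman_infinite_dimensional[OF assms]
  note exists = positive_capacity_bounded_subharmonic[OF assms]
  show ?thesis
  proof (intro conjI iffI)
    show "infinite_dimensional ?A" if "?A \<noteq> {0}" by (rule infinite[OF capacity[OF that]])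
    show "?A \<noteq> {0}" if "infinite_dimensional ?A" by (rule nonzero[OF that])
    show "log_capacity (- \<Omega>) > 0" if "infinite_dimensional ?A" by (rule capacity[OF nonzero[OF that]])
    show "infinite_dimensional ?A" if "log_capacity (- \<Omega>) > 0" by (rule infinite[OF that])
    show "\<exists>\<phi> :: complex \<Rightarrow> real. bounded (\<phi> ` \<Omega>) \<and> \<phi> smooth_on \<Omega> \<and> (\<forall>z\<in>\<Omega>. laplacian \<phi> z > 0)"
      if "log_capacity (- \<Omega>) > 0" by (rule exists[OF that])
    assume "\<exists>\<phi> :: complex \<Rightarrow> real. bounded (\<phi> ` \<Omega>) \<and> \<phi> smooth_on \<Omega> \<and> (\<forall>z\<in>\<Omega>. laplacian \<phi> z > 0)"
    then show "log_capacity (- \<Omega>) > 0" by (elim exE conjE) (rule subharmonic)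
  qed
qed

end
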